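(* Let $c\in\mathbb R$. Assume that $\mathbf E|X|^{2+\delta}<\infty$ for some $\delta>0$ and that $\mathbf E|X|^{p(c)}<\infty$. Then for all $b\ge 0$ and $a>c\sqrt b$ the function $$W(a,b):=\lim_{n\to\infty}\mathbf E\big[V_{p(c)}(a+S(n),b+n);\,T_{a,b}>n\big]$$ is well-defined (the limit exists and is finite) and satisfies $$W(a,b)=\mathbf E\big[W(a+S(n),b+n);\,T_{a,b}>n\big],\qquad n\ge 1.$$ Moreover, for each $b\ge0$ the mapping $a\mapsto W(a,b)$ is monotone increasing (i.e. $W(a,b)\le W(a',b)$ whenever $c\sqrt b<a\le a'$), and for every $\varepsilon>0$ $$W(x,t)\sim V_{p(c)}(x,t)\quad\text{as } x\to\infty,\ t\to\infty \text{ with } \frac{x}{\sqrt t}\ge c+\varepsilon,$$ i.e. $W(x,t)/V_{p(c)}(x,t)\to1$ in this regime.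
   Context: $X_1,X_2,\dots$ are independent copies of a real random variable $X$ with $\mathbf E X=0$ and $\mathbf E X^2=1$; $S(0)=0$, $S(n)=X_1+\dots+X_n$. For a random variable $Y$ and an event $A$, $\mathbf E[Y;A]:=\mathbf E[Y\mathbf 1_A]$. For $c\in\mathbb R$, $b\ge0$ and $a>c\sqrt b$, $T_{a,b}:=\inf\{n\ge1: a+S(n)\le c\sqrt{n+b}\}$. $D_p$ denotes the parabolic cylinder function, i.e. the solution of $w''(z)+(p+\tfrac12-\tfrac{z^2}4)w(z)=0$ with $D_p(z)\sim z^pe^{-z^2/4}$ as $z\to+\infty$. For $p\in\mathbb R$ set $\psi_p(x):=e^{x^2/4}D_p(x)$, $V_p(x,t):=t^{p/2}\psi_p(x/\sqrt t)$ for $t>0$, $x\in\mathbb R$, and $V_p(x,0):=x^p$ for $x>0$. For $c\in\mathbb R$, $p(c)$ denotes the minimal positive root of $p\mapsto\psi_p(c)$. *)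

theory Defs
  imports "HOL-Probability.Probability" "HOL-Library.Landau_Symbols"
begin

definition is_parabolic_cylinder :: "real \<Rightarrow> (real \<Rightarrow> real) \<Rightarrow> bool" where
  "is_parabolic_cylinder p w \<longleftrightarrow>
     (\<exists>w' w''. \<forall>z. (w has_real_derivative w' z) (at z) \<and>
                (w' has_real_derivative w'' z) (at z) \<and>
                w'' z + (p + 1/2 - z\<^sup>2 / 4) * w z = 0) \<and>
     w \<sim>[at_top] (\<lambda>z. z powr p * exp (- z\<^sup>2 / 4))"

definition parabolic_cylinder :: "real \<Rightarrow> real \<Rightarrow> real" where
  "parabolic_cylinder p = (THE w. is_parabolic_cylinder p w)"

definition psi :: "real \<Rightarrow> real \<Rightarrow> real" where
  "psi p x = exp (x\<^sup>2 / 4) * parabolic_cylinder p x"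

(* Meant for t > 0 with x arbitrary, and for t = 0 with x > 0. *)
definition V :: "real \<Rightarrow> real \<Rightarrow> real \<Rightarrow> real" where
  "V p x t = (if t = 0 then x powr p else t powr (p / 2) * psi p (x / sqrt t))"

definition min_root :: "real \<Rightarrow> real" where
  "min_root c = (LEAST p. p > 0 \<and> psi p c = 0)"

(* Steps are indexed from 1; the value of the sequence at 0 is never used. *)
definition walk :: "(nat \<Rightarrow> 'a \<Rightarrow> real) \<Rightarrow> nat \<Rightarrow> 'a \<Rightarrow> real" where
  "walk X n \<omega> = (\<Sum>i=1..n. X i \<omega>)"

(* The infimum is taken in enat, so it is \<infinity> if the boundary is never crossed. *)
definition exit_time :: "(nat \<Rightarrow> 'a \<Rightarrow> real) \<Rightarrow> real \<Rightarrow> real \<Rightarrow> real \<Rightarrow> 'a \<Rightarrow> enat" where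
  "exit_time X c a b \<omega> =
     Inf {enat n |n. n \<ge> 1 \<and> a + walk X n \<omega> \<le> c * sqrt (real n + b)}"

definition survival :: "'a measure \<Rightarrow> (nat \<Rightarrow> 'a \<Rightarrow> real) \<Rightarrow> real \<Rightarrow> real \<Rightarrow> real \<Rightarrow> nat \<Rightarrow> 'a set" where
  "survival M X c a b n = {\<omega> \<in> space M. exit_time X c a b \<omega> > enat n}"

(* Meaningful for b \<ge> 0 and a > c * sqrt b; elsewhere the value is irrelevant. *)
definition W :: "'a measure \<Rightarrow> (nat \<Rightarrow> 'a \<Rightarrow> real) \<Rightarrow> real \<Rightarrow> real \<Rightarrow> real \<Rightarrow> real" where
  "W M X c a b =
     lim (\<lambda>n. LINT \<omega>:survival M X c a b n|M. V (min_root c) (a + walk X n \<omega>) (b + real n))"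

end

theory Submission
  imports Defs "HOL-Real_Asymp.Real_Asymp"
begin

text \<open>
  Write \<open>He p\<close> for the function \<open>psi p\<close>, the Hermite function of real order \<open>p\<close>, and
  \<open>V p x t = t powr (p / 2) * He p (x / sqrt t)\<close>. The equation of \<open>He p\<close> says that \<open>V p\<close> solves the
  backward heat equation. For \<open>p = min_root c\<close> it vanishes on the boundary \<open>x = c * sqrt t\<close> and
  is positive above it, so it is harmonic for Brownian motion killed at the boundary. For the
  random walk it is harmonic only up to an error, and the point is to control this error along
  the whole trajectory, including near the boundary, with little more than two moments.

  There are two kinds of error. The Taylor remainder and the large jumps contribute
  about \<open>t powr (p / 2 - 1 - \<delta> / 2)\<close>, with either sign. Jumps over the boundary replace a negative
  value of \<open>V p\<close> by \<open>0\<close>; this contribution is much larger near the boundary, but it has only one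
  sign. Both are absorbed by the perturbation \<open>h x t = t powr - \<gamma> * V q x t\<close> with
  \<open>q = p - 2 * \<gamma>\<close> and \<open>\<gamma>\<close> small. As \<open>q < min_root c\<close>, \<open>V q\<close> is positive up to the boundary and a
  little beyond it; the decreasing factor \<open>t powr - \<gamma>\<close> makes \<open>h\<close> strictly superharmonic, with
  a gain \<open>\<gamma> * t powr (- \<gamma> - 1) * V q x t\<close> that beats the errors of the first kind. Moreover
  \<open>V p + h\<close> is still nonnegative, and \<open>V p - h\<close> nonpositive, in a layer below the boundary that
  only large jumps can cross, so that killing lowers the expectation of the former and
  raises that of the latter. Hence, for late times, the killed transition operator \<open>P\<close> satisfies
  \<open>P (V p + h) \<le> V p + h\<close> and \<open>P (V p - h) \<ge> V p - h\<close> (lemma \<open>almost_harmonic\<close>).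

  The rest is soft. For late times the sequence \<open>(P ^^ n) h\<close> decreases, \<open>(P ^^ n) (V p - h)\<close> increases and both are
  bounded by \<open>V p + h\<close>, hence \<open>(P ^^ n) (V p)\<close> converges to a limit between \<open>V p - h\<close> and \<open>V p + h\<close>
  (lemma \<open>limit_late\<close>). Since \<open>h / V p\<close> is at most of order \<open>t powr (- 2 * \<gamma>)\<close> for \<open>x / sqrt t \<ge> c + \<epsilon>\<close>, this
  gives the asymptotics. Early times are reduced to late ones, and harmonicity is obtained, by dominated
  convergence in a single step (lemma \<open>limit_one_step\<close>). Monotonicity holds for each \<open>(P ^^ n) (V p)\<close>
  because \<open>He p\<close> increases on \<open>{c..}\<close> and a higher starting point survives longer.

  The facts about \<open>He p\<close> come from \<open>He r' = r * He (r - 1)\<close> together with the three-term recurrence. The minimal root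
  exists because the orders \<open>p \<ge> 0\<close> for which all \<open>He q\<close> with \<open>q \<le> p\<close> are positive on \<open>{c..}\<close> form
  a bounded interval that is open on the right: its supremum is \<open>min_root c\<close>.
\<close>

section \<open>Hermite functions of real order\<close>

text \<open>
  Up to the factor \<open>Gamma \<nu>\<close>, the integral of this kernel is the classical representation of the Hermite function of
  negative order \<open>- \<nu>\<close>. Nonnegative orders are reached from it by the recurrence.
\<close>

definition mellin_kernel :: "real \<Rightarrow> real \<Rightarrow> real \<Rightarrow> real" where
  "mellin_kernel \<nu> x s = indicator {0<..} s * (s powr (\<nu> - 1) * exp (- x * s - s\<^sup>2 / 2))"

definition gauss_mellin :: "real \<Rightarrow> real \<Rightarrow> real" where
  "gauss_mellin \<nu> x = (LINT s|lborel. mellin_kernel \<nu> x s)"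

lemma mellin_kernel_nonneg: "mellin_kernel \<nu> x s \<ge> 0"
  by (simp add: mellin_kernel_def)

lemma mellin_kernel_measurable [measurable]: "mellin_kernel \<nu> x \<in> borel_measurable lborel"
  unfolding mellin_kernel_def by measurable

definition gamma_kernel :: "real \<Rightarrow> real \<Rightarrow> real" where
  "gamma_kernel \<nu> s = indicator {0<..} s * (s powr (\<nu> - 1) * exp (- s))"

lemma gamma_kernel_measurable [measurable]: "gamma_kernel \<nu> \<in> borel_measurable lborel"
  unfolding gamma_kernel_def by measurable

lemma gamma_kernel_integral:
  assumes "\<nu> > 0"
  shows "integrable lborel (gamma_kernel \<nu>)" "(LINT s|lborel. gamma_kernel \<nu> s) = Gamma \<nu>"
proof -
  have "(\<integral>\<^sup>+s. ennreal (gamma_kernel \<nu> s) \<partial>lborel) =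
      (\<integral>\<^sup>+t. ennreal (indicator {0..} t * t powr (\<nu> - 1) / exp t) \<partial>lborel)"
    by (intro nn_integral_cong) (auto simp: gamma_kernel_def indicator_def exp_minus field_simps)
  also have "\<dots> = ennreal (Gamma \<nu>)"
    by (rule Gamma_conv_nn_integral_real[OF assms, symmetric])
  finally have eq: "(\<integral>\<^sup>+s. ennreal (gamma_kernel \<nu> s) \<partial>lborel) = ennreal (Gamma \<nu>)" .
  have nn: "gamma_kernel \<nu> s \<ge> 0" for s by (simp add: gamma_kernel_def)
  have pos: "Gamma \<nu> \<ge> 0" using Gamma_real_pos[OF assms] by simp
  show "integrable lborel (gamma_kernel \<nu>)"
    using eq nn by (intro integrableI_nn_integral_finite) auto
  show "(LINT s|lborel. gamma_kernel \<nu> s) = Gamma \<nu>"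
    using eq nn pos by (subst integral_eq_nn_integral) auto
qed

lemma mellin_kernel_le_gamma: "mellin_kernel \<nu> x s \<le> exp ((1 - x)\<^sup>2 / 2) * gamma_kernel \<nu> s"
proof -
  have "(s - (1 - x))\<^sup>2 \<ge> 0" by simp
  then have "- x * s - s\<^sup>2 / 2 \<le> (1 - x)\<^sup>2 / 2 + - s"
    by (simp add: power2_eq_square algebra_simps)
  then have "exp (- x * s - s\<^sup>2 / 2) \<le> exp ((1 - x)\<^sup>2 / 2) * exp (- s)"
    by (simp flip: exp_add)
  from mult_left_mono[OF this, of "indicator {0<..} s * s powr (\<nu> - 1)"]
  show ?thesis by (simp add: mellin_kernel_def gamma_kernel_def ac_simps)
qed

lemma mellin_kernel_integrable:
  assumes "\<nu> > 0" shows "integrable lborel (mellin_kernel \<nu> x)"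
  by (rule Bochner_Integration.integrable_bound[where
        f = "\<lambda>s. exp ((1 - x)\<^sup>2 / 2) * gamma_kernel \<nu> s"])
     (use gamma_kernel_integral(1)[OF assms] mellin_kernel_le_gamma[of \<nu> x] mellin_kernel_nonneg[of \<nu> x]
        in \<open>auto intro!: AE_I2 intro: order_trans[OF _ abs_ge_self]\<close>)

lemma gauss_mellin_pos:
  assumes "\<nu> > 0" shows "gauss_mellin \<nu> x > 0"
proof -
  have "gauss_mellin \<nu> x \<noteq> 0"
  proof
    assume "gauss_mellin \<nu> x = 0"
    then have "AE s in lborel. mellin_kernel \<nu> x s = 0"
      unfolding gauss_mellin_def
      by (subst (asm) integral_nonneg_eq_0_iff_AE)
         (auto simp: mellin_kernel_nonneg mellin_kernel_integrable[OF assms])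
    then have "AE s in lborel. \<not> (s::real) > 0"
      by (rule AE_mp) (auto simp: mellin_kernel_def)
    then have "AE s in lborel. s \<notin> {0<..<1::real}" by (rule AE_mp) auto
    then have "emeasure lborel {0<..<1::real} = 0"
      by (subst (asm) AE_iff_measurable[OF _ refl]) (auto simp: greaterThanLessThan_def Int_def)
    then show False by simp
  qed
  moreover have "gauss_mellin \<nu> x \<ge> 0"
    unfolding gauss_mellin_def by (rule integral_nonneg_AE) (simp add: mellin_kernel_nonneg)
  ultimately show ?thesis by simp
qed

lemma exp_second_order_bound: "\<bar>exp z - 1 - z\<bar> \<le> z\<^sup>2 * exp \<bar>z\<bar>" for z :: real
proof -
  obtain t where t: "\<bar>t\<bar> \<le> \<bar>z\<bar>" "exp z = (\<Sum>m<2. z ^ m / fact m) + exp t / fact 2 * z ^ 2"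
    using Maclaurin_exp_le by blast
  have "exp z - 1 - z = exp t / 2 * z\<^sup>2"
    using t(2) by (simp add: numeral_2_eq_2)
  then have "\<bar>exp z - 1 - z\<bar> = z\<^sup>2 * (exp t / 2)" by (simp only: abs_mult) simp
  also have "\<dots> \<le> z\<^sup>2 * exp \<bar>z\<bar>"
  proof (rule mult_left_mono)
    have "exp t \<le> exp \<bar>z\<bar>" using t(1) by simp
    then show "exp t / 2 \<le> exp \<bar>z\<bar>" using exp_gt_zero[of t] by linarith
  qed simp
  finally show ?thesis .
qed

lemma mellin_kernel_mult: "s * mellin_kernel \<nu> x s = mellin_kernel (\<nu> + 1) x s"
  by (cases "s > 0") (simp_all add: mellin_kernel_def powr_diff field_simps powr_add)

text \<open>
  Differentiation under the integral sign. The second-order bound for the exponential bounds the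
  error of the difference quotient by another integral of the same family, at \<open>\<nu> + 2\<close> and \<open>x - 1\<close>.
\<close>

lemma gauss_mellin_has_derivative:
  assumes "\<nu> > 0"
  shows "(gauss_mellin \<nu> has_real_derivative - gauss_mellin (\<nu> + 1) x) (at x)"
proof -
  note int = mellin_kernel_integrable
  have key: "\<bar>gauss_mellin \<nu> (x + h) - gauss_mellin \<nu> x + h * gauss_mellin (\<nu> + 1) x\<bar>
      \<le> h\<^sup>2 * gauss_mellin (\<nu> + 2) (x - 1)" if "\<bar>h\<bar> \<le> 1" for h
  proof -
    have pw: "\<bar>mellin_kernel \<nu> (x + h) s - mellin_kernel \<nu> x s + h * mellin_kernel (\<nu> + 1) x s\<bar>
        \<le> h\<^sup>2 * mellin_kernel (\<nu> + 2) (x - 1) s" for s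
    proof (cases "s > 0")
      case True
      have shift: "mellin_kernel \<nu> (x + h) s = mellin_kernel \<nu> x s * exp (- (h * s))"
        by (simp add: mellin_kernel_def algebra_simps flip: exp_add)
      have e1: "exp (\<bar>h * s\<bar>) \<le> exp s"
        using that True by (simp add: abs_mult mult_left_le_one_le)
      have "\<bar>mellin_kernel \<nu> (x + h) s - mellin_kernel \<nu> x s + h * mellin_kernel (\<nu> + 1) x s\<bar>
          = mellin_kernel \<nu> x s * \<bar>exp (- (h * s)) - 1 - (- (h * s))\<bar>"
      proof -
        have "mellin_kernel \<nu> (x + h) s - mellin_kernel \<nu> x s + h * mellin_kernel (\<nu> + 1) x s
            = mellin_kernel \<nu> x s * (exp (- (h * s)) - 1 - (- (h * s)))"
          unfolding shift mellin_kernel_mult[of s \<nu> x, symmetric] by (simp add: algebra_simps)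
        then show ?thesis using mellin_kernel_nonneg[of \<nu> x s] by (simp only: abs_mult abs_of_nonneg)
      qed
      also have "\<dots> \<le> mellin_kernel \<nu> x s * ((h * s)\<^sup>2 * exp s)"
      proof (rule mult_left_mono[OF _ mellin_kernel_nonneg])
        have "\<bar>exp (- (h * s)) - 1 - (- (h * s))\<bar> \<le> (- (h * s))\<^sup>2 * exp \<bar>- (h * s)\<bar>"
          by (rule exp_second_order_bound)
        also have "\<dots> \<le> (h * s)\<^sup>2 * exp s" using e1 by (simp add: mult_left_mono)
        finally show "\<bar>exp (- (h * s)) - 1 - (- (h * s))\<bar> \<le> (h * s)\<^sup>2 * exp s" .
      qed
      also have "\<dots> = h\<^sup>2 * mellin_kernel (\<nu> + 2) (x - 1) s"
      proof -
        have "s powr (\<nu> + 1) = s powr (\<nu> - 1) * s\<^sup>2"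
          using True by (simp add: add.commute flip: powr_numeral powr_add)
        moreover have "exp (- (x - 1) * s - s\<^sup>2 / 2) = exp (- x * s - s\<^sup>2 / 2) * exp s"
          by (simp add: algebra_simps flip: exp_add)
        ultimately show ?thesis using True
          by (simp add: mellin_kernel_def power_mult_distrib algebra_simps)
      qed
      finally show ?thesis .
    qed (simp add: mellin_kernel_def)
    have "gauss_mellin \<nu> (x + h) - gauss_mellin \<nu> x + h * gauss_mellin (\<nu> + 1) x =
        (LINT s|lborel. mellin_kernel \<nu> (x + h) s - mellin_kernel \<nu> x s + h * mellin_kernel (\<nu> + 1) x s)"
      unfolding gauss_mellin_def using assms by (simp add: int)
    also have "\<bar>\<dots>\<bar> \<le> (LINT s|lborel. h\<^sup>2 * mellin_kernel (\<nu> + 2) (x - 1) s)"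
      using pw assms by (intro integral_abs_bound[THEN order_trans] integral_mono) (auto simp: int)
    also have "\<dots> = h\<^sup>2 * gauss_mellin (\<nu> + 2) (x - 1)" by (simp add: gauss_mellin_def)
    finally show ?thesis .
  qed
  define C where "C = gauss_mellin (\<nu> + 2) (x - 1)"
  have "((\<lambda>h. (gauss_mellin \<nu> (x + h) - gauss_mellin \<nu> x) / h - (- gauss_mellin (\<nu> + 1) x)) \<longlongrightarrow> 0) (at 0)"
  proof (rule Lim_null_comparison)
    show "\<forall>\<^sub>F h in at 0. norm ((gauss_mellin \<nu> (x + h) - gauss_mellin \<nu> x) / h - (- gauss_mellin (\<nu> + 1) x))
        \<le> \<bar>h\<bar> * C"
      unfolding eventually_at
    proof (intro exI[of _ 1] conjI ballI impI)
      fix h :: real assume h: "h \<noteq> 0 \<and> dist h 0 < 1"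
      have "(gauss_mellin \<nu> (x + h) - gauss_mellin \<nu> x) / h - (- gauss_mellin (\<nu> + 1) x) =
          (gauss_mellin \<nu> (x + h) - gauss_mellin \<nu> x + h * gauss_mellin (\<nu> + 1) x) / h"
        using h by (simp add: field_simps)
      then show "norm ((gauss_mellin \<nu> (x + h) - gauss_mellin \<nu> x) / h - (- gauss_mellin (\<nu> + 1) x))
        \<le> \<bar>h\<bar> * C"
        using key[of h] h
        by (simp add: C_def abs_divide divide_le_eq power2_eq_square ac_simps flip: abs_mult)
    qed simp
    show "((\<lambda>h. \<bar>h\<bar> * C) \<longlongrightarrow> 0) (at 0)" by (auto intro!: tendsto_eq_intros)
  qed
  then show ?thesis
    unfolding DERIV_def by (rule LIM_zero_cancel)
qed

text \<open>
  The derivative of \<open>s powr \<nu> * exp (- x * s - s\<^sup>2 / 2)\<close> integrates to \<open>0\<close> over the half-line. This is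
  the Hermite equation for negative orders, in integrated form.
\<close>

lemma gauss_mellin_recurrence:
  assumes "\<nu> > 0"
  shows "\<nu> * gauss_mellin \<nu> x = x * gauss_mellin (\<nu> + 1) x + gauss_mellin (\<nu> + 2) x"
proof -
  define F where "F s = s powr \<nu> * exp (- x * s - s\<^sup>2 / 2)" for s
  define f where "f s = \<nu> * mellin_kernel \<nu> x s - x * mellin_kernel (\<nu> + 1) x s - mellin_kernel (\<nu> + 2) x s" for s
  have f_eq: "f s = \<nu> * (s powr (\<nu> - 1) * exp (- x * s - s\<^sup>2 / 2))
      + s powr \<nu> * (exp (- x * s - s\<^sup>2 / 2) * (- x - s))" if "s > 0" for s
  proof -
    have "s powr (\<nu> + 1) = s powr \<nu> * s" using that by (simp add: powr_add)
    with that show ?thesis by (simp add: f_def mellin_kernel_def algebra_simps)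
  qed
  have fint: "integrable lborel f"
    unfolding f_def using assms
    by (intro Bochner_Integration.integrable_diff Bochner_Integration.integrable_mult_right
          mellin_kernel_integrable) auto
  have ein: "einterval 0 \<infinity> = {0<..}" by (auto simp: einterval_def zero_ereal_def)
  have f0: "indicator {0<..} s *\<^sub>R f s = f s" for s
    by (auto simp: f_def mellin_kernel_def indicator_def)
  have "(LBINT s=0..\<infinity>. f s) = 0 - 0"
  proof (rule interval_integral_FTC_integrable[where F = F])
    show "(0::ereal) < \<infinity>" by simp
    show "(F has_vector_derivative f s) (at s)" if "0 < ereal s" for s
    proof -
      have s: "s > 0" using that by (simp add: zero_ereal_def)
      show ?thesis unfolding F_def has_real_derivative_iff_has_vector_derivative[symmetric] f_eq[OF s]
        by (rule derivative_eq_intros refl | use s in \<open>simp add: powr_diff field_simps power2_eq_square\<close>)+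
    qed
    show "isCont f s" if "0 < ereal s" for s
    proof -
      have s: "s > 0" using that by (simp add: zero_ereal_def)
      have "isCont (\<lambda>s. \<nu> * (s powr (\<nu> - 1) * exp (- x * s - s\<^sup>2 / 2))
          + s powr \<nu> * (exp (- x * s - s\<^sup>2 / 2) * (- x - s))) s"
        using s by (intro continuous_intros) auto
      moreover have "\<forall>\<^sub>F r in nhds s. r > 0"
        using eventually_nhds_in_open[of "{0<..}" s] s by simp
      ultimately show ?thesis
        by (subst isCont_cong[where g = "\<lambda>s. \<nu> * (s powr (\<nu> - 1) * exp (- x * s - s\<^sup>2 / 2))
          + s powr \<nu> * (exp (- x * s - s\<^sup>2 / 2) * (- x - s))"]) (auto elim!: eventually_mono simp: f_eq)
    qed
    show "set_integrable lborel (einterval 0 \<infinity>) f"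
      unfolding ein set_integrable_def f0 by (rule fint)
    have "(F \<longlongrightarrow> 0) (at_right 0)"
    proof (rule tendsto_eq_rhs)
      show "(F \<longlongrightarrow> 0 * exp (- x * 0 - 0\<^sup>2 / 2)) (at_right 0)"
        unfolding F_def
        by (intro tendsto_intros tendsto_exp)
           (use assms in \<open>auto intro!: tendsto_eq_intros simp: eventually_at_filter\<close>)
    qed simp
    then show "((F \<circ> real_of_ereal) \<longlongrightarrow> 0) (at_right 0)"
      by (simp add: zero_ereal_def ereal_tendsto_simps)
    have "(F \<longlongrightarrow> 0) at_top"
    proof (rule Lim_null_comparison)
      show "\<forall>\<^sub>F s in at_top. norm (F s) \<le> exp ((1 - x)\<^sup>2 / 2) * (s powr \<nu> * exp (- s))"
        using eventually_gt_at_top[of 0]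
      proof eventually_elim
        case (elim s)
        then show ?case using mellin_kernel_le_gamma[of "\<nu> + 1" x s]
          by (simp add: F_def mellin_kernel_def gamma_kernel_def)
      qed
      have "((\<lambda>s::real. s powr \<nu> * exp (- s)) \<longlongrightarrow> 0) at_top"
        by real_asymp
      then show "((\<lambda>s. exp ((1 - x)\<^sup>2 / 2) * (s powr \<nu> * exp (- s))) \<longlongrightarrow> 0) at_top"
        by (rule tendsto_mult_right_zero)
    qed
    then show "((F \<circ> real_of_ereal) \<longlongrightarrow> 0) (at_left \<infinity>)"
      by (simp add: ereal_tendsto_simps)
  qed
  then have "(LINT s|lborel. f s) = 0"
    unfolding interval_lebesgue_integral_def ein set_lebesgue_integral_def f0 by simp
  then show ?thesis
    unfolding f_def gauss_mellin_def using assms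
    by (simp add: mellin_kernel_integrable)
qed

text \<open>
  Replacing \<open>exp (- s\<^sup>2 / 2)\<close> by \<open>1\<close> and by \<open>1 - s\<^sup>2 / 2\<close> squeezes the integral between Laplace transforms
  of powers.
\<close>

lemma gauss_mellin_asymp:
  assumes "\<nu> > 0"
  shows "((\<lambda>x. gauss_mellin \<nu> x * x powr \<nu>) \<longlongrightarrow> Gamma \<nu>) at_top"
proof (rule tendsto_sandwich)
  have laplace: "integrable lborel (\<lambda>s. gamma_kernel \<mu> (x * s))"
      "(LINT s|lborel. gamma_kernel \<mu> (x * s)) = Gamma \<mu> / x" if "\<mu> > 0" "x > 0" for \<mu> x
  proof -
    show "integrable lborel (\<lambda>s. gamma_kernel \<mu> (x * s))"
      using lborel_integrable_real_affine[OF gamma_kernel_integral(1)[OF that(1)], of x 0] that(2) by simp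
    show "(LINT s|lborel. gamma_kernel \<mu> (x * s)) = Gamma \<mu> / x"
      using lborel_integral_real_affine[of x "gamma_kernel \<mu>" 0] that
      by (simp add: gamma_kernel_integral field_simps)
  qed
  have gk: "gamma_kernel \<mu> (x * s) = x powr (\<mu> - 1) * (indicator {0<..} s * (s powr (\<mu> - 1) * exp (- x * s)))"
    if "x > 0" for \<mu> x s
    using that by (auto simp: gamma_kernel_def indicator_def powr_mult zero_less_mult_iff)
  show "\<forall>\<^sub>F x in at_top. gauss_mellin \<nu> x * x powr \<nu> \<le> Gamma \<nu>"
    using eventually_gt_at_top[of 0]
  proof eventually_elim
    case (elim x)
    have "gauss_mellin \<nu> x \<le> (LINT s|lborel. x powr (1 - \<nu>) * gamma_kernel \<nu> (x * s))"
      unfolding gauss_mellin_def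
    proof (intro integral_mono)
      show "mellin_kernel \<nu> x s \<le> x powr (1 - \<nu>) * gamma_kernel \<nu> (x * s)" for s
        using elim unfolding gk[OF elim]
        by (simp add: mellin_kernel_def indicator_def mult_le_cancel_left flip: powr_add mult.assoc)
    qed (use elim assms laplace in \<open>auto intro!: mellin_kernel_integrable\<close>)
    also have "\<dots> = x powr (1 - \<nu>) * (Gamma \<nu> / x)"
      using elim assms laplace by simp
    also have "\<dots> = Gamma \<nu> / x powr \<nu>" using elim by (simp add: powr_diff)
    finally show ?case using elim by (simp add: field_simps)
  qed
  show "\<forall>\<^sub>F x in at_top. Gamma \<nu> - Gamma (\<nu> + 2) / (2 * x\<^sup>2) \<le> gauss_mellin \<nu> x * x powr \<nu>"
    using eventually_gt_at_top[of 0]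
  proof eventually_elim
    case (elim x)
    have "(LINT s|lborel. x powr (1 - \<nu>) * gamma_kernel \<nu> (x * s)
            - x powr (- 1 - \<nu>) / 2 * gamma_kernel (\<nu> + 2) (x * s)) \<le> gauss_mellin \<nu> x"
      unfolding gauss_mellin_def
    proof (intro integral_mono)
      show "x powr (1 - \<nu>) * gamma_kernel \<nu> (x * s)
            - x powr (- 1 - \<nu>) / 2 * gamma_kernel (\<nu> + 2) (x * s) \<le> mellin_kernel \<nu> x s" for s
      proof (cases "s > 0")
        case True
        have "1 - s\<^sup>2 / 2 \<le> exp (- (s\<^sup>2 / 2))" using exp_ge_add_one_self[of "- (s\<^sup>2 / 2)"] by simp
        from mult_left_mono[OF this, of "s powr (\<nu> - 1) * exp (- x * s)"]
        have low: "s powr (\<nu> - 1) * exp (- x * s) - s powr (\<nu> - 1) * s\<^sup>2 * exp (- x * s) / 2 \<le> mellin_kernel \<nu> x s"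
          using True by (simp add: mellin_kernel_def algebra_simps exp_diff exp_minus)
            (simp add: field_simps)
        have sq: "s powr (\<nu> + 2 - 1) = s powr (\<nu> - 1) * s\<^sup>2"
          using True by (simp flip: powr_numeral powr_add)
        have c1: "x powr (1 - \<nu>) * (x powr (\<nu> - 1) * a) = a" for a
          using elim by (simp flip: mult.assoc powr_add)
        have c2: "x powr (- 1 - \<nu>) / 2 * (x powr (\<nu> + 2 - 1) * a) = a / 2" for a
          using elim by (simp flip: mult.assoc powr_add)
        show ?thesis using True low sq unfolding gk[OF elim] c1 c2 by simp
      qed (simp add: gk[OF elim] mellin_kernel_def)
    qed (use elim assms laplace in \<open>auto intro!: mellin_kernel_integrable\<close>)
    also have "(LINT s|lborel. x powr (1 - \<nu>) * gamma_kernel \<nu> (x * s)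
            - x powr (- 1 - \<nu>) / 2 * gamma_kernel (\<nu> + 2) (x * s))
        = x powr (1 - \<nu>) * (Gamma \<nu> / x) - x powr (- 1 - \<nu>) / 2 * (Gamma (\<nu> + 2) / x)"
      using elim assms laplace by simp
    also have "\<dots> = (Gamma \<nu> - Gamma (\<nu> + 2) / (2 * x\<^sup>2)) / x powr \<nu>"
      using elim by (simp add: powr_diff powr_minus field_simps power2_eq_square)
    finally show ?case using elim by (simp add: field_simps)
  qed
  show "((\<lambda>x. Gamma \<nu> - Gamma (\<nu> + 2) / (2 * x\<^sup>2)) \<longlongrightarrow> Gamma \<nu>) at_top" by real_asymp
qed (rule tendsto_const)

lemma gauss_mellin_continuous:
  "continuous_on ({0<..} \<times> UNIV) (\<lambda>(\<nu>, x). gauss_mellin \<nu> x)"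
  unfolding continuous_on_sequentially
proof (intro allI ballI impI, elim conjE)
  fix u :: "nat \<Rightarrow> real \<times> real" and a
  assume a: "a \<in> {0<..} \<times> UNIV" and u: "\<forall>n. u n \<in> {0<..} \<times> UNIV" "u \<longlonglongrightarrow> a"
  obtain \<nu> x where ax: "a = (\<nu>, x)" "\<nu> > 0" using a by auto
  have lim: "(\<lambda>n. fst (u n)) \<longlonglongrightarrow> \<nu>" "(\<lambda>n. snd (u n)) \<longlonglongrightarrow> x"
    using tendsto_fst[OF u(2)] tendsto_snd[OF u(2)] ax by auto
  have "\<forall>\<^sub>F n in sequentially. fst (u n) > \<nu> / 2 \<and> fst (u n) < \<nu> + 1 \<and> snd (u n) > x - 1"
    using order_tendstoD(1)[OF lim(1), of "\<nu> / 2"] order_tendstoD(2)[OF lim(1), of "\<nu> + 1"]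
      order_tendstoD(1)[OF lim(2), of "x - 1"] ax(2) by (intro eventually_conj) auto
  then obtain N where N: "\<And>n. n \<ge> N \<Longrightarrow> fst (u n) > \<nu> / 2 \<and> fst (u n) < \<nu> + 1 \<and> snd (u n) > x - 1"
    unfolding eventually_sequentially by blast
  have "(\<lambda>n. gauss_mellin (fst (u (n + N))) (snd (u (n + N)))) \<longlonglongrightarrow> gauss_mellin \<nu> x"
    unfolding gauss_mellin_def
  proof (rule integral_dominated_convergence[where
        w = "\<lambda>s. mellin_kernel (\<nu> / 2) (x - 1) s + mellin_kernel (\<nu> + 1) (x - 1) s"])
    show "integrable lborel (\<lambda>s. mellin_kernel (\<nu> / 2) (x - 1) s + mellin_kernel (\<nu> + 1) (x - 1) s)"
      using ax(2) by (auto intro!: mellin_kernel_integrable)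
    have "(\<lambda>n. mellin_kernel (fst (u (n + N))) (snd (u (n + N))) s) \<longlonglongrightarrow> mellin_kernel \<nu> x s" for s
      unfolding mellin_kernel_def
      by (cases "s > 0")
         (auto intro!: tendsto_intros LIMSEQ_ignore_initial_segment[OF lim(1)] LIMSEQ_ignore_initial_segment[OF lim(2)])
    then show "AE s in lborel. (\<lambda>n. mellin_kernel (fst (u (n + N))) (snd (u (n + N))) s) \<longlonglongrightarrow> mellin_kernel \<nu> x s"
      by simp
    fix n
    have "mellin_kernel (fst (u (n + N))) (snd (u (n + N))) s
        \<le> mellin_kernel (\<nu> / 2) (x - 1) s + mellin_kernel (\<nu> + 1) (x - 1) s" for s
    proof (cases "s > 0")
      case True
      obtain \<mu> y where uy: "u (n + N) = (\<mu>, y)" by force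
      have b: "\<mu> > \<nu> / 2" "\<mu> < \<nu> + 1" "y > x - 1" using N[of "n + N"] uy by auto
      have 1: "s powr (\<mu> - 1) \<le> s powr (\<nu> / 2 - 1) + s powr (\<nu> + 1 - 1)"
      proof (cases "s \<ge> 1")
        case True
        then have "s powr (\<mu> - 1) \<le> s powr (\<nu> + 1 - 1)" using b by (intro powr_mono) auto
        then show ?thesis by (simp add: add_increasing)
      next
        case False
        then have "s powr (\<mu> - 1) \<le> s powr (\<nu> / 2 - 1)"
          using b \<open>s > 0\<close> by (intro powr_mono') auto
        then show ?thesis by (simp add: add_increasing2)
      qed
      have 2: "exp (- y * s - s\<^sup>2 / 2) \<le> exp (- (x - 1) * s - s\<^sup>2 / 2)"
        using mult_right_mono[of "- y" "- (x - 1)" s] b True by simp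
      show ?thesis using mult_mono[OF 1 2] True uy by (simp add: mellin_kernel_def distrib_right)
    qed (simp add: mellin_kernel_def)
    then show "AE s in lborel. norm (mellin_kernel (fst (u (n + N))) (snd (u (n + N))) s)
        \<le> mellin_kernel (\<nu> / 2) (x - 1) s + mellin_kernel (\<nu> + 1) (x - 1) s"
      by (simp add: mellin_kernel_nonneg)
  qed auto
  then have "(\<lambda>n. gauss_mellin (fst (u n)) (snd (u n))) \<longlonglongrightarrow> gauss_mellin \<nu> x"
    by (rule LIMSEQ_offset)
  then show "((\<lambda>(\<nu>, x). gauss_mellin \<nu> x) \<circ> u) \<longlonglongrightarrow> (case a of (\<nu>, x) \<Rightarrow> gauss_mellin \<nu> x)"
    by (simp add: ax o_def case_prod_beta)
qed

text \<open>
  The number \<open>n\<close> counts how often the recurrence is applied before a negative order is reached. The value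
  is the intended one for \<open>r < real n\<close>, and then it does not depend on \<open>n\<close>.
\<close>

primrec hermite_raise :: "nat \<Rightarrow> real \<Rightarrow> real \<Rightarrow> real" where
  "hermite_raise 0 r x = gauss_mellin (- r) x / Gamma (- r)"
| "hermite_raise (Suc n) r x = x * hermite_raise n (r - 1) x - (r - 1) * hermite_raise n (r - 2) x"

definition He :: "real \<Rightarrow> real \<Rightarrow> real" where
  "He r = hermite_raise (nat \<lceil>r\<rceil> + 1) r"

lemma hermite_raise_recurrence:
  "r < real n \<Longrightarrow>
   hermite_raise n r x = x * hermite_raise n (r - 1) x - (r - 1) * hermite_raise n (r - 2) x"
proof (induction n arbitrary: r)
  case 0
  define \<nu> where "\<nu> = - r"
  have \<nu>: "\<nu> > 0" "\<nu> \<noteq> 0" using 0 by (auto simp: \<nu>_def)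
  have G1: "Gamma (\<nu> + 1) = \<nu> * Gamma \<nu>" using \<nu> by (intro Gamma_plus1) (auto simp: nonpos_Ints_def)
  have G2: "Gamma (\<nu> + 2) = (\<nu> + 1) * (\<nu> * Gamma \<nu>)"
    using Gamma_plus1[of "\<nu> + 1"] \<nu> G1 by (auto simp: nonpos_Ints_def add.commute add.left_commute)
  have G0: "Gamma \<nu> > 0" using \<nu> by (rule_tac Gamma_real_pos)
  have "hermite_raise 0 r x = gauss_mellin \<nu> x / Gamma \<nu>" by (simp add: \<nu>_def)
  also have "\<dots> = (x * gauss_mellin (\<nu> + 1) x + gauss_mellin (\<nu> + 2) x) / (\<nu> * Gamma \<nu>)"
    using \<nu>(2) by (simp flip: gauss_mellin_recurrence[OF \<nu>(1), of x])
  also have "\<dots> = x * (gauss_mellin (\<nu> + 1) x / Gamma (\<nu> + 1))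
      + (\<nu> + 1) * (gauss_mellin (\<nu> + 2) x / Gamma (\<nu> + 2))"
  proof -
    have "(\<nu> + 1) * (a / ((\<nu> + 1) * (\<nu> * Gamma \<nu>))) = a / (\<nu> * Gamma \<nu>)" for a
      using \<nu>(1) by simp
    then show ?thesis unfolding G1 G2 by (simp only: add_divide_distrib times_divide_eq_right)
  qed
  also have "\<dots> = x * hermite_raise 0 (r - 1) x - (r - 1) * hermite_raise 0 (r - 2) x"
    by (simp add: \<nu>_def algebra_simps diff_divide_distrib)
  finally show ?case .
next
  case (Suc n)
  have "hermite_raise (Suc n) s x = hermite_raise n s x" if "s < real n" for s
    using Suc.IH[OF that] by simp
  from this[of "r - 1"] this[of "r - 2"] show ?case using Suc.prems by simp
qed

lemma hermite_raise_stable: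
  assumes "r < real n" "n \<le> m" shows "hermite_raise m r x = hermite_raise n r x"
  using assms(2)
proof (induction m rule: dec_induct)
  case (step k)
  then show ?case using hermite_raise_recurrence[of r k x] assms(1) by simp
qed simp

lemma He_eq_raise:
  assumes "r < real n" shows "He r x = hermite_raise n r x"
proof -
  have "r < real (nat \<lceil>r\<rceil> + 1)" by linarith
  then show ?thesis unfolding He_def
    using hermite_raise_stable[of r _ "max n (nat \<lceil>r\<rceil> + 1)" x] assms by (metis max.cobounded1 max.cobounded2)
qed

lemma He_neg: "r < 0 \<Longrightarrow> He r x = gauss_mellin (- r) x / Gamma (- r)"
  using He_eq_raise[of r 0] by simp

lemma He_recurrence:
  "He r x = x * He (r - 1) x - (r - 1) * He (r - 2) x"
proof -
  obtain n :: nat where "r < real n" using reals_Archimedean2 by blast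
  then show ?thesis using hermite_raise_recurrence[of r n x]
    by (simp add: He_eq_raise[of _ n])
qed

lemma real_order_induct [case_names neg step]:
  fixes P :: "real \<Rightarrow> bool"
  assumes neg: "\<And>r. r < 0 \<Longrightarrow> P r" and step: "\<And>r. r \<ge> 0 \<Longrightarrow> P (r - 1) \<Longrightarrow> P (r - 2) \<Longrightarrow> P r"
  shows "P r"
proof -
  have "r < real n \<longrightarrow> P r" for n
  proof (induction n arbitrary: r)
    case (Suc n)
    show ?case
    proof
      assume "r < real (Suc n)"
      then show "P r" using Suc.IH[of "r - 1"] Suc.IH[of "r - 2"] neg[of r] step[of r] by (cases "r < 0") auto
    qed
  qed (use neg in auto)
  then show ?thesis using reals_Archimedean2 by blast
qed

lemma He_pos_of_neg: "r < 0 \<Longrightarrow> He r x > 0"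
  by (simp add: He_neg gauss_mellin_pos Gamma_real_pos)

lemma He_has_derivative:
  "(He r has_real_derivative r * He (r - 1) x) (at x)"
proof (induction r rule: real_order_induct)
  case (neg r)
  have "((\<lambda>x. gauss_mellin (- r) x / Gamma (- r)) has_real_derivative
      - gauss_mellin (- r + 1) x / Gamma (- r)) (at x)"
  proof -
    have "((\<lambda>x. gauss_mellin (- r) x) has_real_derivative - gauss_mellin (- r + 1) x) (at x)"
      using neg by (intro gauss_mellin_has_derivative) simp
    then show ?thesis by (rule DERIV_cdivide)
  qed
  moreover have "- gauss_mellin (- r + 1) x / Gamma (- r) = r * He (r - 1) x"
    using neg Gamma_plus1[of "- r"] Gamma_real_pos[of "- r"]
    by (simp add: He_neg nonpos_Ints_def field_simps)
  moreover have "He r = (\<lambda>x. gauss_mellin (- r) x / Gamma (- r))"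
    using neg by (auto simp: He_neg)
  ultimately show ?case by simp
next
  case (step r)
  have "((\<lambda>x. x * He (r - 1) x - (r - 1) * He (r - 2) x) has_real_derivative
      (1 * He (r - 1) x + (r - 1) * He (r - 1 - 1) x * x)
        - (r - 1) * ((r - 2) * He (r - 2 - 1) x)) (at x)"
    by (intro derivative_intros step DERIV_cmult)
  moreover have "(1 * He (r - 1) x + (r - 1) * He (r - 1 - 1) x * x)
        - (r - 1) * ((r - 2) * He (r - 2 - 1) x) = r * He (r - 1) x"
    using arg_cong[OF He_recurrence[of "r - 1" x], of "\<lambda>t. (r - 1) * t"]
    by (simp add: algebra_simps)
  moreover have "He r = (\<lambda>x. x * He (r - 1) x - (r - 1) * He (r - 2) x)"
    by (intro ext He_recurrence)
  ultimately show ?case by simp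
qed

lemma He_asymp: "((\<lambda>x. He r x / x powr r) \<longlongrightarrow> 1) at_top"
proof (induction r rule: real_order_induct)
  case (neg r)
  have G: "Gamma (- r) > 0" using neg by (intro Gamma_real_pos) simp
  have "((\<lambda>x. gauss_mellin (- r) x * x powr (- r) / Gamma (- r)) \<longlongrightarrow> Gamma (- r) / Gamma (- r)) at_top"
    using neg by (intro tendsto_divide gauss_mellin_asymp) (auto simp: G less_imp_neq[symmetric])
  then show ?case using neg G by (simp add: He_neg powr_minus field_simps)
next
  case (step r)
  have "((\<lambda>x. He (r - 1) x / x powr (r - 1)
      - (r - 1) * (He (r - 2) x / x powr (r - 2)) * (1 / x\<^sup>2)) \<longlongrightarrow> 1 - (r - 1) * 1 * 0) at_top"
    by (intro tendsto_intros step) real_asymp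
  moreover have "\<forall>\<^sub>F x in at_top. He (r - 1) x / x powr (r - 1)
      - (r - 1) * (He (r - 2) x / x powr (r - 2)) * (1 / x\<^sup>2) = He r x / x powr r"
    using eventually_gt_at_top[of 0]
  proof eventually_elim
    case (elim x)
    then show ?case unfolding He_recurrence[of r x]
      by (simp add: powr_diff field_simps power2_eq_square)
  qed
  ultimately show ?case by (simp add: tendsto_cong)
qed

lemma He_continuous: "continuous_on UNIV (\<lambda>(r, x). He r x)"
proof -
  have *: "continuous_on ({..<real n} \<times> UNIV) (\<lambda>(r, x). He r x)" for n
  proof (induction n)
    case 0
    have "continuous_on ({..<0} \<times> UNIV) (\<lambda>z. (\<lambda>(\<nu>, x). gauss_mellin \<nu> x) (- fst z, snd z))"
      by (rule continuous_on_compose2[OF gauss_mellin_continuous]) (auto intro!: continuous_intros)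
    moreover have "continuous_on ({..<0} \<times> UNIV) (\<lambda>z::real \<times> real. Gamma (- fst z))"
      by (rule continuous_on_compose2[OF continuous_on_Gamma[of "{0<..}"]])
         (auto intro!: continuous_intros simp: nonpos_Ints_def)
    ultimately have "continuous_on ({..<0} \<times> UNIV)
        (\<lambda>z. (\<lambda>(\<nu>, x). gauss_mellin \<nu> x) (- fst z, snd z) / Gamma (- fst z))"
      by (intro continuous_on_divide) (auto simp: Gamma_eq_zero_iff nonpos_Ints_def)
    then show ?case
      unfolding of_nat_0 by (rule continuous_on_eq) (auto simp: He_neg)
  next
    case (Suc n)
    have sh: "continuous_on ({..<real (Suc n)} \<times> UNIV) (\<lambda>z. (\<lambda>(r, x). He r x) (fst z - k, snd z))"
      if "k \<ge> 1" for k
      by (rule continuous_on_compose2[OF Suc]) (use that in \<open>auto intro!: continuous_intros\<close>)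
    have "continuous_on ({..<real (Suc n)} \<times> UNIV)
        (\<lambda>z. snd z * (\<lambda>(r, x). He r x) (fst z - 1, snd z)
           - (fst z - 1) * (\<lambda>(r, x). He r x) (fst z - 2, snd z))"
      by (intro continuous_intros sh) auto
    then show ?case
      by (rule continuous_on_eq) (auto simp: He_recurrence[symmetric])
  qed
  have "isCont (\<lambda>(r, x). He r x) z" for z
  proof -
    obtain n :: nat where "fst z < real n" using reals_Archimedean2 by blast
    then show ?thesis
      using *[of n] by (cases z) (auto simp: continuous_on_eq_continuous_at open_Times)
  qed
  then show ?thesis by (simp add: continuous_at_imp_continuous_on)
qed

text \<open>
  Positivity far to the right, uniformly in the order: while \<open>4 * r \<le> x\<^sup>2\<close>, the recurrence preserves the
  bound \<open>He r x \<ge> x / 2 * He (r - 1) x\<close> on the ratio of consecutive functions.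
\<close>

lemma He_pos_far:
  assumes x: "x > 0" and r: "4 * r \<le> x\<^sup>2"
  shows "He r x > 0"
proof -
  have "4 * r \<le> x\<^sup>2 \<longrightarrow> He r x > 0 \<and> x * He (r - 1) x \<le> 2 * He r x"
  proof (induction r rule: real_order_induct)
    case (neg r)
    have "- ((r - 1) * He (r - 2) x) \<ge> 0"
      using neg He_pos_of_neg[of "r - 2" x] by (simp add: mult_nonpos_nonneg)
    then have "x * He (r - 1) x \<le> He r x"
      using He_recurrence[of r x] by simp
    moreover have "He r x > 0" using neg by (rule He_pos_of_neg)
    ultimately show ?case by simp
  next
    case (step r)
    show ?case
    proof
      assume r: "4 * r \<le> x\<^sup>2"
      with step have 1: "He (r - 1) x > 0" "x * He (r - 2) x \<le> 2 * He (r - 1) x"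
        and 2: "He (r - 2) x > 0"
        by (auto simp: algebra_simps)
      have "2 * ((r - 1) * He (r - 2) x) \<le> x * He (r - 1) x"
      proof (cases "r \<le> 1")
        case True
        then have "(r - 1) * He (r - 2) x \<le> 0" using 2 by (simp add: mult_nonpos_nonneg)
        moreover have "x * He (r - 1) x > 0" using 1 x by simp
        ultimately show ?thesis by simp
      next
        case False
        have "x * (2 * ((r - 1) * He (r - 2) x)) = 2 * (r - 1) * (x * He (r - 2) x)" by simp
        also have "\<dots> \<le> 2 * (r - 1) * (2 * He (r - 1) x)"
          using False 1(2) by (intro mult_left_mono) auto
        also have "\<dots> = 4 * (r - 1) * He (r - 1) x" by simp
        also have "\<dots> \<le> x\<^sup>2 * He (r - 1) x"
          using r 1 by (intro mult_right_mono) auto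
        finally show ?thesis using x by (simp add: power2_eq_square)
      qed
      then have "x * He (r - 1) x \<le> 2 * He r x"
        using He_recurrence[of r x] by linarith
      moreover have "x * He (r - 1) x > 0" using 1 x by simp
      ultimately show "He r x > 0 \<and> x * He (r - 1) x \<le> 2 * He r x" by linarith
    qed
  qed
  with r show ?thesis by simp
qed

section \<open>Identification with the parabolic cylinder functions\<close>

text \<open>
  Gronwall for the energy \<open>(d x)\<^sup>2 + (d' x)\<^sup>2\<close>.
\<close>

lemma linear_ode_zero_backwards:
  fixes d d' q :: "real \<Rightarrow> real"
  assumes d: "\<And>x. (d has_real_derivative d' x) (at x)"
    and d': "\<And>x. (d' has_real_derivative q x * d x) (at x)"
    and q: "continuous_on UNIV q"
    and zero: "d K = 0" "d' K = 0" and aK: "a \<le> K"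
  shows "d a = 0"
proof -
  have "bounded (q ` {a..K})"
    using q by (intro compact_imp_bounded compact_continuous_image continuous_on_subset[OF q]) auto
  then obtain Q where Q: "\<And>x. x \<in> {a..K} \<Longrightarrow> \<bar>q x\<bar> \<le> Q"
    unfolding bounded_iff by (auto simp del: atLeastAtMost_iff)
  define E where "E x = (d x)\<^sup>2 + (d' x)\<^sup>2" for x
  define E' where "E' x = 2 * d x * d' x + 2 * d' x * (q x * d x)" for x
  have E: "(E has_real_derivative E' x) (at x)" for x
    unfolding E_def E'_def power2_eq_square
    by (rule derivative_eq_intros refl d d')+ simp
  have E'_ge: "E' x \<ge> - (1 + Q) * E x" if "x \<in> {a..K}" for x
  proof -
    have "\<bar>E' x\<bar> = \<bar>1 + q x\<bar> * (2 * \<bar>d x\<bar> * \<bar>d' x\<bar>)"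
    proof -
      have "E' x = (1 + q x) * (2 * d x * d' x)" by (simp add: E'_def algebra_simps)
      then show ?thesis by (simp add: abs_mult)
    qed
    also have "\<dots> \<le> (1 + Q) * E x"
    proof (rule mult_mono)
      show "\<bar>1 + q x\<bar> \<le> 1 + Q" using Q[OF that] by linarith
      show "2 * \<bar>d x\<bar> * \<bar>d' x\<bar> \<le> E x"
        using sum_squares_bound[of "\<bar>d x\<bar>" "\<bar>d' x\<bar>"] by (simp add: E_def)
      show "0 \<le> 1 + Q" using Q[OF that] by linarith
    qed simp
    finally show ?thesis by linarith
  qed
  have "E a * exp ((1 + Q) * a) \<le> E K * exp ((1 + Q) * K)"
  proof (rule DERIV_nonneg_imp_nondecreasing[OF aK])
    fix x assume x: "a \<le> x" "x \<le> K"
    have "((\<lambda>x. E x * exp ((1 + Q) * x)) has_real_derivative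
        (E' x + (1 + Q) * E x) * exp ((1 + Q) * x)) (at x)"
      by (rule derivative_eq_intros refl E | simp add: algebra_simps)+
    moreover have "(E' x + (1 + Q) * E x) * exp ((1 + Q) * x) \<ge> 0"
      using E'_ge[of x] x by (intro mult_nonneg_nonneg) (auto simp: algebra_simps)
    ultimately show "\<exists>y. ((\<lambda>x. E x * exp ((1 + Q) * x)) has_real_derivative y) (at x) \<and> 0 \<le> y"
      by blast
  qed
  then have "E a * exp ((1 + Q) * a) \<le> 0" using zero by (simp add: E_def)
  then have "E a \<le> 0" by (simp add: mult_le_0_iff)
  then show ?thesis using sum_power2_le_zero_iff unfolding E_def by blast
qed

text \<open>
  Reduction of order: for the difference \<open>d\<close> of two solutions the Wronskian with \<open>w1\<close> is a constant \<open>C\<close>, and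
  \<open>d / w1\<close> has derivative \<open>C / w1\<^sup>2\<close>. As \<open>w1\<close> tends to \<open>0\<close> while \<open>d / w1\<close> tends to \<open>0\<close> too, \<open>C\<close>
  must vanish; then \<open>d\<close> vanishes near infinity, hence everywhere.
\<close>

lemma is_parabolic_cylinder_unique:
  assumes "is_parabolic_cylinder p w1" "is_parabolic_cylinder p w2"
  shows "w1 = w2"
proof
  fix a
  obtain w1' w1'' where w1: "\<And>z. (w1 has_real_derivative w1' z) (at z)"
      "\<And>z. (w1' has_real_derivative w1'' z) (at z)" "\<And>z. w1'' z + (p + 1/2 - z\<^sup>2 / 4) * w1 z = 0"
    using assms(1) unfolding is_parabolic_cylinder_def by blast
  obtain w2' w2'' where w2: "\<And>z. (w2 has_real_derivative w2' z) (at z)"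
      "\<And>z. (w2' has_real_derivative w2'' z) (at z)" "\<And>z. w2'' z + (p + 1/2 - z\<^sup>2 / 4) * w2 z = 0"
    using assms(2) unfolding is_parabolic_cylinder_def by blast
  define D :: "real \<Rightarrow> real" where "D z = z powr p * exp (- z\<^sup>2 / 4)" for z
  have eqv: "w1 \<sim>[at_top] D" "w2 \<sim>[at_top] D"
    using assms unfolding is_parabolic_cylinder_def D_def by auto
  define q :: "real \<Rightarrow> real" where "q z = z\<^sup>2 / 4 - (p + 1/2)" for z
  define d where "d z = w1 z - w2 z" for z
  define d' where "d' z = w1' z - w2' z" for z
  have dd: "(d has_real_derivative d' z) (at z)" for z
    unfolding d_def d'_def by (intro derivative_intros w1 w2)
  have dd': "(d' has_real_derivative q z * d z) (at z)" for z
  proof -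
    have "(d' has_real_derivative w1'' z - w2'' z) (at z)"
      unfolding d'_def by (intro derivative_intros w1 w2)
    moreover have "w1'' z - w2'' z = q z * d z"
    proof -
      have "w1'' z = - ((p + 1/2 - z\<^sup>2 / 4) * w1 z)" "w2'' z = - ((p + 1/2 - z\<^sup>2 / 4) * w2 z)"
        using w1(3)[of z] w2(3)[of z] by (simp_all only: eq_neg_iff_add_eq_0)
      then have "w1'' z - w2'' z = - ((p + 1/2 - z\<^sup>2 / 4) * w1 z) - - ((p + 1/2 - z\<^sup>2 / 4) * w2 z)"
        by (simp only:)
      also have "\<dots> = q z * d z" by (simp add: q_def d_def algebra_simps diff_divide_distrib)
      finally show ?thesis .
    qed
    ultimately show ?thesis by simp
  qed
  have w1q: "(w1' has_real_derivative q z * w1 z) (at z)" for z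
  proof -
    have "w1'' z = q z * w1 z" using w1(3)[of z] by (simp add: q_def algebra_simps)
    then show ?thesis using w1(2)[of z] by simp
  qed
  have Dpos: "\<forall>\<^sub>F z in at_top. D z > 0" using eventually_gt_at_top[of 0]
    by eventually_elim (simp add: D_def)
  have r1: "((\<lambda>z. w1 z / D z) \<longlongrightarrow> 1) at_top" and r2: "((\<lambda>z. w2 z / D z) \<longlongrightarrow> 1) at_top"
    using eqv Dpos by (auto intro!: asymp_equivD_strong elim: eventually_mono)
  have "((\<lambda>z. D z) \<longlongrightarrow> 0) at_top" unfolding D_def by real_asymp
  from tendsto_mult[OF r1 this] have w1_0: "((\<lambda>z. w1 z / D z * D z) \<longlongrightarrow> 0) at_top" by simp
  have "\<forall>\<^sub>F z in at_top. w1 z / D z > 0 \<and> w1 z / D z * D z < 1"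
    using order_tendstoD(1)[OF r1, of 0] order_tendstoD(2)[OF w1_0, of 1] by (auto elim: eventually_elim2)
  with Dpos have ev1: "\<forall>\<^sub>F z in at_top. 0 < w1 z \<and> w1 z < 1"
    by eventually_elim (auto simp: zero_less_divide_iff)
  define g where "g z = d z / w1 z" for z
  have g0: "(g \<longlongrightarrow> 0) at_top"
  proof -
    have "((\<lambda>z. (w1 z / D z - w2 z / D z) / (w1 z / D z)) \<longlongrightarrow> (1 - 1) / 1) at_top"
      by (intro tendsto_intros r1 r2) simp
    moreover have "\<forall>\<^sub>F z in at_top. (w1 z / D z - w2 z / D z) / (w1 z / D z) = g z"
      using Dpos ev1 by eventually_elim (simp add: g_def d_def field_simps)
    ultimately show ?thesis by (simp add: tendsto_cong)
  qed
  have "\<forall>\<^sub>F z in at_top. \<bar>g z\<bar> < 1" using tendsto_rabs[OF g0] order_tendstoD(2)[of _ 0] by force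
  with ev1 have "\<forall>\<^sub>F z in at_top. 0 < w1 z \<and> w1 z < 1 \<and> \<bar>g z\<bar> < 1" by eventually_elim auto
  then obtain K where K: "\<And>z. z \<ge> K \<Longrightarrow> 0 < w1 z \<and> w1 z < 1 \<and> \<bar>g z\<bar> < 1"
    unfolding eventually_at_top_linorder by blast
  define Wr where "Wr z = d' z * w1 z - d z * w1' z" for z
  have "(Wr has_real_derivative 0) (at z)" for z
    unfolding Wr_def by (rule derivative_eq_intros refl dd dd' w1 w1q)+ (simp add: algebra_simps)
  then obtain C where C: "\<And>z. Wr z = C" using DERIV_isconst_all[of Wr] by blast
  have g': "(g has_real_derivative C / (w1 z)\<^sup>2) (at z)" if "z \<ge> K" for z
  proof -
    have "(g has_real_derivative (d' z * w1 z - d z * w1' z) / (w1 z * w1 z)) (at z)"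
      unfolding g_def using K[OF that] by (intro DERIV_divide dd w1) auto
    then show ?thesis using C[of z] by (simp add: Wr_def power2_eq_square)
  qed
  have C0: "C = 0"
  proof (rule ccontr)
    assume "C \<noteq> 0"
    \<comment> \<open>over this length \<open>g\<close> would have to change by more than \<open>2\<close>, although \<open>\<bar>g\<bar> < 1\<close>\<close>
    define T where "T = 2 / \<bar>C\<bar> + 1"
    have T: "T > 0" using \<open>C \<noteq> 0\<close> by (simp add: T_def add_pos_pos)
    obtain z where z: "K < z" "z < K + T" "g (K + T) - g K = (K + T - K) * (C / (w1 z)\<^sup>2)"
      using MVT2[of K "K + T" g "\<lambda>z. C / (w1 z)\<^sup>2"] g' T by auto
    have "(w1 z)\<^sup>2 \<le> 1" "(w1 z)\<^sup>2 > 0" using K[of z] z by (auto simp: power_le_one)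
    then have "\<bar>C\<bar> \<le> \<bar>C\<bar> / (w1 z)\<^sup>2"
      by (simp add: le_divide_eq mult_left_le)
    then have "T * \<bar>C\<bar> \<le> T * (\<bar>C\<bar> / (w1 z)\<^sup>2)" using T by (intro mult_left_mono) auto
    also have "\<dots> = \<bar>g (K + T) - g K\<bar>" using T by (simp add: z(3) abs_mult)
    also have "\<dots> < 2" using K[of K] K[of "K + T"] T by linarith
    finally show False using \<open>C \<noteq> 0\<close> by (simp add: T_def field_simps)
  qed
  have gz: "g z = 0" if "z \<ge> K" for z
  proof -
    have const: "g y = g K" if "y \<ge> K" for y
    proof (cases "y = K")
      case False
      then obtain u where "K < u" "u < y" "g y - g K = (y - K) * (C / (w1 u)\<^sup>2)"
        using MVT2[of K y g "\<lambda>z. C / (w1 z)\<^sup>2"] g' \<open>y \<ge> K\<close> by auto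
      then show ?thesis using C0 by simp
    qed simp
    have "\<forall>\<^sub>F y in at_top. g y = g K"
      using eventually_ge_at_top[of K] by eventually_elim (rule const)
    then have "(g \<longlongrightarrow> g K) at_top" by (rule tendsto_eventually)
    then have "g K = 0" using g0 tendsto_unique[OF trivial_limit_at_top_linorder] by blast
    then show ?thesis using const[OF that] by simp
  qed
  have dz: "d z = 0" if "z \<ge> K" for z using gz[OF that] K[OF that] by (simp add: g_def)
  define b where "b = max a K + 1"
  have "\<forall>\<^sub>F z in nhds b. z \<in> {K<..}"
    by (rule eventually_nhds_in_open) (auto simp: b_def)
  then have "\<forall>\<^sub>F z in nhds b. d z = 0" by eventually_elim (simp add: dz)
  from DERIV_cong_ev[OF refl this refl, of 0] have "(d has_real_derivative 0) (at b)" by simp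
  from DERIV_unique[OF dd this] have "d' b = 0" .
  moreover have "continuous_on UNIV q" unfolding q_def by (intro continuous_intros) auto
  ultimately have "d a = 0"
    by (intro linear_ode_zero_backwards[of d d' q b a] dd dd' dz) (auto simp: b_def)
  then show "w1 a = w2 a" by (simp add: d_def)
qed

lemma He_is_parabolic_cylinder:
  "is_parabolic_cylinder p (\<lambda>z. exp (- z\<^sup>2 / 4) * He p z)"
  unfolding is_parabolic_cylinder_def
proof (intro conjI exI allI)
  fix z :: real
  let ?H = "He"
  have e: "((\<lambda>z. exp (- z\<^sup>2 / 4)) has_real_derivative - z / 2 * exp (- z\<^sup>2 / 4)) (at z)"
    by (auto intro!: derivative_eq_intros)
  note h = He_has_derivative[of p z] He_has_derivative[of "p - 1" z]
  show "((\<lambda>z. exp (- z\<^sup>2 / 4) * ?H p z) has_real_derivative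
      exp (- z\<^sup>2 / 4) * (p * ?H (p - 1) z - z / 2 * ?H p z)) (at z)"
    by (rule DERIV_cong[OF DERIV_mult[OF e h(1)]]) (simp add: algebra_simps)
  have h': "((\<lambda>z. p * ?H (p - 1) z - z / 2 * ?H p z) has_real_derivative
      p * ((p - 1) * ?H (p - 2) z) - (1 / 2 * ?H p z + z / 2 * (p * ?H (p - 1) z))) (at z)"
    using h by (auto intro!: derivative_eq_intros simp: field_simps)
  show "((\<lambda>z. exp (- z\<^sup>2 / 4) * (p * ?H (p - 1) z - z / 2 * ?H p z)) has_real_derivative
      exp (- z\<^sup>2 / 4) * (- z / 2 * (p * ?H (p - 1) z - z / 2 * ?H p z)
        + (p * ((p - 1) * ?H (p - 2) z) - (1 / 2 * ?H p z + z / 2 * (p * ?H (p - 1) z))))) (at z)"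
    by (rule DERIV_cong[OF DERIV_mult[OF e h']])
       (simp add: algebra_simps diff_divide_distrib add_divide_distrib)
  show "exp (- z\<^sup>2 / 4) * (- z / 2 * (p * ?H (p - 1) z - z / 2 * ?H p z)
        + (p * ((p - 1) * ?H (p - 2) z) - (1 / 2 * ?H p z + z / 2 * (p * ?H (p - 1) z))))
      + (p + 1 / 2 - z\<^sup>2 / 4) * (exp (- z\<^sup>2 / 4) * ?H p z) = 0"
  proof -
    have *: "(p - 1) * ?H (p - 2) z = z * ?H (p - 1) z - ?H p z"
      using He_recurrence[of p z] by simp
    show ?thesis unfolding * by (simp add: algebra_simps power2_eq_square)
  qed
next
  show "(\<lambda>z. exp (- z\<^sup>2 / 4) * He p z) \<sim>[at_top] (\<lambda>z. z powr p * exp (- z\<^sup>2 / 4))"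
  proof (rule asymp_equivI')
    have "\<forall>\<^sub>F z in at_top. He p z / z powr p
        = exp (- z\<^sup>2 / 4) * He p z / (z powr p * exp (- z\<^sup>2 / 4))"
      by (rule always_eventually) simp
    then show "((\<lambda>z. exp (- z\<^sup>2 / 4) * He p z / (z powr p * exp (- z\<^sup>2 / 4))) \<longlongrightarrow> 1) at_top"
      using He_asymp[of p] by (simp add: tendsto_cong)
  qed
qed

lemma psi_eq_He: "psi = He"
proof (intro ext)
  fix p x
  have "parabolic_cylinder p = (\<lambda>z. exp (- z\<^sup>2 / 4) * He p z)"
    unfolding parabolic_cylinder_def
    by (rule the_equality[where P = "is_parabolic_cylinder p"])
       (rule He_is_parabolic_cylinder
         is_parabolic_cylinder_unique[OF _ He_is_parabolic_cylinder], assumption?)+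
  then show "psi p x = He p x"
    by (simp add: psi_def flip: exp_add mult.assoc)
qed

section \<open>The minimal root\<close>

lemma He_zero: "He 0 x = 1"
proof -
  have "(He 0 has_real_derivative 0) (at y)" for y
    using He_has_derivative[of 0 y] by simp
  then obtain k where k: "\<And>y. He 0 y = k" using DERIV_isconst_all[of "He 0"] by blast
  have "\<forall>\<^sub>F y in at_top. He 0 y / y powr 0 = k"
    using eventually_gt_at_top[of "0::real"] by eventually_elim (simp add: k)
  then have "((\<lambda>y. He 0 y / y powr 0) \<longlongrightarrow> k) at_top" by (rule tendsto_eventually)
  then show ?thesis using He_asymp[of 0] k tendsto_unique[OF trivial_limit_at_top_linorder] by blast
qed

text \<open>
  If all functions of positive order were positive on \<open>{c..}\<close>, two steps of the recurrence would
  give \<open>He (r + 1) x \<le> (x\<^sup>2 - r) * He (r - 1) x\<close>, which is negative once \<open>r > x\<^sup>2\<close>.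
\<close>

lemma He_sometimes_nonpos: "\<exists>r>0. \<exists>x\<ge>c. He r x \<le> 0"
proof (rule ccontr)
  assume "\<not> ?thesis"
  then have pos: "He r x > 0" if "r > 0" "x \<ge> c" for r x
    using that by (meson not_le_imp_less)
  define x where "x = max c 1"
  have x: "x \<ge> c" "x \<ge> 1" by (auto simp: x_def)
  define r where "r = x\<^sup>2 + 2"
  have r: "r > 2" using x by (simp add: r_def add_pos_pos)
  have "He (r + 1) x = x * He r x - r * He (r - 1) x"
    using He_recurrence[of "r + 1" x] by simp
  also have "\<dots> \<le> x * (x * He (r - 1) x) - r * He (r - 1) x"
  proof (intro diff_right_mono mult_left_mono)
    have "(r - 1) * He (r - 2) x \<ge> 0" using r pos[of "r - 2" x] x by simp
    then show "He r x \<le> x * He (r - 1) x"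
      using He_recurrence[of r x] by simp
  qed (use x in simp)
  also have "\<dots> = - 2 * He (r - 1) x" by (simp add: r_def algebra_simps power2_eq_square)
  also have "\<dots> < 0" using pos[of "r - 1" x] r x by simp
  finally show False using pos[of "r + 1" x] r x by simp
qed

text \<open>
  Quantifying over all smaller orders makes this set an interval by definition, so that its supremum
  can be recognised as the minimal root without comparing the zeros of different Hermite functions.
\<close>

definition positive_orders :: "real \<Rightarrow> real set" where
  "positive_orders c = {p. p \<ge> 0 \<and> (\<forall>q\<le>p. \<forall>x\<ge>c. He q x > 0)}"

text \<open>
  Otherwise there are orders tending to \<open>p\<close> from above with nonpositive values at points of \<open>{c..}\<close>. These points stay in a
  compact interval by \<open>He_pos_far\<close>, and joint continuity produces a zero of \<open>He p\<close> in \<open>{c..}\<close>.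
\<close>

lemma positive_orders_open_right:
  assumes p: "p \<in> positive_orders c"
  shows "\<exists>\<epsilon>>0. p + \<epsilon> \<in> positive_orders c"
proof (rule ccontr)
  assume "\<not> ?thesis"
  then have "p + 1 / real (Suc n) \<notin> positive_orders c" for n by (simp del: of_nat_Suc)
  then have "\<exists>q x. q \<le> p + 1 / real (Suc n) \<and> x \<ge> c \<and> He q x \<le> 0" for n
    using p by (force simp: positive_orders_def not_less simp del: of_nat_Suc)
  then obtain q x where qx: "\<And>n. q n \<le> p + 1 / real (Suc n)" "\<And>n. x n \<ge> c" "\<And>n. He (q n) (x n) \<le> 0"
    by metis
  have qp: "q n > p" for n using p qx(2,3)[of n] by (force simp: positive_orders_def not_less[symmetric])
  define B where "B = max c (4 * (p + 1) + 1)"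
  have xB: "x n \<le> B" for n
  proof (rule ccontr)
    assume "\<not> x n \<le> B"
    then have xn: "x n > 4 * (p + 1) + 1" by (simp add: B_def)
    have p0: "p \<ge> 0" using p by (simp add: positive_orders_def)
    have "q n \<le> p + 1" by (rule order_trans[OF qx(1)]) simp
    then have "4 * q n \<le> 4 * (p + 1)" by simp
    also have "\<dots> \<le> x n" using xn by simp
    also have "\<dots> \<le> (x n)\<^sup>2" using xn p0 by (simp add: power2_eq_square)
    finally have "He (q n) (x n) > 0" using xn p0 by (intro He_pos_far) auto
    then show False using qx(3)[of n] by simp
  qed
  have "compact {c..B}" by simp
  then obtain l s where l: "l \<in> {c..B}" "strict_mono s" "(x \<circ> s) \<longlonglongrightarrow> l"
    using xB qx(2) unfolding compact_def by (metis atLeastAtMost_iff)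
  have q_lim: "q \<longlonglongrightarrow> p"
  proof (rule tendsto_sandwich)
    show "\<forall>\<^sub>F n in sequentially. p \<le> q n" by (intro always_eventually allI less_imp_le qp)
    show "\<forall>\<^sub>F n in sequentially. q n \<le> p + 1 / real (Suc n)" by (intro always_eventually allI qx(1))
    show "(\<lambda>n. p + 1 / real (Suc n)) \<longlonglongrightarrow> p" by real_asymp
    show "(\<lambda>_. p) \<longlonglongrightarrow> p" by simp
  qed
  have "(\<lambda>n. (q (s n), x (s n))) \<longlonglongrightarrow> (p, l)"
    using LIMSEQ_subseq_LIMSEQ[OF q_lim l(2)] l(3) by (intro tendsto_Pair) (auto simp: o_def)
  moreover have "isCont (\<lambda>(r, x). He r x) (p, l)"
    using He_continuous by (simp add: continuous_on_eq_continuous_at)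
  ultimately have "(\<lambda>n. (\<lambda>(r, x). He r x) (q (s n), x (s n))) \<longlonglongrightarrow> (\<lambda>(r, x). He r x) (p, l)"
    by (rule isCont_tendsto_compose[rotated])
  then have "He p l \<le> 0"
    using qx(3) by (intro LIMSEQ_le_const2[of "\<lambda>n. He (q (s n)) (x (s n))"]) auto
  then show False using p l(1) by (force simp: positive_orders_def)
qed

text \<open>
  At the supremum \<open>ps\<close> of the interval the function is nonnegative on \<open>{c..}\<close>, but not positive,
  because the interval is open on the right. It is strictly increasing there, since its derivative is
  \<open>ps * He (ps - 1)\<close>; so its only zero in \<open>{c..}\<close> is \<open>c\<close>.
\<close>

theorem min_root_properties:
  shows min_root_pos: "min_root c > 0"
    and psi_min_root: "psi (min_root c) c = 0"
    and psi_pos_below_min_root: "\<And>q x. q < min_root c \<Longrightarrow> x \<ge> c \<Longrightarrow> psi q x > 0"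
proof -
  define P where "P = positive_orders c"
  have P0: "0 \<in> P"
    unfolding P_def positive_orders_def using He_zero He_pos_of_neg
    by (auto simp: le_less)
  have down: "q \<in> P" if "p \<in> P" "0 \<le> q" "q \<le> p" for p q
    using that by (auto simp: P_def positive_orders_def)
  obtain r0 x0 where r0: "r0 > 0" "x0 \<ge> c" "He r0 x0 \<le> 0"
    using He_sometimes_nonpos by blast
  have bdd: "p \<le> r0" if "p \<in> P" for p
  proof (rule ccontr)
    assume "\<not> p \<le> r0"
    then have "He r0 x0 > 0" using that r0(2) by (auto simp: P_def positive_orders_def)
    then show False using r0(3) by simp
  qed
  define ps where "ps = Sup P"
  have bd: "bdd_above P" using bdd by (rule bdd_aboveI)
  have le_ps: "p \<le> ps" if "p \<in> P" for p unfolding ps_def by (rule cSup_upper[OF that bd])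
  have ps_pos: "ps > 0"
    using positive_orders_open_right[of 0 c] P0 le_ps by (force simp: P_def)
  have below: "He q x > 0" if "q < ps" "x \<ge> c" for q x
  proof -
    have "P \<noteq> {}" "q < Sup P" using P0 that(1) by (auto simp: ps_def)
    then obtain p where "p \<in> P" "q < p"
      using less_cSup_iff[OF _ bd, of q] by blast
    then show ?thesis using that(2) by (auto simp: P_def positive_orders_def)
  qed
  have notin: "ps \<notin> P" using positive_orders_open_right[of ps c] le_ps by (force simp: P_def)
  then obtain x1 where x1: "x1 \<ge> c" "He ps x1 \<le> 0"
    using below ps_pos unfolding P_def positive_orders_def by (force simp: le_less not_less)
  have nonneg: "He ps x \<ge> 0" if "x \<ge> c" for x
  proof (rule tendsto_lowerbound)
    have "isCont (\<lambda>r. (\<lambda>(r, x). He r x) (r, x)) ps"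
      using He_continuous
      by (intro isCont_o2[where f = "\<lambda>r. (r, x)" and g = "\<lambda>(r, x). He r x"] continuous_intros)
         (simp add: continuous_on_eq_continuous_at)
    then show "((\<lambda>q. He q x) \<longlongrightarrow> He ps x) (at_left ps)"
      by (auto simp: isCont_def intro: filterlim_mono at_le)
    show "\<forall>\<^sub>F q in at_left ps. 0 \<le> He q x"
      using below[OF _ that] by (auto simp: eventually_at_filter intro!: always_eventually less_imp_le)
  qed simp
  have incr: "He ps x < He ps y" if "c \<le> x" "x < y" for x y
    using that below[of "ps - 1"] ps_pos
    by (intro DERIV_pos_imp_increasing[OF \<open>x < y\<close>]) (auto intro!: exI He_has_derivative mult_pos_pos)
  have "x1 = c" using incr[of c x1] x1 nonneg[of c] by (cases "x1 = c") auto
  then have root: "He ps c = 0" using x1 nonneg[of c] by simp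
  have "min_root c = ps" unfolding min_root_def psi_eq_He
  proof (rule Least_equality)
    show "ps \<le> p" if "p > 0 \<and> He p c = 0" for p
      using below[of p c] that by (cases "p < ps") auto
  qed (use ps_pos root in simp)
  then show "min_root c > 0" "psi (min_root c) c = 0" "\<And>q x. q < min_root c \<Longrightarrow> x \<ge> c \<Longrightarrow> psi q x > 0"
    using ps_pos root below by (auto simp: psi_eq_He)
qed

lemma psi_min_root_increasing:
  assumes "c \<le> x" "x < y" shows "psi (min_root c) x < psi (min_root c) y"
  unfolding psi_eq_He
  using assms psi_pos_below_min_root[of "min_root c - 1" c] min_root_pos[of c]
  by (intro DERIV_pos_imp_increasing[OF \<open>x < y\<close>])
     (auto simp: psi_eq_He intro!: exI He_has_derivative mult_pos_pos)

section \<open>Growth bounds\<close>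

lemma He_normalised:
  shows continuous_on_He_normalised: "continuous_on S (\<lambda>x. He r x / (1 + \<bar>x\<bar>) powr r)"
    and He_normalised_limit: "((\<lambda>x. He r x / (1 + \<bar>x\<bar>) powr r) \<longlongrightarrow> 1) at_top"
proof -
  show "continuous_on S (\<lambda>x. He r x / (1 + \<bar>x\<bar>) powr r)"
    by (intro continuous_intros continuous_at_imp_continuous_on ballI DERIV_isCont[OF He_has_derivative]) auto
  have "((\<lambda>x. He r x / x powr r * (x powr r / (1 + x) powr r)) \<longlongrightarrow> 1 * 1) at_top"
    by (intro tendsto_mult He_asymp) real_asymp
  moreover have "\<forall>\<^sub>F x in at_top. He r x / x powr r * (x powr r / (1 + x) powr r)
      = He r x / (1 + \<bar>x\<bar>) powr r"
    using eventually_gt_at_top[of 0] by eventually_elim simp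
  ultimately show "((\<lambda>x. He r x / (1 + \<bar>x\<bar>) powr r) \<longlongrightarrow> 1) at_top" by (simp add: tendsto_cong)
qed

lemma He_upper_bound:
  obtains C where "C > 0" "\<And>x. x \<ge> A \<Longrightarrow> \<bar>He r x\<bar> \<le> C * (1 + \<bar>x\<bar>) powr r"
proof -
  define f where "f x = He r x / (1 + \<bar>x\<bar>) powr r" for x
  have fc: "continuous_on S f" for S
    unfolding f_def by (rule continuous_on_He_normalised)
  have flim: "(f \<longlongrightarrow> 1) at_top" unfolding f_def by (rule He_normalised_limit)
  then have "\<forall>\<^sub>F x in at_top. \<bar>f x\<bar> < 2" using order_tendstoD(2)[OF tendsto_rabs[OF flim], of 2] by simp
  then obtain K where K: "\<And>x. x \<ge> K \<Longrightarrow> \<bar>f x\<bar> < 2" unfolding eventually_at_top_linorder by blast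
  have "bounded (f ` {A..K})" by (intro compact_imp_bounded compact_continuous_image fc) simp
  then obtain C where "\<forall>y\<in>f ` {A..K}. norm y \<le> C" unfolding bounded_iff by blast
  then have C: "\<And>x. A \<le> x \<Longrightarrow> x \<le> K \<Longrightarrow> \<bar>f x\<bar> \<le> C" by auto
  have f: "\<bar>f x\<bar> \<le> max C 2" if "x \<ge> A" for x
    using C[OF that] K[of x] by (cases "x \<le> K") auto
  show ?thesis
  proof (rule that[of "max C 2"])
    fix x assume "x \<ge> A"
    then show "\<bar>He r x\<bar> \<le> max C 2 * (1 + \<bar>x\<bar>) powr r"
      using f[of x] by (simp add: f_def abs_divide divide_le_eq)
  qed simp
qed

lemma He_lower_bound:
  assumes pos: "\<And>x. x \<ge> A \<Longrightarrow> He r x > 0"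
  obtains C where "C > 0" "\<And>x. x \<ge> A \<Longrightarrow> He r x \<ge> C * (1 + \<bar>x\<bar>) powr r"
proof -
  define f where "f x = He r x / (1 + \<bar>x\<bar>) powr r" for x
  have fc: "continuous_on S f" for S
    unfolding f_def by (rule continuous_on_He_normalised)
  have flim: "(f \<longlongrightarrow> 1) at_top" unfolding f_def by (rule He_normalised_limit)
  then have "\<forall>\<^sub>F x in at_top. f x > 1/2" using order_tendstoD(1)[OF flim, of "1/2"] by simp
  then obtain K where K: "\<And>x. x \<ge> K \<Longrightarrow> f x > 1/2" unfolding eventually_at_top_linorder by blast
  obtain y where y: "y \<in> {A..max A K}" "\<And>x. x \<in> {A..max A K} \<Longrightarrow> f y \<le> f x"
    using continuous_attains_inf[OF compact_Icc _ fc, of A "max A K"] by auto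
  have fy: "f y > 0" using y(1) pos[of y] by (simp add: f_def)
  have f: "f x \<ge> min (f y) (1/2)" if "x \<ge> A" for x
    using y(2)[of x] K[of x] that by (cases "x \<le> K") auto
  show ?thesis
  proof (rule that[of "min (f y) (1/2)"])
    fix x assume "x \<ge> A"
    then show "He r x \<ge> min (f y) (1/2) * (1 + \<bar>x\<bar>) powr r"
      using f[of x] by (simp add: f_def le_divide_eq)
  qed (use fy in simp)
qed

section \<open>Second-order expansion of the Hermite functions\<close>

lemma powr_comparable:
  fixes a b e :: real
  assumes "a > 0" "a \<le> 2 * b" "b \<le> 2 * a"
  shows "b powr e \<le> 2 powr \<bar>e\<bar> * a powr e"
proof (cases "e \<ge> 0")
  case True
  then have "b powr e \<le> (2 * a) powr e" using assms by (intro powr_mono2) auto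
  then show ?thesis using True assms(1) by (simp add: powr_mult)
next
  case False
  then have "b powr e \<le> (a / 2) powr e" using assms by (intro powr_mono2') auto
  then show ?thesis using False assms(1) by (simp add: powr_divide powr_minus field_simps)
qed

definition taylor2 :: "real \<Rightarrow> real \<Rightarrow> real \<Rightarrow> real" where
  "taylor2 r u y = He r u + r * He (r - 1) u * y
     + r * (r - 1) / 2 * He (r - 2) u * y\<^sup>2"

lemma taylor2_error:
  obtains C where "C > 0"
    "\<And>u v. A \<le> u \<Longrightarrow> A \<le> v \<Longrightarrow> \<bar>v - u\<bar> \<le> (1 + \<bar>u\<bar>) / 2 \<Longrightarrow>
       \<bar>He r v - taylor2 r u (v - u)\<bar> \<le> C * (1 + \<bar>u\<bar>) powr (r - 3) * \<bar>v - u\<bar> ^ 3"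
proof -
  obtain B where B: "B > 0" "\<And>x. x \<ge> A \<Longrightarrow> \<bar>He (r - 3) x\<bar> \<le> B * (1 + \<bar>x\<bar>) powr (r - 3)"
    using He_upper_bound by blast
  define k where "k = \<bar>r * (r - 1) * (r - 2)\<bar> / 6"
  define C where "C = k * (B * 2 powr \<bar>r - 3\<bar>) + 1"
  have k0: "k \<ge> 0" by (simp add: k_def)
  have C: "C > 0" using B(1) k0 by (simp add: C_def add_nonneg_pos)
  show ?thesis
  proof (rule that[OF C])
    fix u v :: real assume uv: "A \<le> u" "A \<le> v" "\<bar>v - u\<bar> \<le> (1 + \<bar>u\<bar>) / 2"
    show "\<bar>He r v - taylor2 r u (v - u)\<bar> \<le> C * (1 + \<bar>u\<bar>) powr (r - 3) * \<bar>v - u\<bar> ^ 3"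
    proof (cases "v = u")
      case False
      define diff where "diff m t = (\<Prod>i<m. r - real i) * He (r - real m) t" for m t
      have d0: "diff 0 = He r" by (simp add: diff_def[abs_def])
      have "\<forall>m t. m < 3 \<and> min u v \<le> t \<and> t \<le> max u v \<longrightarrow> DERIV (diff m) t :> diff (Suc m) t"
      proof (intro allI impI)
        fix m t
        have "((\<lambda>t. (\<Prod>i<m. r - real i) * He (r - real m) t) has_real_derivative
            (\<Prod>i<m. r - real i) * ((r - real m) * He (r - real m - 1) t)) (at t)"
          by (intro DERIV_cmult He_has_derivative)
        moreover have "(\<Prod>i<m. r - real i) * ((r - real m) * He (r - real m - 1) t) = diff (Suc m) t"
          by (simp add: diff_def diff_diff_add add.commute)
        ultimately show "DERIV (diff m) t :> diff (Suc m) t" by (simp add: diff_def[abs_def])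
      qed
      then obtain t where t: "if v < u then v < t \<and> t < u else u < t \<and> t < v"
          "He r v = (\<Sum>m<3. diff m u / fact m * (v - u) ^ m) + diff 3 t / fact 3 * (v - u) ^ 3"
        using Taylor[of 3 diff "He r" "min u v" "max u v" u v, OF _ d0] False by auto
      have "(\<Sum>m<3. diff m u / fact m * (v - u) ^ m) = taylor2 r u (v - u)"
        by (simp add: diff_def taylor2_def eval_nat_numeral algebra_simps)
      with t(2) have "He r v - taylor2 r u (v - u) = diff 3 t / fact 3 * (v - u) ^ 3" by simp
      also have "\<dots> = r * (r - 1) * (r - 2) / 6 * He (r - 3) t * (v - u) ^ 3"
        by (simp add: diff_def eval_nat_numeral algebra_simps)
      finally have "\<bar>He r v - taylor2 r u (v - u)\<bar> = k * \<bar>He (r - 3) t\<bar> * \<bar>v - u\<bar> ^ 3"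
        by (simp only: abs_mult power_abs abs_divide k_def) simp
      also have "\<dots> \<le> k * (B * (2 powr \<bar>r - 3\<bar> * (1 + \<bar>u\<bar>) powr (r - 3))) * \<bar>v - u\<bar> ^ 3"
      proof (intro mult_right_mono mult_left_mono)
        have tA: "t \<ge> A" using t(1) uv by (auto split: if_splits)
        have tu: "\<bar>t - u\<bar> \<le> (1 + \<bar>u\<bar>) / 2" using t(1) uv(3) by (auto split: if_splits)
        have tri: "\<bar>t\<bar> \<le> \<bar>u\<bar> + \<bar>t - u\<bar>" "\<bar>u\<bar> \<le> \<bar>t\<bar> + \<bar>t - u\<bar>" by linarith+
        have "(1 + \<bar>t\<bar>) powr (r - 3) \<le> 2 powr \<bar>r - 3\<bar> * (1 + \<bar>u\<bar>) powr (r - 3)"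
          using tu tri by (intro powr_comparable) (auto simp: field_simps)
        then show "\<bar>He (r - 3) t\<bar> \<le> B * (2 powr \<bar>r - 3\<bar> * (1 + \<bar>u\<bar>) powr (r - 3))"
          using B(2)[OF tA] B(1) by (meson mult_left_mono less_imp_le order_trans)
      qed (use k0 in auto)
      also have "\<dots> \<le> C * (1 + \<bar>u\<bar>) powr (r - 3) * \<bar>v - u\<bar> ^ 3"
        unfolding C_def by (intro mult_right_mono) (auto simp: algebra_simps)
      finally show ?thesis .
    qed (simp add: taylor2_def)
  qed
qed

text \<open>
  The parameter \<open>\<tau>\<close> fixes the truncation level \<open>\<tau> * (1 + \<bar>u\<bar>) / 2\<close> of the jumps, proportional to
  the distance scale at \<open>u\<close>. Below this level the third-order remainder is bounded by the moment of order \<open>2 + \<delta>\<close>;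
  above it each term of the polynomial is, because \<open>1 + \<bar>u\<bar>\<close> is at most \<open>2 / \<tau> * \<bar>y\<bar>\<close> there. The
  price is the factor \<open>\<tau> powr (- 3)\<close>.
\<close>

lemma truncated_taylor2:
  fixes \<delta> A r :: real
  assumes \<delta>: "0 < \<delta>" "\<delta> \<le> 1"
  obtains C where "C > 0"
    "\<And>u y \<tau>. A \<le> u \<Longrightarrow> 0 < \<tau> \<Longrightarrow> \<tau> \<le> 1 \<Longrightarrow> (\<bar>y\<bar> \<le> \<tau> * (1 + \<bar>u\<bar>) / 2 \<Longrightarrow> A \<le> u + y) \<Longrightarrow>
       \<bar>(if \<bar>y\<bar> \<le> \<tau> * (1 + \<bar>u\<bar>) / 2 then He r (u + y) else 0) - taylor2 r u y\<bar>
         \<le> C * \<tau> powr (- 3) * (1 + \<bar>u\<bar>) powr (r - 2) * \<bar>y\<bar> powr (2 + \<delta>)"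
proof -
  obtain C1 where C1: "C1 > 0"
    "\<And>u v. A \<le> u \<Longrightarrow> A \<le> v \<Longrightarrow> \<bar>v - u\<bar> \<le> (1 + \<bar>u\<bar>) / 2 \<Longrightarrow>
       \<bar>He r v - taylor2 r u (v - u)\<bar> \<le> C1 * (1 + \<bar>u\<bar>) powr (r - 3) * \<bar>v - u\<bar> ^ 3"
    using taylor2_error by blast
  obtain B0 where B0: "B0 > 0" "\<And>x. x \<ge> A \<Longrightarrow> \<bar>He r x\<bar> \<le> B0 * (1 + \<bar>x\<bar>) powr r"
    using He_upper_bound by blast
  obtain B1 where B1: "B1 > 0" "\<And>x. x \<ge> A \<Longrightarrow> \<bar>He (r - 1) x\<bar> \<le> B1 * (1 + \<bar>x\<bar>) powr (r - 1)"
    using He_upper_bound by blast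
  obtain B2 where B2: "B2 > 0" "\<And>x. x \<ge> A \<Longrightarrow> \<bar>He (r - 2) x\<bar> \<le> B2 * (1 + \<bar>x\<bar>) powr (r - 2)"
    using He_upper_bound by blast
  define K where "K = B0 + \<bar>r\<bar> * B1 + \<bar>r * (r - 1) / 2\<bar> * B2"
  have K: "K > 0" using B0(1) B1(1) B2(1) by (simp add: K_def add_pos_nonneg)
  have Kc: "B0 \<le> K" "\<bar>r\<bar> * B1 \<le> K" "\<bar>r * (r - 1) / 2\<bar> * B2 \<le> K"
    using B0(1) B1(1) B2(1) by (simp_all add: K_def)
  define C where "C = C1 + 14 * K"
  have "C > 0" using C1 K by (simp add: C_def)
  then show ?thesis
  proof (rule that)
    fix u y \<tau> :: real
    assume u: "A \<le> u" and \<tau>: "0 < \<tau>" "\<tau> \<le> 1" and w: "\<bar>y\<bar> \<le> \<tau> * (1 + \<bar>u\<bar>) / 2 \<Longrightarrow> A \<le> u + y"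
    define a where "a = 1 + \<bar>u\<bar>"
    define z where "z = \<bar>y\<bar>"
    have a: "a \<ge> 1" by (simp add: a_def)
    have z: "z \<ge> 0" by (simp add: z_def)
    have \<tau>3: "\<tau> powr (- 3) \<ge> 1" using \<tau> by (simp add: powr_minus one_le_inverse_iff power_le_one)
    show "\<bar>(if \<bar>y\<bar> \<le> \<tau> * (1 + \<bar>u\<bar>) / 2 then He r (u + y) else 0) - taylor2 r u y\<bar>
         \<le> C * \<tau> powr (- 3) * (1 + \<bar>u\<bar>) powr (r - 2) * \<bar>y\<bar> powr (2 + \<delta>)"
    proof (cases "\<bar>y\<bar> \<le> \<tau> * (1 + \<bar>u\<bar>) / 2")
      case True
      have ya: "z \<le> a / 2" using True \<tau> mult_right_mono[of \<tau> 1 a] a by (simp add: a_def z_def)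
      have "\<bar>He r (u + y) - taylor2 r u y\<bar> \<le> C1 * a powr (r - 3) * z ^ 3"
      proof -
        have "\<bar>(u + y) - u\<bar> \<le> (1 + \<bar>u\<bar>) / 2" using ya unfolding a_def z_def by simp
        from C1(2)[OF u w[OF True] this] show ?thesis unfolding a_def z_def by simp
      qed
      also have "\<dots> \<le> C1 * a powr (r - 3) * (a * z powr (2 + \<delta>))"
      proof (intro mult_left_mono)
        show "z ^ 3 \<le> a * z powr (2 + \<delta>)"
        proof (cases "z = 0")
          case False
          then have "z ^ 3 = z powr (1 - \<delta>) * z powr (2 + \<delta>)"
            using z by (simp flip: powr_numeral powr_add)
          also have "z powr (1 - \<delta>) \<le> a powr (1 - \<delta>)" using z ya a \<delta> by (intro powr_mono2) auto
          also have "a powr (1 - \<delta>) \<le> a powr 1" using a \<delta> by (intro powr_mono) auto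
          finally show ?thesis using a by (simp add: mult_right_mono)
        qed simp
      qed (use C1(1) in auto)
      also have "\<dots> = C1 * a powr (r - 2) * z powr (2 + \<delta>)"
      proof -
        have "a powr (r - 2) = a powr (r - 3) * a"
          using a powr_add[of a "r - 3" 1] by simp
        then show ?thesis by simp
      qed
      also have "\<dots> \<le> (C * \<tau> powr (- 3)) * a powr (r - 2) * z powr (2 + \<delta>)"
      proof (intro mult_right_mono)
        show "C1 \<le> C * \<tau> powr (- 3)"
          using mult_mono[of C1 C 1 "\<tau> powr (- 3)"] \<tau>3 C1 K by (simp add: C_def)
      qed auto
      finally show ?thesis using True by (simp add: a_def z_def)
    next
      case False
      then have az: "a < 2 / \<tau> * z" using \<tau> by (simp add: a_def z_def field_simps)
      have "\<tau> * 1 \<le> \<tau> * a" using a \<tau> by (intro mult_left_mono) auto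
      moreover have "\<tau> * a / 2 < z" using False by (simp add: a_def z_def not_le)
      ultimately have zt: "z > \<tau> / 2" by linarith
      have z0: "z > 0" using zt \<tau> by linarith
      have t1: "1 \<le> 1 / \<tau>" using \<tau> by simp
      have e0: "\<bar>He r u\<bar> \<le> K * a powr (r - 2) * (4 / \<tau>\<^sup>2 * z\<^sup>2)"
      proof -
        have "\<bar>He r u\<bar> \<le> K * a powr r"
          using B0(2)[OF u] Kc(1) mult_right_mono[of B0 K "a powr r"] by (simp add: a_def)
        also have "a powr r = a powr (r - 2) * a\<^sup>2"
          using a by (simp flip: powr_numeral powr_add)
        also have "K * (a powr (r - 2) * a\<^sup>2) \<le> K * (a powr (r - 2) * (2 / \<tau> * z)\<^sup>2)"
          using K az a by (intro mult_left_mono power_mono) auto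
        finally show ?thesis by (simp add: power_mult_distrib power_divide)
      qed
      have e1: "\<bar>r * He (r - 1) u * y\<bar> \<le> K * a powr (r - 2) * (2 / \<tau> * z\<^sup>2)"
      proof -
        have "\<bar>r * He (r - 1) u * y\<bar> \<le> \<bar>r\<bar> * (B1 * a powr (r - 1)) * z"
          using B1(2)[OF u] by (auto simp: abs_mult a_def z_def intro!: mult_right_mono mult_left_mono)
        also have "\<dots> = (\<bar>r\<bar> * B1) * a powr (r - 1) * z" by simp
        also have "\<dots> \<le> K * a powr (r - 1) * z" using Kc(2) z by (intro mult_right_mono) auto
        also have "a powr (r - 1) = a powr (r - 2) * a"
          using a powr_add[of a "r - 2" 1] by simp
        also have "K * (a powr (r - 2) * a) * z \<le> K * (a powr (r - 2) * (2 / \<tau> * z)) * z"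
          using K az z by (intro mult_right_mono mult_left_mono) auto
        finally show ?thesis by (simp add: power2_eq_square)
      qed
      have e2: "\<bar>r * (r - 1) / 2 * He (r - 2) u * y\<^sup>2\<bar> \<le> K * a powr (r - 2) * z\<^sup>2"
      proof -
        have "\<bar>r * (r - 1) / 2 * He (r - 2) u * y\<^sup>2\<bar>
            = \<bar>r * (r - 1) / 2\<bar> * \<bar>He (r - 2) u\<bar> * z\<^sup>2" by (simp add: abs_mult z_def)
        also have "\<dots> \<le> \<bar>r * (r - 1) / 2\<bar> * (B2 * a powr (r - 2)) * z\<^sup>2"
          using B2(2)[OF u] by (intro mult_right_mono mult_left_mono) (auto simp: a_def)
        also have "\<dots> = (\<bar>r * (r - 1) / 2\<bar> * B2) * a powr (r - 2) * z\<^sup>2" by simp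
        also have "\<dots> \<le> K * a powr (r - 2) * z\<^sup>2" using Kc(3) by (intro mult_right_mono) auto
        finally show ?thesis .
      qed
      have t2: "4 / \<tau>\<^sup>2 + 2 / \<tau> + 1 \<le> 7 * (1 / \<tau>)\<^sup>2"
      proof -
        define b where "b = 1 / \<tau>"
        have b: "1 \<le> b" using t1 by (simp add: b_def)
        have "b \<le> b * b" using mult_left_mono[of 1 b b] b by linarith
        then have "4 * b\<^sup>2 + 2 * b + 1 \<le> 7 * b\<^sup>2" using b unfolding power2_eq_square by linarith
        then show ?thesis by (simp add: b_def power_divide)
      qed
      have z2: "z\<^sup>2 \<le> 2 / \<tau> * z powr (2 + \<delta>)"
      proof -
        have "z\<^sup>2 = z powr (- \<delta>) * z powr (2 + \<delta>)" using z0 by (simp flip: powr_numeral powr_add)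
        also have "z powr (- \<delta>) \<le> (\<tau> / 2) powr (- \<delta>)" using zt \<tau> \<delta> by (intro powr_mono2') auto
        also have "(\<tau> / 2) powr (- \<delta>) = (2 / \<tau>) powr \<delta>"
          using \<tau> by (simp add: powr_minus_divide powr_divide)
        also have "\<dots> \<le> (2 / \<tau>) powr 1" using \<tau> \<delta> by (intro powr_mono) auto
        finally show ?thesis using \<tau> by (simp add: mult_right_mono)
      qed
      have "\<bar>taylor2 r u y\<bar> \<le> K * a powr (r - 2) * (4 / \<tau>\<^sup>2 * z\<^sup>2)
          + K * a powr (r - 2) * (2 / \<tau> * z\<^sup>2) + K * a powr (r - 2) * z\<^sup>2"
        unfolding taylor2_def using e0 e1 e2 by linarith
      also have "\<dots> = K * a powr (r - 2) * ((4 / \<tau>\<^sup>2 + 2 / \<tau> + 1) * z\<^sup>2)"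
        by (simp add: algebra_simps)
      also have "\<dots> \<le> K * a powr (r - 2) * ((7 * (1 / \<tau>)\<^sup>2) * (2 / \<tau> * z powr (2 + \<delta>)))"
        using t2 z2 K \<tau> by (intro mult_left_mono mult_mono) auto
      also have "\<dots> = 14 * K * \<tau> powr (- 3) * a powr (r - 2) * z powr (2 + \<delta>)"
        using \<tau> by (simp add: powr_minus power_divide eval_nat_numeral field_simps)
      also have "\<dots> \<le> C * \<tau> powr (- 3) * a powr (r - 2) * z powr (2 + \<delta>)"
        using C1 by (intro mult_right_mono) (auto simp: C_def)
      finally show ?thesis using False by (simp add: a_def z_def)
    qed
  qed
qed

text \<open>
  The two powers serve \<open>p \<le> 2 + \<delta>\<close> and \<open>p > 2 + \<delta>\<close> at the same time. Both exponents are at least \<open>2 + \<delta>\<close>,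
  so that the moment of a step scaled down by \<open>sqrt s\<close> is of order \<open>s powr (- 1 - \<delta> / 2)\<close>.
\<close>

definition moment_fn :: "real \<Rightarrow> real \<Rightarrow> real \<Rightarrow> real" where
  "moment_fn \<delta> p y = \<bar>y\<bar> powr (2 + \<delta>) + \<bar>y\<bar> powr max p (2 + \<delta>)"

text \<open>
  A large jump may carry the walk far up, where the Hermite function grows like \<open>(1 + \<bar>v\<bar>) powr p\<close>. If
  \<open>p \<ge> 2 + \<delta>\<close>, the moment of order \<open>p\<close> pays for it; otherwise the missing power of \<open>\<bar>y\<bar>\<close> is bounded through
  the truncation level.
\<close>

lemma tail_power_bound:
  fixes p q \<delta> \<tau> u y :: real
  assumes p: "0 < p" and \<delta>: "0 < \<delta>" "\<delta> \<le> 1" and q: "0 \<le> q" "p - 2 \<le> q" and \<tau>: "0 < \<tau>" "\<tau> \<le> 1"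
    and y: "\<bar>y\<bar> > \<tau> * (1 + \<bar>u\<bar>) / 2"
  shows "(1 + \<bar>u + y\<bar>) powr p \<le> 8 * 3 powr p * \<tau> powr (- (p + 3)) * (1 + \<bar>u\<bar>) powr q * moment_fn \<delta> p y"
proof -
  define a where "a = 1 + \<bar>u\<bar>"
  define z where "z = \<bar>y\<bar>"
  have a: "a \<ge> 1" by (simp add: a_def)
  have az: "a < 2 / \<tau> * z" using y \<tau> by (simp add: a_def z_def field_simps)
  have "0 < \<tau> * (1 + \<bar>u\<bar>) / 2" using \<tau> by simp
  then have z0: "z > 0" unfolding z_def using y by linarith
  have t1: "1 \<le> 1 / \<tau>" using \<tau> by simp
  have "1 + \<bar>u + y\<bar> \<le> a + z" by (simp add: a_def z_def)
  also have "\<dots> \<le> 2 / \<tau> * z + 1 / \<tau> * z" using az mult_right_mono[OF t1, of z] z0 by simp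
  also have "\<dots> = 3 / \<tau> * z" using \<tau> by (simp add: field_simps)
  finally have "(1 + \<bar>u + y\<bar>) powr p \<le> (3 / \<tau> * z) powr p" using p by (intro powr_mono2) auto
  also have "\<dots> = 3 powr p * \<tau> powr (- p) * z powr p"
    using \<tau> z0 by (simp add: powr_mult powr_divide powr_minus_divide)
  also have "z powr p \<le> 8 * \<tau> powr (- 3) * a powr q * moment_fn \<delta> p y"
  proof (cases "p \<ge> 2 + \<delta>")
    case True
    have "1 \<le> \<tau> powr (- 3)" using \<tau> by (simp add: powr_minus one_le_inverse_iff power_le_one)
    moreover have "1 \<le> a powr q" using a q by (simp add: ge_one_powr_ge_zero)
    ultimately have "1 \<le> \<tau> powr (- 3) * a powr q" using mult_mono[of 1 _ 1] by force
    then have "1 \<le> 8 * \<tau> powr (- 3) * a powr q" by simp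
    moreover have "z powr p \<le> moment_fn \<delta> p y" using True by (simp add: moment_fn_def z_def max_def)
    ultimately show ?thesis
      using mult_mono[of 1 "8 * \<tau> powr (- 3) * a powr q" "z powr p" "moment_fn \<delta> p y"] by simp
  next
    case False
    define e where "e = 2 + \<delta> - p"
    have e: "0 < e" "e \<le> 3" using False p \<delta> by (auto simp: e_def)
    have "z powr p = z powr (- e) * z powr (2 + \<delta>)" by (simp add: e_def flip: powr_add)
    also have "z powr (- e) \<le> (\<tau> * a / 2) powr (- e)"
      using y e \<tau> a by (intro powr_mono2') (auto simp: a_def z_def)
    also have "(\<tau> * a / 2) powr (- e) = 2 powr e * \<tau> powr (- e) * a powr (- e)"
      using \<tau> a by (simp add: powr_mult powr_divide powr_minus_divide)
    also have "\<dots> \<le> 8 * \<tau> powr (- 3) * a powr q"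
    proof (intro mult_mono)
      show "2 powr e \<le> (8::real)" using powr_mono[of e 3 "2::real"] e by simp
      show "\<tau> powr (- e) \<le> \<tau> powr (- 3)" using \<tau> e by (intro powr_mono') auto
      show "a powr (- e) \<le> a powr q" using a e q by (intro powr_mono) (auto simp: e_def)
    qed auto
    finally have "z powr p \<le> 8 * \<tau> powr (- 3) * a powr q * z powr (2 + \<delta>)"
      by (simp add: mult_right_mono)
    also have "\<dots> \<le> 8 * \<tau> powr (- 3) * a powr q * moment_fn \<delta> p y"
      by (intro mult_left_mono) (auto simp: moment_fn_def z_def)
    finally show ?thesis .
  qed
  finally have "(1 + \<bar>u + y\<bar>) powr p
      \<le> 3 powr p * \<tau> powr (- p) * (8 * \<tau> powr (- 3) * a powr q * moment_fn \<delta> p y)"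
    by (simp add: mult_left_mono)
  also have "\<dots> = 8 * 3 powr p * (\<tau> powr (- p) * \<tau> powr (- 3)) * a powr q * moment_fn \<delta> p y" by simp
  also have "\<tau> powr (- p) * \<tau> powr (- 3) = \<tau> powr (- (p + 3))" by (simp flip: powr_add)
  finally show ?thesis by (simp add: a_def)
qed

definition step_error :: "real \<Rightarrow> real \<Rightarrow> real \<Rightarrow> real \<Rightarrow> real \<Rightarrow> real \<Rightarrow> real" where
  "step_error \<delta> p q \<tau> u y = \<tau> powr (- (p + 3)) * (1 + \<bar>u\<bar>) powr q * moment_fn \<delta> p y"

text \<open>
  The sign condition in the layer below \<open>c\<close> that small jumps from \<open>u\<close> can reach: \<open>He p + \<theta> * He q\<close> is
  nonnegative and \<open>He p - \<theta> * He q\<close> is nonpositive there.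
\<close>

definition window_ok :: "real \<Rightarrow> real \<Rightarrow> real \<Rightarrow> real \<Rightarrow> real \<Rightarrow> real \<Rightarrow> real \<Rightarrow> bool" where
  "window_ok p q c A \<theta> \<tau> u \<longleftrightarrow> (\<forall>v. \<bar>v - u\<bar> \<le> \<tau> * (1 + \<bar>u\<bar>) / 2 \<longrightarrow>
     A \<le> v \<and> (v \<le> c \<longrightarrow> He p v \<le> \<theta> * He q v \<and> 0 \<le> He p v + \<theta> * He q v))"

text \<open>
  For small jumps, \<open>window_ok\<close> says that killing decreases \<open>He p + \<theta> * He q\<close> and increases
  \<open>He p - \<theta> * He q\<close>, so the Taylor polynomial is an upper bound in the first case and a lower one in the second.
  Large jumps are estimated by absolute values.
\<close>

lemma killed_taylor2:
  fixes p q \<delta> A c :: real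
  assumes \<delta>: "0 < \<delta>" "\<delta> \<le> 1" and pq: "0 < p" "0 \<le> q" "q \<le> p" "p - 2 \<le> q" and Ac: "A \<le> c"
    and nonneg: "\<And>v. v \<ge> c \<Longrightarrow> 0 \<le> He p v" "\<And>v. v \<ge> c \<Longrightarrow> 0 \<le> He q v"
  obtains C where "C > 0"
    "\<And>u y \<tau> \<theta>. A \<le> u \<Longrightarrow> 0 < \<tau> \<Longrightarrow> \<tau> \<le> 1 \<Longrightarrow> 0 \<le> \<theta> \<Longrightarrow> \<theta> \<le> 1 \<Longrightarrow>
       window_ok p q c A \<theta> \<tau> u \<Longrightarrow>
       (if u + y > c then He p (u + y) + \<theta> * He q (u + y) else 0)
         \<le> taylor2 p u y + \<theta> * taylor2 q u y + C * step_error \<delta> p q \<tau> u y"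
    "\<And>u y \<tau> \<theta>. A \<le> u \<Longrightarrow> 0 < \<tau> \<Longrightarrow> \<tau> \<le> 1 \<Longrightarrow> 0 \<le> \<theta> \<Longrightarrow> \<theta> \<le> 1 \<Longrightarrow>
       window_ok p q c A \<theta> \<tau> u \<Longrightarrow>
       taylor2 p u y - \<theta> * taylor2 q u y - C * step_error \<delta> p q \<tau> u y
         \<le> (if u + y > c then He p (u + y) - \<theta> * He q (u + y) else 0)"
proof -
  obtain Cp where Cp: "Cp > 0"
    "\<And>u y \<tau>. A \<le> u \<Longrightarrow> 0 < \<tau> \<Longrightarrow> \<tau> \<le> 1 \<Longrightarrow> (\<bar>y\<bar> \<le> \<tau> * (1 + \<bar>u\<bar>) / 2 \<Longrightarrow> A \<le> u + y) \<Longrightarrow>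
       \<bar>(if \<bar>y\<bar> \<le> \<tau> * (1 + \<bar>u\<bar>) / 2 then He p (u + y) else 0) - taylor2 p u y\<bar>
         \<le> Cp * \<tau> powr (- 3) * (1 + \<bar>u\<bar>) powr (p - 2) * \<bar>y\<bar> powr (2 + \<delta>)"
    using truncated_taylor2[OF \<delta>, of A p] by blast
  obtain Cq where Cq: "Cq > 0"
    "\<And>u y \<tau>. A \<le> u \<Longrightarrow> 0 < \<tau> \<Longrightarrow> \<tau> \<le> 1 \<Longrightarrow> (\<bar>y\<bar> \<le> \<tau> * (1 + \<bar>u\<bar>) / 2 \<Longrightarrow> A \<le> u + y) \<Longrightarrow>
       \<bar>(if \<bar>y\<bar> \<le> \<tau> * (1 + \<bar>u\<bar>) / 2 then He q (u + y) else 0) - taylor2 q u y\<bar>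
         \<le> Cq * \<tau> powr (- 3) * (1 + \<bar>u\<bar>) powr (q - 2) * \<bar>y\<bar> powr (2 + \<delta>)"
    using truncated_taylor2[OF \<delta>, of A q] by blast
  obtain Bp where Bp: "Bp > 0" "\<And>x. x \<ge> c \<Longrightarrow> \<bar>He p x\<bar> \<le> Bp * (1 + \<bar>x\<bar>) powr p"
    using He_upper_bound by blast
  obtain Bq where Bq: "Bq > 0" "\<And>x. x \<ge> c \<Longrightarrow> \<bar>He q x\<bar> \<le> Bq * (1 + \<bar>x\<bar>) powr q"
    using He_upper_bound by blast
  define K where "K = (Bp + Bq) * (8 * 3 powr p)"
  define C where "C = Cp + Cq + K"
  have K: "K > 0" using Bp(1) Bq(1) by (simp add: K_def)
  have C: "C > 0" using Cp(1) Cq(1) K by (simp add: C_def)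
  have err: "\<bar>(if \<bar>y\<bar> \<le> \<tau> * (1 + \<bar>u\<bar>) / 2 then He p (u + y) else 0) - taylor2 p u y\<bar>
      \<le> Cp * step_error \<delta> p q \<tau> u y"
    "\<bar>(if \<bar>y\<bar> \<le> \<tau> * (1 + \<bar>u\<bar>) / 2 then \<theta> * He q (u + y) else 0) - \<theta> * taylor2 q u y\<bar>
      \<le> Cq * step_error \<delta> p q \<tau> u y"
    "\<bar>y\<bar> > \<tau> * (1 + \<bar>u\<bar>) / 2 \<Longrightarrow> u + y > c \<Longrightarrow>
       He p (u + y) + \<theta> * He q (u + y) \<le> K * step_error \<delta> p q \<tau> u y"
    "0 \<le> step_error \<delta> p q \<tau> u y"
    if u: "A \<le> u" and \<tau>: "0 < \<tau>" "\<tau> \<le> 1" and \<theta>: "0 \<le> \<theta>" "\<theta> \<le> 1"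
      and w: "\<bar>y\<bar> \<le> \<tau> * (1 + \<bar>u\<bar>) / 2 \<Longrightarrow> A \<le> u + y" for u y \<tau> \<theta>
  proof -
    have le: "k * \<tau> powr (- 3) * (1 + \<bar>u\<bar>) powr e * \<bar>y\<bar> powr (2 + \<delta>) \<le> k * step_error \<delta> p q \<tau> u y"
      if "k \<ge> 0" "e \<le> q" for k e
    proof -
      have "\<tau> powr (- 3) * (1 + \<bar>u\<bar>) powr e * \<bar>y\<bar> powr (2 + \<delta>) \<le> step_error \<delta> p q \<tau> u y"
        unfolding step_error_def
      proof (intro mult_mono)
        show "\<tau> powr (- 3) \<le> \<tau> powr (- (p + 3))" using \<tau> pq by (intro powr_mono') auto
        show "(1 + \<bar>u\<bar>) powr e \<le> (1 + \<bar>u\<bar>) powr q" using that by (intro powr_mono) auto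
        show "\<bar>y\<bar> powr (2 + \<delta>) \<le> moment_fn \<delta> p y" by (simp add: moment_fn_def)
      qed auto
      from mult_left_mono[OF this that(1)] show ?thesis by (simp add: mult.assoc)
    qed
    show "\<bar>(if \<bar>y\<bar> \<le> \<tau> * (1 + \<bar>u\<bar>) / 2 then He p (u + y) else 0) - taylor2 p u y\<bar>
      \<le> Cp * step_error \<delta> p q \<tau> u y"
      using Cp(2)[OF u \<tau> w] le[of Cp "p - 2"] Cp(1) pq by (meson less_imp_le order_trans)
    have cq: "\<bar>(if \<bar>y\<bar> \<le> \<tau> * (1 + \<bar>u\<bar>) / 2 then He q (u + y) else 0) - taylor2 q u y\<bar>
      \<le> Cq * step_error \<delta> p q \<tau> u y"
      using Cq(2)[OF u \<tau> w] le[of Cq "q - 2"] Cq(1) by (meson diff_le_eq le_add_same_cancel1 less_imp_le order_trans zero_le_numeral)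
    have "\<bar>\<theta> * ((if \<bar>y\<bar> \<le> \<tau> * (1 + \<bar>u\<bar>) / 2 then He q (u + y) else 0) - taylor2 q u y)\<bar>
      \<le> 1 * (Cq * step_error \<delta> p q \<tau> u y)"
      unfolding abs_mult
      using \<theta> by (intro mult_mono cq) auto
    then show "\<bar>(if \<bar>y\<bar> \<le> \<tau> * (1 + \<bar>u\<bar>) / 2 then \<theta> * He q (u + y) else 0) - \<theta> * taylor2 q u y\<bar>
      \<le> Cq * step_error \<delta> p q \<tau> u y"
      by (simp add: right_diff_distrib split: if_splits)
    show "0 \<le> step_error \<delta> p q \<tau> u y" by (simp add: step_error_def moment_fn_def)
    assume far: "\<bar>y\<bar> > \<tau> * (1 + \<bar>u\<bar>) / 2" "u + y > c"
    have "He p (u + y) \<le> Bp * (1 + \<bar>u + y\<bar>) powr p" using Bp(2)[of "u + y"] far(2) by simp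
    moreover have "\<theta> * He q (u + y) \<le> 1 * (Bq * (1 + \<bar>u + y\<bar>) powr p)"
    proof (intro mult_mono)
      have "He q (u + y) \<le> Bq * (1 + \<bar>u + y\<bar>) powr q" using Bq(2)[of "u + y"] far(2) by simp
      also have "\<dots> \<le> Bq * (1 + \<bar>u + y\<bar>) powr p" using Bq(1) pq by (intro mult_left_mono powr_mono) auto
      finally show "He q (u + y) \<le> Bq * (1 + \<bar>u + y\<bar>) powr p" .
    qed (use \<theta> far nonneg in auto)
    ultimately have "He p (u + y) + \<theta> * He q (u + y) \<le> (Bp + Bq) * (1 + \<bar>u + y\<bar>) powr p"
      by (simp add: distrib_right)
    also have "\<dots> \<le> (Bp + Bq) * (8 * 3 powr p * \<tau> powr (- (p + 3)) * (1 + \<bar>u\<bar>) powr q * moment_fn \<delta> p y)"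
      using Bp(1) Bq(1) pq \<delta> \<tau> far by (intro mult_left_mono tail_power_bound) auto
    also have "\<dots> = K * step_error \<delta> p q \<tau> u y" by (simp add: K_def step_error_def)
    finally show "He p (u + y) + \<theta> * He q (u + y) \<le> K * step_error \<delta> p q \<tau> u y" .
  qed
  show ?thesis
  proof (rule that[OF C])
    fix u y \<tau> \<theta> :: real
    assume u: "A \<le> u" and \<tau>: "0 < \<tau>" "\<tau> \<le> 1" and \<theta>: "0 \<le> \<theta>" "\<theta> \<le> 1"
      and w: "window_ok p q c A \<theta> \<tau> u"
    have wy: "A \<le> u + y" "u + y \<le> c \<Longrightarrow> He p (u + y) \<le> \<theta> * He q (u + y)"
        "u + y \<le> c \<Longrightarrow> 0 \<le> He p (u + y) + \<theta> * He q (u + y)"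
      if "\<bar>y\<bar> \<le> \<tau> * (1 + \<bar>u\<bar>) / 2"
      using w[unfolded window_ok_def, rule_format, of "u + y"] that by auto
    note e = err[OF u \<tau> \<theta> wy(1)]
    have Ce: "C * step_error \<delta> p q \<tau> u y = Cp * step_error \<delta> p q \<tau> u y
        + Cq * step_error \<delta> p q \<tau> u y + K * step_error \<delta> p q \<tau> u y"
      by (simp add: C_def algebra_simps)
    have K0: "0 \<le> K * step_error \<delta> p q \<tau> u y" using e(4) K by simp
    have far0: "0 \<le> He p (u + y)" "0 \<le> \<theta> * He q (u + y)" if "u + y > c"
      using nonneg that \<theta> by auto
    show "(if u + y > c then He p (u + y) + \<theta> * He q (u + y) else 0)
         \<le> taylor2 p u y + \<theta> * taylor2 q u y + C * step_error \<delta> p q \<tau> u y"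
    proof (cases "\<bar>y\<bar> \<le> \<tau> * (1 + \<bar>u\<bar>) / 2")
      case True
      then show ?thesis using e(1,2) wy(3) K0 Ce by (auto simp: not_less)
    next
      case False
      then show ?thesis using e(1,2,3) K0 Ce by (auto simp: not_less)
    qed
    show "taylor2 p u y - \<theta> * taylor2 q u y - C * step_error \<delta> p q \<tau> u y
         \<le> (if u + y > c then He p (u + y) - \<theta> * He q (u + y) else 0)"
    proof (cases "\<bar>y\<bar> \<le> \<tau> * (1 + \<bar>u\<bar>) / 2")
      case True
      then show ?thesis using e(1,2) wy(2) K0 Ce by (auto simp: not_less)
    next
      case False
      then show ?thesis using e(1,2,3) K0 Ce far0 by (auto simp: not_less)
    qed
  qed
qed

text \<open>
  This is the function \<open>V r\<close> for positive times. At time \<open>0\<close> it is \<open>0\<close>, by the convention for \<open>powr\<close>, which only affects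
  the starting point of the walk.
\<close>

definition heat_hermite :: "real \<Rightarrow> real \<Rightarrow> real \<Rightarrow> real" where
  "heat_hermite r x t = t powr (r / 2) * He r (x / sqrt t)"

text \<open>
  The mean of the second-order Taylor polynomial of \<open>He r\<close> at \<open>u\<close> when the increment is centred with variance \<open>1 / s\<close>.
\<close>

definition step_mean :: "real \<Rightarrow> real \<Rightarrow> real \<Rightarrow> real" where
  "step_mean r u s = He r u + r * (r - 1) * He (r - 2) u / (2 * s)"

lemma heat_hermite_measurable [measurable]: "(\<lambda>x. heat_hermite r x t) \<in> borel_measurable borel"
proof -
  have "continuous_on UNIV (He r)"
    by (intro continuous_at_imp_continuous_on ballI DERIV_isCont[OF He_has_derivative])
  then have [measurable]: "He r \<in> borel_measurable borel"
    by (rule borel_measurable_continuous_onI)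
  show ?thesis unfolding heat_hermite_def by measurable
qed

text \<open>
  The backward heat equation: \<open>r * (r - 1) * heat_hermite (r - 2) x t\<close> is the second derivative in \<open>x\<close>.
\<close>

lemma heat_hermite_time_derivative:
  assumes "t > 0"
  shows "((\<lambda>t. heat_hermite r x t) has_real_derivative - (r * (r - 1) / 2) * heat_hermite (r - 2) x t) (at t)"
proof -
  define u where "u = x / sqrt t"
  have du: "((\<lambda>t. x / sqrt t) has_real_derivative - (u / (2 * t))) (at t)"
    using assms by (auto intro!: derivative_eq_intros simp: u_def field_simps)
  have dp: "((\<lambda>t. t powr (r / 2)) has_real_derivative r / 2 * t powr (r / 2 - 1)) (at t)"
    using assms by (auto intro!: derivative_eq_intros)
  have dh: "((\<lambda>t. He r (x / sqrt t)) has_real_derivative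
      r * He (r - 1) u * - (u / (2 * t))) (at t)"
    using DERIV_chain2[OF He_has_derivative du] by (simp add: u_def)
  have "(heat_hermite r x has_real_derivative
      r / 2 * t powr (r / 2 - 1) * He r u
        + r * He (r - 1) u * - (u / (2 * t)) * t powr (r / 2)) (at t)"
    unfolding heat_hermite_def[abs_def] using DERIV_mult[OF dp dh] by (simp add: u_def)
  moreover have "r / 2 * t powr (r / 2 - 1) * He r u
        + r * He (r - 1) u * - (u / (2 * t)) * t powr (r / 2)
      = - (r * (r - 1) / 2) * heat_hermite (r - 2) x t"
  proof -
    have "t powr (r / 2) = t powr (r / 2 - 1) * t"
      using assms powr_add[of t "r / 2 - 1" 1] by simp
    then have "r / 2 * t powr (r / 2 - 1) * He r u
          + r * He (r - 1) u * - (u / (2 * t)) * t powr (r / 2)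
        = t powr (r / 2 - 1) * (r / 2) * (He r u - u * He (r - 1) u)"
      using assms by (simp add: field_simps)
    also have "He r u - u * He (r - 1) u = - ((r - 1) * He (r - 2) u)"
      using He_recurrence[of r u] by simp
    finally show ?thesis
      unfolding heat_hermite_def u_def diff_divide_distrib[of r 2 2] by simp
  qed
  ultimately show ?thesis by (simp only:)
qed

text \<open>
  One unit of time undoes one centred step of unit variance: a second-order expansion in time, taken at \<open>t + 1\<close>, produces
  exactly the mean of the spatial Taylor polynomial. The error is the second time derivative, that is, a multiple of
  the function of order \<open>r - 4\<close>.
\<close>

lemma heat_hermite_time_step:
  fixes c r :: real
  obtains C where "C > 0" "\<And>x t. t \<ge> 1 \<Longrightarrow> x \<ge> c * sqrt t \<Longrightarrow>
     \<bar>heat_hermite r x t - (t + 1) powr (r / 2) * step_mean r (x / sqrt (t + 1)) (t + 1)\<bar>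
       \<le> C * (t + 1) powr (r / 2 - 2) * (1 + \<bar>x / sqrt (t + 1)\<bar>) powr (r - 4)"
proof -
  obtain B where B: "B > 0" "\<And>v. v \<ge> - \<bar>c\<bar> \<Longrightarrow> \<bar>He (r - 4) v\<bar> \<le> B * (1 + \<bar>v\<bar>) powr (r - 4)"
    using He_upper_bound by blast
  define k where "k = r * (r - 1) * (r - 2) * (r - 3) / 4"
  define C where "C = \<bar>k\<bar> / 2 * (2 powr \<bar>r / 2 - 2\<bar> * (B * 2 powr \<bar>r - 4\<bar>)) + 1"
  have "C > 0" using B(1) by (simp add: C_def add_nonneg_pos)
  then show ?thesis
  proof (rule that)
    fix x t :: real assume t: "t \<ge> 1" and x: "x \<ge> c * sqrt t"
    define s where "s = t + 1"
    define u where "u = x / sqrt s"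
    have s: "s \<ge> 2" "s > 0" "t \<le> s" using t by (auto simp: s_def)
    define diff where "diff m \<tau> = (if m = 0 then heat_hermite r x \<tau>
        else if m = 1 then - (r * (r - 1) / 2) * heat_hermite (r - 2) x \<tau> else k * heat_hermite (r - 4) x \<tau>)"
      for m :: nat and \<tau>
    have d0: "diff 0 = heat_hermite r x" by (simp add: diff_def[abs_def])
    have dd: "\<forall>m \<tau>. m < 2 \<and> t \<le> \<tau> \<and> \<tau> \<le> s \<longrightarrow> DERIV (diff m) \<tau> :> diff (Suc m) \<tau>"
    proof (intro allI impI)
      fix m :: nat and \<tau> :: real
      assume m: "m < 2 \<and> t \<le> \<tau> \<and> \<tau> \<le> s"
      then have "\<tau> > 0" using t by simp
      note D = heat_hermite_time_derivative[OF this]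
      consider "m = 0" | "m = 1" using m by linarith
      then show "DERIV (diff m) \<tau> :> diff (Suc m) \<tau>"
      proof cases
        case 1
        then show ?thesis using D[of r x] by (simp add: diff_def[abs_def])
      next
        case 2
        have D': "((\<lambda>\<tau>. - (r * (r - 1) / 2) * heat_hermite (r - 2) x \<tau>) has_real_derivative
            - (r * (r - 1) / 2) * (- ((r - 2) * (r - 2 - 1) / 2) * heat_hermite (r - 2 - 2) x \<tau>)) (at \<tau>)"
          by (intro DERIV_cmult D)
        have k': "- (r * (r - 1) / 2) * (- ((r - 2) * (r - 2 - 1) / 2) * h) = k * h" for h
          unfolding k_def by (simp add: field_simps)
        from D'[unfolded k'] show ?thesis using 2 by (simp add: diff_def[abs_def])
      qed
    qed
    obtain \<zeta> where \<zeta>: "t < \<zeta>" "\<zeta> < s" "heat_hermite r x t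
        = (\<Sum>m<2. diff m s / fact m * (t - s) ^ m) + diff 2 \<zeta> / fact 2 * (t - s) ^ 2"
      using Taylor_down[of 2 diff "heat_hermite r x" t s s, OF _ d0 dd] s t by (auto simp: s_def)
    have "(\<Sum>m<2. diff m s / fact m * (t - s) ^ m) = heat_hermite r x s + r * (r - 1) / 2 * heat_hermite (r - 2) x s"
      by (simp add: diff_def eval_nat_numeral s_def)
    also have "\<dots> = s powr (r / 2) * step_mean r u s"
    proof -
      have "s powr (r / 2) = s powr ((r - 2) / 2) * s"
        using s powr_add[of s "(r - 2) / 2" 1] by (simp add: field_simps)
      then show ?thesis using s by (simp add: heat_hermite_def step_mean_def u_def field_simps)
    qed
    finally have "heat_hermite r x t - s powr (r / 2) * step_mean r u s = k / 2 * heat_hermite (r - 4) x \<zeta>"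
      using \<zeta>(3) by (simp add: diff_def s_def)
    then have "\<bar>heat_hermite r x t - s powr (r / 2) * step_mean r u s\<bar> = \<bar>k / 2 * heat_hermite (r - 4) x \<zeta>\<bar>"
      by (simp only:)
    also have "\<dots> = \<bar>k\<bar> / 2 * (\<zeta> powr ((r - 4) / 2) * \<bar>He (r - 4) (x / sqrt \<zeta>)\<bar>)"
      by (simp add: abs_mult heat_hermite_def)
    also have "\<dots> \<le> \<bar>k\<bar> / 2 * ((2 powr \<bar>r / 2 - 2\<bar> * s powr (r / 2 - 2)) * (B * (2 powr \<bar>r - 4\<bar> * (1 + \<bar>u\<bar>) powr (r - 4))))"
    proof (intro mult_left_mono mult_mono)
      show "\<zeta> powr ((r - 4) / 2) \<le> 2 powr \<bar>r / 2 - 2\<bar> * s powr (r / 2 - 2)"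
        using powr_comparable[of s \<zeta> "r / 2 - 2"] \<zeta> s t by (simp add: diff_divide_distrib s_def)
      have \<zeta>0: "\<zeta> > 0" using \<zeta> t by simp
      have "x / sqrt \<zeta> \<ge> - \<bar>c\<bar>"
      proof -
        have "- \<bar>c\<bar> * sqrt \<zeta> \<le> - \<bar>c\<bar> * sqrt t" using \<zeta> by (intro mult_left_mono_neg) auto
        also have "\<dots> \<le> c * sqrt t" using t by (intro mult_right_mono) auto
        finally have "- \<bar>c\<bar> * sqrt \<zeta> \<le> x" using x by simp
        then show ?thesis using \<zeta>0 by (subst le_divide_eq) simp
      qed
      then have "\<bar>He (r - 4) (x / sqrt \<zeta>)\<bar> \<le> B * (1 + \<bar>x / sqrt \<zeta>\<bar>) powr (r - 4)" by (rule B(2))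
      also have "\<dots> \<le> B * (2 powr \<bar>r - 4\<bar> * (1 + \<bar>u\<bar>) powr (r - 4))"
      proof (intro mult_left_mono powr_comparable)
        have gen: "1 + a \<le> 2 * (1 + b)" if "a \<le> b" "0 \<le> b" for a b :: real using that by simp
        have gen': "1 + b \<le> 2 * (1 + a)" if "b \<le> 2 * a" for a b :: real using that by simp
        have "\<bar>x / sqrt s\<bar> \<le> \<bar>x / sqrt \<zeta>\<bar>"
          using \<zeta> \<zeta>0 by (simp add: abs_divide divide_left_mono)
        then show "1 + \<bar>u\<bar> \<le> 2 * (1 + \<bar>x / sqrt \<zeta>\<bar>)"
          unfolding u_def by (rule gen) simp
        have "sqrt s \<le> sqrt (4 * \<zeta>)" using \<zeta> t by (simp add: s_def)
        then have "sqrt s \<le> 2 * sqrt \<zeta>" by (simp add: real_sqrt_mult)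
        then have "\<bar>x\<bar> * sqrt s \<le> \<bar>x\<bar> * (2 * sqrt \<zeta>)" by (intro mult_left_mono) auto
        then have "\<bar>x / sqrt \<zeta>\<bar> \<le> 2 * \<bar>x / sqrt s\<bar>"
          using \<zeta>0 s by (simp add: abs_divide field_simps)
        then show "1 + \<bar>x / sqrt \<zeta>\<bar> \<le> 2 * (1 + \<bar>u\<bar>)" unfolding u_def by (rule gen')
      qed (use B(1) in auto)
      finally show "\<bar>He (r - 4) (x / sqrt \<zeta>)\<bar> \<le> B * (2 powr \<bar>r - 4\<bar> * (1 + \<bar>u\<bar>) powr (r - 4))" .
    qed auto
    also have "\<dots> = (C - 1) * s powr (r / 2 - 2) * (1 + \<bar>u\<bar>) powr (r - 4)" by (simp add: C_def)
    also have "\<dots> \<le> C * s powr (r / 2 - 2) * (1 + \<bar>u\<bar>) powr (r - 4)" by (intro mult_right_mono) auto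
    finally show "\<bar>heat_hermite r x t - (t + 1) powr (r / 2) * step_mean r (x / sqrt (t + 1)) (t + 1)\<bar>
       \<le> C * (t + 1) powr (r / 2 - 2) * (1 + \<bar>x / sqrt (t + 1)\<bar>) powr (r - 4)"
      by (simp add: u_def s_def)
  qed
qed

section \<open>One step of the killed walk\<close>

locale centred_step = prob_space \<mu> for \<mu> :: "real measure" +
  assumes sets_step [measurable_cong]: "sets \<mu> = sets borel"
    and step_integrable: "integrable \<mu> (\<lambda>\<xi>. \<xi>)"
    and step_mean_zero: "(LINT \<xi>|\<mu>. \<xi>) = 0"
    and step_square_integrable: "integrable \<mu> (\<lambda>\<xi>. \<xi>\<^sup>2)"
    and step_variance: "(LINT \<xi>|\<mu>. \<xi>\<^sup>2) = 1"
begin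

lemma taylor2_integral:
  assumes "s > 0"
  shows "integrable \<mu> (\<lambda>\<xi>. taylor2 r u (\<xi> / sqrt s))"
    and "(LINT \<xi>|\<mu>. taylor2 r u (\<xi> / sqrt s)) = step_mean r u s"
proof -
  have eq: "taylor2 r u (\<xi> / sqrt s) = He r u + r * He (r - 1) u / sqrt s * \<xi>
      + r * (r - 1) * He (r - 2) u / (2 * s) * \<xi>\<^sup>2" for \<xi>
    using assms by (simp add: taylor2_def power_divide)
  show "integrable \<mu> (\<lambda>\<xi>. taylor2 r u (\<xi> / sqrt s))"
    unfolding eq using step_integrable step_square_integrable by simp
  show "(LINT \<xi>|\<mu>. taylor2 r u (\<xi> / sqrt s)) = step_mean r u s"
    unfolding eq using step_integrable step_square_integrable
    by (simp add: step_mean_zero step_variance step_mean_def prob_space)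
qed

end

lemma moment_fn_scale:
  assumes "s \<ge> 1" "\<delta> > 0"
  shows "moment_fn \<delta> p (\<xi> / sqrt s) \<le> s powr (- 1 - \<delta> / 2) * moment_fn \<delta> p \<xi>"
proof -
  have "\<bar>\<xi> / sqrt s\<bar> powr e \<le> s powr (- 1 - \<delta> / 2) * \<bar>\<xi>\<bar> powr e" if "e \<ge> 2 + \<delta>" for e
  proof -
    have "sqrt s powr e = s powr (e / 2)" using assms by (simp add: powr_half_sqrt[symmetric] powr_powr)
    then have "\<bar>\<xi> / sqrt s\<bar> powr e = s powr (- e / 2) * \<bar>\<xi>\<bar> powr e"
      using assms by (simp add: abs_divide powr_divide powr_minus_divide)
    also have "\<dots> \<le> s powr (- 1 - \<delta> / 2) * \<bar>\<xi>\<bar> powr e"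
      using assms that by (intro mult_right_mono powr_mono) auto
    finally show ?thesis .
  qed
  from this[of "2 + \<delta>"] this[of "max p (2 + \<delta>)"] show ?thesis
    by (simp add: moment_fn_def distrib_left)
qed

text \<open>
  A small jump from above the boundary at time \<open>s - 1\<close> ends at most a multiple of \<open>\<tau>\<close> below \<open>c\<close> in the scale
  of time \<open>s\<close>. The boundary itself moves by a multiple of \<open>1 / s\<close> in this scale, and \<open>1 \<le> s * \<tau>\<close> bounds
  this by the same multiple of \<open>\<tau>\<close>.
\<close>

lemma window_above_boundary:
  fixes c x s \<tau> v :: real
  assumes s: "s \<ge> 2" and x: "x \<ge> c * sqrt (s - 1)" and \<tau>: "0 < \<tau>" "\<tau> \<le> 1" "1 \<le> s * \<tau>"
  shows "x / sqrt s \<ge> - \<bar>c\<bar>"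
    and "\<bar>v - x / sqrt s\<bar> \<le> \<tau> * (1 + \<bar>x / sqrt s\<bar>) / 2 \<Longrightarrow> v \<ge> c - (1 + 2 * \<bar>c\<bar>) * \<tau>"
proof -
  define u where "u = x / sqrt s"
  define \<rho> where "\<rho> = sqrt ((s - 1) / s)"
  have "(s - 1) / s \<ge> 0" "(s - 1) / s \<le> 1" using s by auto
  then have \<rho>1: "\<rho> \<le> 1" "0 \<le> \<rho>" by (auto simp: \<rho>_def)
  have "(s - 1) / s \<le> \<rho>"
  proof -
    have "y \<le> sqrt y" if "0 \<le> y" "y \<le> 1" for y :: real
      using that by (intro real_le_rsqrt) (simp add: power2_eq_square mult_left_le)
    then show ?thesis using \<open>(s - 1) / s \<ge> 0\<close> \<open>(s - 1) / s \<le> 1\<close> unfolding \<rho>_def by blast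
  qed
  moreover have "1 / s \<le> \<tau>" using s \<tau> by (simp add: divide_le_eq mult.commute)
  ultimately have \<rho>2: "1 - \<tau> \<le> \<rho>" using s by (simp add: diff_divide_distrib)
  have "x / sqrt s \<ge> c * sqrt (s - 1) / sqrt s" using x s by (intro divide_right_mono) auto
  then have u: "u \<ge> c * \<rho>" by (simp add: u_def \<rho>_def real_sqrt_divide)
  have "\<bar>c * \<rho>\<bar> \<le> \<bar>c\<bar> * 1" unfolding abs_mult using \<rho>1 by (intro mult_left_mono) auto
  then have uc: "u \<ge> - \<bar>c\<bar>" using u by linarith
  then show "x / sqrt s \<ge> - \<bar>c\<bar>" by (simp add: u_def)
  assume "\<bar>v - x / sqrt s\<bar> \<le> \<tau> * (1 + \<bar>x / sqrt s\<bar>) / 2"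
  then have "v \<ge> u - \<tau> * (1 + \<bar>u\<bar>) / 2" unfolding u_def[symmetric] by linarith
  then have v: "v \<ge> u - \<tau> / 2 - \<tau> * \<bar>u\<bar> / 2" by (simp add: algebra_simps add_divide_distrib)
  have c\<tau>: "0 \<le> \<tau> * \<bar>c\<bar>" using \<tau> by simp
  have exp_goal: "(1 + 2 * \<bar>c\<bar>) * \<tau> = \<tau> + 2 * (\<tau> * \<bar>c\<bar>)" by (simp add: algebra_simps)
  show "v \<ge> c - (1 + 2 * \<bar>c\<bar>) * \<tau>"
  proof (cases "u \<le> 0")
    case True
    then have "\<tau> * \<bar>u\<bar> \<le> \<tau> * \<bar>c\<bar>" using uc \<tau> by (intro mult_left_mono) auto
    moreover have "u \<ge> c - \<tau> * \<bar>c\<bar>"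
    proof (cases "c \<le> 0")
      case c: True
      then have "c * 1 \<le> c * \<rho>" using \<rho>1 by (intro mult_left_mono_neg) auto
      then show ?thesis using u c\<tau> by linarith
    next
      case False
      then have "c * (1 - \<tau>) \<le> c * \<rho>" using \<rho>2 by (intro mult_left_mono) auto
      then show ?thesis using u False by (simp add: algebra_simps)
    qed
    ultimately show ?thesis unfolding exp_goal using v \<tau>(1) c\<tau> by linarith
  next
    case False
    then have v': "v \<ge> u * (1 - \<tau> / 2) - \<tau> / 2" using v by (simp add: algebra_simps)
    show ?thesis
    proof (cases "c \<le> 0")
      case True
      have "0 \<le> u * (1 - \<tau> / 2)" using False \<tau> by (intro mult_nonneg_nonneg) auto
      then show ?thesis using v' True \<tau> c\<tau> by (simp add: algebra_simps)
    next
      case c: False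
      have "c * (1 - \<tau>) \<le> c * \<rho>" using \<rho>2 c by (intro mult_left_mono) auto
      then have "c * (1 - \<tau>) \<le> u" using u by linarith
      then have "c * (1 - \<tau>) * (1 - \<tau> / 2) \<le> u * (1 - \<tau> / 2)" using \<tau> by (intro mult_right_mono) auto
      moreover have "c * (1 - \<tau>) * (1 - \<tau> / 2) = c - 3 / 2 * (\<tau> * c) + c * \<tau>\<^sup>2 / 2"
        by (simp add: field_simps power2_eq_square)
      moreover have "0 \<le> c * \<tau>\<^sup>2 / 2" using c by simp
      moreover have ac: "\<bar>c\<bar> = c" and "0 \<le> \<tau> * c" using c \<tau> by auto
      ultimately show ?thesis unfolding exp_goal unfolding ac using v' \<tau>(1) by linarith
    qed
  qed
qed

lemma He_near_root:
  fixes p q c :: real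
  assumes p: "p > 0" and root: "He p c = 0" and pos: "He q c > 0" "He (p - 1) c > 0"
  obtains \<epsilon> L B where "0 < \<epsilon>" "\<epsilon> \<le> 1" "0 < L" "0 < B"
    "\<And>v. c - \<epsilon> \<le> v \<Longrightarrow> v \<le> c \<Longrightarrow>
       L \<le> He q v \<and> He p v \<le> 0 \<and> - (B * (c - v)) \<le> He p v"
proof -
  define a where "a = He (p - 1) c"
  define b where "b = He q c"
  have "isCont (He q) c" "isCont (He (p - 1)) c"
    by (rule DERIV_isCont[OF He_has_derivative])+
  then have "(He q \<longlongrightarrow> b) (nhds c)" "(He (p - 1) \<longlongrightarrow> a) (nhds c)"
    unfolding a_def b_def by (simp_all add: continuous_at tendsto_at_iff_tendsto_nhds)
  then have "\<forall>\<^sub>F v in nhds c. He q v > b / 2 \<and> He (p - 1) v > 0 \<and> He (p - 1) v < 2 * a"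
    using pos order_tendstoD(1)[of "He q" b "nhds c" "b / 2"]
      order_tendstoD(1)[of "He (p - 1)" a "nhds c" 0]
      order_tendstoD(2)[of "He (p - 1)" a "nhds c" "2 * a"]
    by (intro eventually_conj) (auto simp: a_def b_def)
  then obtain d where d: "d > 0" "\<And>v. dist v c < d \<Longrightarrow>
      He q v > b / 2 \<and> He (p - 1) v > 0 \<and> He (p - 1) v < 2 * a"
    unfolding eventually_nhds_metric by blast
  define \<epsilon> where "\<epsilon> = min (d / 2) 1"
  show ?thesis
  proof (rule that[of \<epsilon> "b / 2" "p * (2 * a)"])
    show "0 < \<epsilon>" "\<epsilon> \<le> 1" "0 < b / 2" "0 < p * (2 * a)" using d(1) p pos by (auto simp: \<epsilon>_def a_def b_def)
    fix v assume v: "c - \<epsilon> \<le> v" "v \<le> c"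
    have near: "dist w c < d" if "v \<le> w" "w \<le> c" for w
      using that v d(1) by (auto simp: dist_real_def \<epsilon>_def min_def split: if_splits)
    show "b / 2 \<le> He q v \<and> He p v \<le> 0 \<and> - (p * (2 * a) * (c - v)) \<le> He p v"
    proof (cases "v = c")
      case True
      then show ?thesis using root pos by (simp add: b_def)
    next
      case False
      then have "v < c" using v by simp
      then obtain z where z: "v < z" "z < c" "He p c - He p v = (c - v) * (p * He (p - 1) z)"
        using MVT2[of v c "He p" "\<lambda>z. p * He (p - 1) z"] He_has_derivative by blast
      have a': "0 < He (p - 1) z" "He (p - 1) z < 2 * a" using d(2)[OF near[of z]] z by auto
      have "0 \<le> (c - v) * (p * He (p - 1) z)" using a' p v by simp
      moreover have "(c - v) * (p * He (p - 1) z) \<le> (c - v) * (p * (2 * a))"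
        using a' p v by (intro mult_left_mono) auto
      ultimately show ?thesis using z(3) root d(2)[OF near[of v]] v by (auto simp: algebra_simps)
    qed
  qed
qed

text \<open>
  For \<open>\<sigma> = 1\<close> and \<open>\<sigma> = - 1\<close> this is the function \<open>V p + h\<close> respectively \<open>V p - h\<close>, after killing.
\<close>

definition killed_sum :: "real \<Rightarrow> real \<Rightarrow> real \<Rightarrow> real \<Rightarrow> real \<Rightarrow> real \<Rightarrow> real \<Rightarrow> real" where
  "killed_sum \<sigma> \<gamma> c p q x s = (if x > c * sqrt s
     then heat_hermite p x s + \<sigma> * (s powr - \<gamma> * heat_hermite q x s) else 0)"

context centred_step
begin

text \<open>
  With \<open>s = t + 1\<close> and \<open>u = x / sqrt s\<close>, everything is compared in units of
  \<open>G = s powr (p / 2 - 1 - 2 * \<gamma>) * (1 + \<bar>u\<bar>) powr q\<close>. The decay of \<open>t powr - \<gamma>\<close> gains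
  \<open>\<gamma> * c1\<close> units; the errors of truncation and Taylor expansion cost \<open>C * m * s powr \<beta>\<close> units with
  \<open>\<beta> = 3 * \<gamma> * (p + 3) + 2 * \<gamma> - \<delta> / 2\<close>, and those of the time step \<open>(Cp + Cq) * s powr (2 * \<gamma> - 1)\<close>. By
  the hypotheses on \<open>\<gamma>\<close> both exponents are negative, so the gain wins for late times.
\<close>

theorem almost_harmonic:
  fixes p q c \<gamma> \<delta> :: real
  assumes \<delta>: "0 < \<delta>" "\<delta> \<le> 1" and p: "p > 0" and \<gamma>: "0 < \<gamma>" "q = p - 2 * \<gamma>" "q > 0" "2 * \<gamma> < 1"
    "3 * \<gamma> * (p + 3) + 2 * \<gamma> < \<delta> / 2"
    and root: "He p c = 0" and pos: "\<And>r v. r < p \<Longrightarrow> v \<ge> c \<Longrightarrow> He r v > 0"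
    and nonneg: "\<And>v. v \<ge> c \<Longrightarrow> 0 \<le> He p v"
    and moment: "integrable \<mu> (moment_fn \<delta> p)"
  obtains t\<^sub>0 where "t\<^sub>0 \<ge> 1"
    "\<And>t x. t \<ge> t\<^sub>0 \<Longrightarrow> x > c * sqrt t \<Longrightarrow> integrable \<mu> (\<lambda>\<xi>. killed_sum 1 \<gamma> c p q (x + \<xi>) (t + 1)) \<and>
       integrable \<mu> (\<lambda>\<xi>. killed_sum (-1) \<gamma> c p q (x + \<xi>) (t + 1)) \<and>
       (LINT \<xi>|\<mu>. killed_sum 1 \<gamma> c p q (x + \<xi>) (t + 1)) \<le> killed_sum 1 \<gamma> c p q x t \<and>
       killed_sum (-1) \<gamma> c p q x t \<le> (LINT \<xi>|\<mu>. killed_sum (-1) \<gamma> c p q (x + \<xi>) (t + 1))"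
proof -
  define A where "A = - \<bar>c\<bar> - 1"
  define m where "m = (LINT \<xi>|\<mu>. moment_fn \<delta> p \<xi>)"
  have qp: "q < p" "q \<le> p" "p - 2 \<le> q" "0 \<le> q" "A \<le> c" using \<gamma> by (auto simp: A_def)
  have posq: "\<And>v. v \<ge> c \<Longrightarrow> 0 < He q v" using pos qp by blast
  obtain C where C: "C > 0"
    and Cup: "\<And>u y \<tau> \<theta>. A \<le> u \<Longrightarrow> 0 < \<tau> \<Longrightarrow> \<tau> \<le> 1 \<Longrightarrow> 0 \<le> \<theta> \<Longrightarrow> \<theta> \<le> 1 \<Longrightarrow>
       window_ok p q c A \<theta> \<tau> u \<Longrightarrow>
       (if u + y > c then He p (u + y) + \<theta> * He q (u + y) else 0)
         \<le> taylor2 p u y + \<theta> * taylor2 q u y + C * step_error \<delta> p q \<tau> u y"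
    and Clow: "\<And>u y \<tau> \<theta>. A \<le> u \<Longrightarrow> 0 < \<tau> \<Longrightarrow> \<tau> \<le> 1 \<Longrightarrow> 0 \<le> \<theta> \<Longrightarrow> \<theta> \<le> 1 \<Longrightarrow>
       window_ok p q c A \<theta> \<tau> u \<Longrightarrow>
       taylor2 p u y - \<theta> * taylor2 q u y - C * step_error \<delta> p q \<tau> u y
         \<le> (if u + y > c then He p (u + y) - \<theta> * He q (u + y) else 0)"
    using killed_taylor2[OF \<delta> p qp(4,2,3,5) nonneg less_imp_le[OF posq]] by blast
  obtain \<epsilon> L B where near: "0 < \<epsilon>" "\<epsilon> \<le> 1" "0 < L" "0 < B"
    "\<And>v. c - \<epsilon> \<le> v \<Longrightarrow> v \<le> c \<Longrightarrow>
       L \<le> He q v \<and> He p v \<le> 0 \<and> - (B * (c - v)) \<le> He p v"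
    using He_near_root[OF p root posq[OF order_refl] pos[of "p - 1" c]] by auto
  obtain Cp where Cp: "Cp > 0" "\<And>x t. t \<ge> 1 \<Longrightarrow> x \<ge> c * sqrt t \<Longrightarrow>
     \<bar>heat_hermite p x t - (t + 1) powr (p / 2) * step_mean p (x / sqrt (t + 1)) (t + 1)\<bar>
       \<le> Cp * (t + 1) powr (p / 2 - 2) * (1 + \<bar>x / sqrt (t + 1)\<bar>) powr (p - 4)"
    using heat_hermite_time_step by blast
  obtain Cq where Cq: "Cq > 0" "\<And>x t. t \<ge> 1 \<Longrightarrow> x \<ge> c * sqrt t \<Longrightarrow>
     \<bar>heat_hermite q x t - (t + 1) powr (q / 2) * step_mean q (x / sqrt (t + 1)) (t + 1)\<bar>
       \<le> Cq * (t + 1) powr (q / 2 - 2) * (1 + \<bar>x / sqrt (t + 1)\<bar>) powr (q - 4)"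
    using heat_hermite_time_step by blast
  obtain L' where L': "L' > 0" "\<And>v. v \<ge> c \<Longrightarrow> He q v \<ge> L' * (1 + \<bar>v\<bar>) powr q"
    using He_lower_bound[OF posq] by blast
  define c1 where "c1 = L' * 2 powr - (q / 2)"
  have c1: "c1 > 0" using L' by (simp add: c1_def)
  define K where "K = 1 + 2 * \<bar>c\<bar>"
  have K: "K > 0" by (simp add: K_def add_pos_nonneg)
  define \<beta> where "\<beta> = 3 * \<gamma> * (p + 3) + 2 * \<gamma> - \<delta> / 2"
  have neg: "- (3 * \<gamma>) < 0" "- \<gamma> < 0" "\<beta> < 0" "2 * \<gamma> - 1 < 0" using \<gamma> by (auto simp: \<beta>_def)
  have lim: "((\<lambda>s::real. k * s powr e) \<longlongrightarrow> 0) at_top" if "e < 0" for k e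
    by (rule tendsto_mult_right_zero[OF tendsto_neg_powr[OF that filterlim_ident]])
  have "\<forall>\<^sub>F s::real in at_top. s \<ge> 2 \<and> K * s powr (- (3 * \<gamma>)) < \<epsilon> \<and> B * K * s powr (- \<gamma>) < L \<and>
      C * m * s powr \<beta> < \<gamma> * c1 / 2 \<and> (Cp + Cq) * s powr (2 * \<gamma> - 1) < \<gamma> * c1 / 2"
    using near c1 \<gamma> by (intro eventually_conj eventually_ge_at_top order_tendstoD(2)[OF lim] neg) auto
  then obtain s\<^sub>0 where s0: "\<And>s. s \<ge> s\<^sub>0 \<Longrightarrow> s \<ge> 2 \<and> K * s powr (- (3 * \<gamma>)) < \<epsilon> \<and> B * K * s powr (- \<gamma>) < L \<and>
      C * m * s powr \<beta> < \<gamma> * c1 / 2 \<and> (Cp + Cq) * s powr (2 * \<gamma> - 1) < \<gamma> * c1 / 2"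
    unfolding eventually_at_top_linorder by blast
  show ?thesis
  proof (rule that[of "max 1 s\<^sub>0"])
    fix t x assume t: "t \<ge> max 1 s\<^sub>0" and x: "x > c * sqrt t"
    define s where "s = t + 1"
    \<comment> \<open>The layer below the boundary reached by small jumps has width of order \<open>\<tau>\<close>; there \<open>He p\<close> is of
      order \<open>\<tau>\<close> and loses against \<open>\<theta> * He q\<close>, since \<open>\<tau> = \<theta> * s powr - \<gamma>\<close>.\<close>
    define \<tau> where "\<tau> = s powr (- (3 * \<gamma>))"
    define \<theta> where "\<theta> = s powr (- (2 * \<gamma>))"
    define u where "u = x / sqrt s"
    define a where "a = (1 + \<bar>u\<bar>) powr q"
    define S where "S = s powr (p / 2)"
    define G where "G = S * s powr (- 1 - 2 * \<gamma>) * a"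
    note conds = s0[of s]
    have s: "s \<ge> 2" "t = s - 1" "t \<ge> 1" "s > 0" "s \<ge> 1" using t by (auto simp: s_def)
    have cs: "K * \<tau> < \<epsilon>" "B * K * s powr (- \<gamma>) < L" "C * m * s powr \<beta> < \<gamma> * c1 / 2"
      "(Cp + Cq) * s powr (2 * \<gamma> - 1) < \<gamma> * c1 / 2"
      using conds t by (auto simp: s_def \<tau>_def)
    have \<tau>: "0 < \<tau>" "\<tau> \<le> 1" using s \<gamma> by (auto simp: \<tau>_def powr_minus one_le_inverse_iff
          intro!: inverse_le_1_iff[THEN iffD2] ge_one_powr_ge_zero)
    have \<theta>: "0 \<le> \<theta>" "\<theta> \<le> 1" using s \<gamma> by (auto simp: \<theta>_def powr_minus
          intro!: inverse_le_1_iff[THEN iffD2] ge_one_powr_ge_zero)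
    have s\<tau>: "1 \<le> s * \<tau>"
    proof -
      have "\<gamma> * 9 \<le> \<gamma> * (3 * (p + 3))" using \<gamma>(1) p by (intro mult_left_mono) auto
      then have "9 * \<gamma> \<le> 3 * \<gamma> * (p + 3)" by (simp add: algebra_simps)
      then have "3 * \<gamma> \<le> 1" using \<gamma>(1,5) \<delta> by linarith
      moreover have "s * \<tau> = s powr (1 - 3 * \<gamma>)"
        using s powr_add[of s 1 "- (3 * \<gamma>)"] by (simp add: \<tau>_def)
      ultimately show ?thesis using s by (simp add: ge_one_powr_ge_zero)
    qed
    have x': "x \<ge> c * sqrt (s - 1)" using x s(2) by simp
    note win = window_above_boundary[OF s(1) x' \<tau> s\<tau>, folded u_def]
    have uA: "A \<le> u" using win(1) by (simp add: A_def)
    have sg: "s powr (- \<gamma>) * \<theta> = \<tau>" by (simp add: \<theta>_def \<tau>_def flip: powr_add)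
    have window: "window_ok p q c A \<theta> \<tau> u"
      unfolding window_ok_def
    proof (intro allI impI)
      fix v assume "\<bar>v - u\<bar> \<le> \<tau> * (1 + \<bar>u\<bar>) / 2"
      then have v: "v \<ge> c - K * \<tau>" using win(2) by (simp add: K_def)
      then have v\<epsilon>: "v \<ge> c - \<epsilon>" using cs(1) by linarith
      have "He p v \<le> \<theta> * He q v \<and> 0 \<le> He p v + \<theta> * He q v" if "v \<le> c"
      proof -
        note n = near(5)[OF v\<epsilon> that]
        have tL: "\<theta> * L \<le> \<theta> * He q v" using n \<theta> by (intro mult_left_mono) auto
        moreover have "0 \<le> \<theta> * L" using \<theta> near by simp
        moreover have "B * (c - v) \<le> \<theta> * L"
        proof -
          have "B * (c - v) \<le> B * (K * \<tau>)" using v near by (intro mult_left_mono) auto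
          also have "\<dots> = B * K * s powr (- \<gamma>) * \<theta>" by (simp flip: sg)
          also have "\<dots> \<le> L * \<theta>" using cs(2) \<theta> by (intro mult_right_mono) auto
          finally show ?thesis by (simp add: mult.commute)
        qed
        ultimately show ?thesis using n by linarith
      qed
      then show "A \<le> v \<and> (v \<le> c \<longrightarrow> He p v \<le> \<theta> * He q v \<and> 0 \<le> He p v + \<theta> * He q v)"
        using v\<epsilon> near(2) by (auto simp: A_def)
    qed
    have scaled: "killed_sum \<sigma> \<gamma> c p q (x + \<xi>) s = S * (if u + \<xi> / sqrt s > c
        then He p (u + \<xi> / sqrt s) + \<sigma> * \<theta> * He q (u + \<xi> / sqrt s) else 0)" for \<sigma> \<xi>
    proof -
      have "(x + \<xi>) / sqrt s = u + \<xi> / sqrt s" by (simp add: u_def add_divide_distrib)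
      moreover have "x + \<xi> > c * sqrt s \<longleftrightarrow> (x + \<xi>) / sqrt s > c" using s by (simp add: less_divide_eq)
      moreover have "s powr - \<gamma> * s powr (q / 2) = S * \<theta>"
        unfolding S_def \<theta>_def powr_add[symmetric] \<gamma>(2) by (simp add: field_simps)
      then have "s powr - \<gamma> * (s powr (q / 2) * h) = S * (\<theta> * h)" for h by (simp flip: mult.assoc)
      ultimately show ?thesis by (simp add: killed_sum_def heat_hermite_def S_def[symmetric] algebra_simps)
    qed
    have S: "S > 0" using s by (simp add: S_def)
    have a: "a > 0" by (simp add: a_def)
    have G0: "G > 0" using S a s by (simp add: G_def)
    have err_int: "integrable \<mu> (\<lambda>\<xi>. step_error \<delta> p q \<tau> u (\<xi> / sqrt s))"
    proof -
      have "integrable \<mu> (\<lambda>\<xi>. moment_fn \<delta> p (\<xi> / sqrt s))"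
      proof (rule Bochner_Integration.integrable_bound)
        show "integrable \<mu> (\<lambda>\<xi>. s powr (- 1 - \<delta> / 2) * moment_fn \<delta> p \<xi>)" using moment by simp
        show "(\<lambda>\<xi>. moment_fn \<delta> p (\<xi> / sqrt s)) \<in> borel_measurable \<mu>" unfolding moment_fn_def by measurable
        show "AE \<xi> in \<mu>. norm (moment_fn \<delta> p (\<xi> / sqrt s)) \<le> norm (s powr (- 1 - \<delta> / 2) * moment_fn \<delta> p \<xi>)"
          using moment_fn_scale[OF s(5) \<delta>(1), of p]
          by (intro AE_I2) (auto simp: moment_fn_def intro: order_trans[OF _ abs_ge_self])
      qed
      then show ?thesis unfolding step_error_def by simp
    qed
    have err: "S * (C * (LINT \<xi>|\<mu>. step_error \<delta> p q \<tau> u (\<xi> / sqrt s))) \<le> G * (C * m * s powr \<beta>)"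
    proof -
      have "(LINT \<xi>|\<mu>. step_error \<delta> p q \<tau> u (\<xi> / sqrt s))
          \<le> (LINT \<xi>|\<mu>. \<tau> powr (- (p + 3)) * a * (s powr (- 1 - \<delta> / 2) * moment_fn \<delta> p \<xi>))"
        unfolding step_error_def a_def
        by (intro integral_mono mult_left_mono moment_fn_scale s \<delta> integrable_mult_right moment
              err_int[unfolded step_error_def]) auto
      also have "\<dots> = \<tau> powr (- (p + 3)) * a * s powr (- 1 - \<delta> / 2) * m"
        unfolding m_def by simp
      also have "\<dots> = s powr (- 1 - 2 * \<gamma>) * a * m * s powr \<beta>"
      proof -
        have "\<tau> powr (- (p + 3)) * s powr (- 1 - \<delta> / 2) = s powr (- 1 - 2 * \<gamma>) * s powr \<beta>"
          unfolding \<tau>_def powr_powr powr_add[symmetric] \<beta>_def by (simp add: algebra_simps)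
        from arg_cong[OF this, of "\<lambda>z. z * (a * m)"] show ?thesis by (simp only: ac_simps)
      qed
      finally have "S * (C * (LINT \<xi>|\<mu>. step_error \<delta> p q \<tau> u (\<xi> / sqrt s)))
          \<le> S * (C * (s powr (- 1 - 2 * \<gamma>) * a * m * s powr \<beta>))"
        using S C by (intro mult_left_mono) auto
      then show ?thesis by (simp add: G_def ac_simps)
    qed
    have meas: "(\<lambda>\<xi>. killed_sum \<sigma> \<gamma> c p q (x + \<xi>) s) \<in> borel_measurable \<mu>" for \<sigma>
      unfolding killed_sum_def by measurable
    let ?T = "\<lambda>\<sigma> \<xi>. S * (taylor2 p u (\<xi> / sqrt s) + \<sigma> * \<theta> * taylor2 q u (\<xi> / sqrt s)
        + \<sigma> * C * step_error \<delta> p q \<tau> u (\<xi> / sqrt s))"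
    have Tint: "integrable \<mu> (?T \<sigma>)" for \<sigma>
      using taylor2_integral[OF s(4)] err_int by simp
    have Teq: "(LINT \<xi>|\<mu>. ?T \<sigma> \<xi>) = S * (step_mean p u s + \<sigma> * \<theta> * step_mean q u s)
        + \<sigma> * (S * (C * (LINT \<xi>|\<mu>. step_error \<delta> p q \<tau> u (\<xi> / sqrt s))))" for \<sigma>
      using taylor2_integral[OF s(4)] err_int by (simp add: algebra_simps)
    have up: "killed_sum 1 \<gamma> c p q (x + \<xi>) s \<le> ?T 1 \<xi>" for \<xi>
      unfolding scaled using Cup[OF uA \<tau> \<theta> window, of "\<xi> / sqrt s"] S by (intro mult_left_mono) auto
    have low: "?T (-1) \<xi> \<le> killed_sum (-1) \<gamma> c p q (x + \<xi>) s" for \<xi>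
      unfolding scaled using Clow[OF uA \<tau> \<theta> window, of "\<xi> / sqrt s"] S by (intro mult_left_mono) auto
    have upper_nonneg: "0 \<le> killed_sum 1 \<gamma> c p q (x + \<xi>) s" for \<xi>
      unfolding scaled using S \<theta> nonneg posq by (auto intro!: mult_nonneg_nonneg add_nonneg_nonneg less_imp_le[OF posq])
    have abs_le: "\<bar>killed_sum (-1) \<gamma> c p q (x + \<xi>) s\<bar> \<le> killed_sum 1 \<gamma> c p q (x + \<xi>) s" for \<xi>
    proof -
      have "0 \<le> He p v" "0 \<le> \<theta> * He q v" if "v > c" for v
        using \<theta> nonneg[of v] posq[of v] that by auto
      then have "\<bar>He p v - \<theta> * He q v\<bar> \<le> He p v + \<theta> * He q v" if "v > c" for v
        using that by (simp add: abs_le_iff)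
      then show ?thesis unfolding scaled using S by (auto simp: abs_mult)
    qed
    have int1: "integrable \<mu> (\<lambda>\<xi>. killed_sum 1 \<gamma> c p q (x + \<xi>) s)"
    proof (rule Bochner_Integration.integrable_bound[OF Tint[of 1] meas])
      have "norm (killed_sum 1 \<gamma> c p q (x + \<xi>) s) \<le> norm (?T 1 \<xi>)" for \<xi>
        using up[of \<xi>] upper_nonneg[of \<xi>] by (auto intro: order_trans[OF _ abs_ge_self])
      then show "AE \<xi> in \<mu>. norm (killed_sum 1 \<gamma> c p q (x + \<xi>) s) \<le> norm (?T 1 \<xi>)" by (rule AE_I2)
    qed
    have int2: "integrable \<mu> (\<lambda>\<xi>. killed_sum (-1) \<gamma> c p q (x + \<xi>) s)"
    proof (rule Bochner_Integration.integrable_bound[OF int1 meas])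
      have "norm (killed_sum (-1) \<gamma> c p q (x + \<xi>) s) \<le> norm (killed_sum 1 \<gamma> c p q (x + \<xi>) s)" for \<xi>
        using abs_le[of \<xi>] upper_nonneg[of \<xi>] by simp
      then show "AE \<xi> in \<mu>. norm (killed_sum (-1) \<gamma> c p q (x + \<xi>) s)
          \<le> norm (killed_sum 1 \<gamma> c p q (x + \<xi>) s)" by (rule AE_I2)
    qed
    have "(LINT \<xi>|\<mu>. killed_sum 1 \<gamma> c p q (x + \<xi>) s) \<le> (LINT \<xi>|\<mu>. ?T 1 \<xi>)"
      by (intro integral_mono int1 Tint up)
    then have F1: "(LINT \<xi>|\<mu>. killed_sum 1 \<gamma> c p q (x + \<xi>) s)
        \<le> S * step_mean p u s + S * \<theta> * step_mean q u s + G * (C * m * s powr \<beta>)"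
      unfolding Teq using err by (simp add: algebra_simps)
    have "(LINT \<xi>|\<mu>. ?T (-1) \<xi>) \<le> (LINT \<xi>|\<mu>. killed_sum (-1) \<gamma> c p q (x + \<xi>) s)"
      by (intro integral_mono int2 Tint low)
    then have F1': "S * step_mean p u s - S * \<theta> * step_mean q u s - G * (C * m * s powr \<beta>)
        \<le> (LINT \<xi>|\<mu>. killed_sum (-1) \<gamma> c p q (x + \<xi>) s)"
      unfolding Teq using err by (simp add: algebra_simps)
    have time: "k * s powr (r / 2 - 2) * (1 + \<bar>u\<bar>) powr (r - 4) \<le> k * (s powr (r / 2) * s powr - 2 * a)"
      if "k \<ge> 0" "r \<le> p" for k r
    proof -
      have "s powr (r / 2 - 2) = s powr (r / 2) * s powr - 2" by (simp flip: powr_add)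
      moreover have "(1 + \<bar>u\<bar>) powr (r - 4) \<le> a" unfolding a_def using that qp by (intro powr_mono) auto
      ultimately show ?thesis using that by (auto simp: mult.assoc intro!: mult_left_mono)
    qed
    have s2: "s powr - 2 = s powr (- 1 - 2 * \<gamma>) * s powr (2 * \<gamma> - 1)" by (simp flip: powr_add)
    have xt: "x \<ge> c * sqrt t" using x by simp
    have F2: "\<bar>heat_hermite p x t - S * step_mean p u s\<bar> \<le> G * (Cp * s powr (2 * \<gamma> - 1))"
    proof -
      have "\<bar>heat_hermite p x t - S * step_mean p u s\<bar> \<le> Cp * (S * s powr - 2 * a)"
        using order_trans[OF Cp(2)[OF s(3) xt] time[of Cp p, unfolded u_def s_def]] Cp(1)
        by (simp add: S_def u_def s_def)
      then show ?thesis unfolding s2 by (simp add: G_def ac_simps)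
    qed
    have F3: "S * \<theta> * step_mean q u s + G * (\<gamma> * c1) - G * (Cq * s powr (2 * \<gamma> - 1))
        \<le> t powr - \<gamma> * heat_hermite q x t"
    proof -
      have sq: "s powr - \<gamma> * s powr (q / 2) = S * \<theta>"
        unfolding S_def \<theta>_def powr_add[symmetric] \<gamma>(2) by (simp add: field_simps)
      have "\<bar>heat_hermite q x t - s powr (q / 2) * step_mean q u s\<bar> \<le> Cq * (s powr (q / 2) * s powr - 2 * a)"
        using order_trans[OF Cq(2)[OF s(3) xt] time[of Cq q, unfolded u_def s_def]] Cq(1) qp
        by (simp add: u_def s_def)
      then have "s powr (q / 2) * step_mean q u s - Cq * (s powr (q / 2) * s powr - 2 * a) \<le> heat_hermite q x t"
        by linarith
      then have "s powr - \<gamma> * (s powr (q / 2) * step_mean q u s - Cq * (s powr (q / 2) * s powr - 2 * a))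
          \<le> s powr - \<gamma> * heat_hermite q x t" by (intro mult_left_mono) auto
      then have h1: "S * \<theta> * step_mean q u s - S * \<theta> * (Cq * (s powr - 2 * a)) \<le> s powr - \<gamma> * heat_hermite q x t"
        by (simp add: right_diff_distrib sq[symmetric] ac_simps)
      have h2: "S * \<theta> * (Cq * (s powr - 2 * a)) \<le> G * (Cq * s powr (2 * \<gamma> - 1))"
      proof -
        have "\<theta> * (S * (Cq * (s powr - 2 * a))) \<le> 1 * (S * (Cq * (s powr - 2 * a)))"
          using \<theta> S Cq a by (intro mult_right_mono) auto
        then show ?thesis unfolding s2 by (simp add: G_def ac_simps)
      qed
      have hq: "c1 * (s powr (q / 2) * a) \<le> heat_hermite q x t"
      proof -
        have xc: "x / sqrt t \<ge> c" using xt s by (simp add: le_divide_eq)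
        have "s powr (q / 2) \<le> (2 * t) powr (q / 2)" using s qp by (intro powr_mono2) auto
        also have "\<dots> = 2 powr (q / 2) * t powr (q / 2)" using s(3) by (simp add: powr_mult)
        finally have 1: "2 powr - (q / 2) * s powr (q / 2) \<le> t powr (q / 2)"
          by (simp add: powr_minus field_simps)
        have "\<bar>u\<bar> \<le> \<bar>x / sqrt t\<bar>" unfolding u_def using s by (simp add: abs_divide divide_left_mono)
        then have 2: "a \<le> (1 + \<bar>x / sqrt t\<bar>) powr q" unfolding a_def using qp by (intro powr_mono2) auto
        have "c1 * (s powr (q / 2) * a) = (2 powr - (q / 2) * s powr (q / 2)) * (L' * a)"
          by (simp add: c1_def)
        also have "\<dots> \<le> t powr (q / 2) * (L' * (1 + \<bar>x / sqrt t\<bar>) powr q)"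
          using 1 2 L'(1) a by (intro mult_mono) auto
        also have "\<dots> \<le> heat_hermite q x t"
          unfolding heat_hermite_def by (intro mult_left_mono L'(2)[OF xc]) auto
        finally show ?thesis .
      qed
      have dt: "\<gamma> * s powr (- \<gamma> - 1) \<le> t powr - \<gamma> - s powr - \<gamma>"
      proof -
        have "((\<lambda>z. z powr - \<gamma>) has_real_derivative - \<gamma> * z powr (- \<gamma> - 1)) (at z)" if "t \<le> z" for z
          using that s by (auto intro!: derivative_eq_intros)
        then obtain z where z: "t < z" "z < s"
            "s powr - \<gamma> - t powr - \<gamma> = (s - t) * (- \<gamma> * z powr (- \<gamma> - 1))"
          using MVT2[of t s "\<lambda>z. z powr - \<gamma>" "\<lambda>z. - \<gamma> * z powr (- \<gamma> - 1)"] s by auto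
        have "s powr (- \<gamma> - 1) \<le> z powr (- \<gamma> - 1)" using z s \<gamma> by (intro powr_mono2') auto
        then have "\<gamma> * s powr (- \<gamma> - 1) \<le> \<gamma> * z powr (- \<gamma> - 1)" using \<gamma> by (intro mult_left_mono) auto
        then show ?thesis using z(3) s(2) by simp
      qed
      have "G * (\<gamma> * c1) = \<gamma> * s powr (- \<gamma> - 1) * (c1 * (s powr (q / 2) * a))"
      proof -
        have "S * s powr (- 1 - 2 * \<gamma>) = s powr (- \<gamma> - 1) * s powr (q / 2)"
          unfolding S_def powr_add[symmetric] \<gamma>(2) by (simp add: field_simps)
        then show ?thesis unfolding G_def by (simp only: ac_simps)
      qed
      also have "\<dots> \<le> (t powr - \<gamma> - s powr - \<gamma>) * heat_hermite q x t"
      proof (intro mult_mono dt hq)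
        show "0 \<le> t powr - \<gamma> - s powr - \<gamma>" using order_trans[OF _ dt, of 0] \<gamma>(1) by simp
        show "0 \<le> c1 * (s powr (q / 2) * a)" using c1 a by simp
      qed
      finally show ?thesis using h1 h2 by (simp add: left_diff_distrib)
    qed
    have "G * (C * m * s powr \<beta>) + G * ((Cp + Cq) * s powr (2 * \<gamma> - 1)) \<le> G * (\<gamma> * c1 / 2) + G * (\<gamma> * c1 / 2)"
      using cs(3,4) G0 by (intro add_mono mult_left_mono) auto
    then have F4: "G * (C * m * s powr \<beta>) + G * (Cp * s powr (2 * \<gamma> - 1)) + G * (Cq * s powr (2 * \<gamma> - 1))
        \<le> G * (\<gamma> * c1)"
      by (simp add: algebra_simps)
    have at_x: "killed_sum \<sigma> \<gamma> c p q x t = heat_hermite p x t + \<sigma> * (t powr - \<gamma> * heat_hermite q x t)" for \<sigma>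
      using x by (simp add: killed_sum_def)
    have "(LINT \<xi>|\<mu>. killed_sum 1 \<gamma> c p q (x + \<xi>) s) \<le> killed_sum 1 \<gamma> c p q x t"
      unfolding at_x using F1 F2 F3 F4 by (simp add: abs_le_iff)
    moreover have "killed_sum (-1) \<gamma> c p q x t \<le> (LINT \<xi>|\<mu>. killed_sum (-1) \<gamma> c p q (x + \<xi>) s)"
      unfolding at_x using F1' F2 F3 F4 by (simp add: abs_le_iff)
    ultimately show "integrable \<mu> (\<lambda>\<xi>. killed_sum 1 \<gamma> c p q (x + \<xi>) (t + 1)) \<and>
       integrable \<mu> (\<lambda>\<xi>. killed_sum (-1) \<gamma> c p q (x + \<xi>) (t + 1)) \<and>
       (LINT \<xi>|\<mu>. killed_sum 1 \<gamma> c p q (x + \<xi>) (t + 1)) \<le> killed_sum 1 \<gamma> c p q x t \<and>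
       killed_sum (-1) \<gamma> c p q x t \<le> (LINT \<xi>|\<mu>. killed_sum (-1) \<gamma> c p q (x + \<xi>) (t + 1))"
      using int1 int2 by (simp add: s_def)
  qed simp
qed

end

section \<open>Iterating the killed transition operator\<close>

text \<open>
  Values in \<open>ennreal\<close> make additivity, monotonicity and the passage from the walk to the iterates free of integrability
  conditions.
\<close>

definition killed_step :: "real measure \<Rightarrow> real \<Rightarrow> (real \<Rightarrow> real \<Rightarrow> ennreal) \<Rightarrow> real \<Rightarrow> real \<Rightarrow> ennreal" where
  "killed_step \<mu> c F x t = (\<integral>\<^sup>+\<xi>. F (x + \<xi>) (t + 1) * indicator {c * sqrt (t + 1)<..} (x + \<xi>) \<partial>\<mu>)"

abbreviation (input) in_domain :: "real \<Rightarrow> real \<Rightarrow> real \<Rightarrow> bool" where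
  "in_domain c x t \<equiv> c * sqrt t < x"

lemma killed_step_mono:
  assumes "\<And>y. in_domain c y (t + 1) \<Longrightarrow> F y (t + 1) \<le> G y (t + 1)"
  shows "killed_step \<mu> c F x t \<le> killed_step \<mu> c G x t"
  unfolding killed_step_def using assms
  by (intro nn_integral_mono) (auto simp: indicator_def)

lemma killed_step_cong:
  assumes "\<And>y. in_domain c y (t + 1) \<Longrightarrow> F y (t + 1) = G y (t + 1)"
  shows "killed_step \<mu> c F x t = killed_step \<mu> c G x t"
  using assms by (intro antisym killed_step_mono) auto

lemma funpow_killed_step_mono:
  assumes FG: "\<And>y s. s \<ge> t\<^sub>0 \<Longrightarrow> in_domain c y s \<Longrightarrow> F y s \<le> G y s"
    and "t + real n \<ge> t\<^sub>0" "in_domain c x t"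
  shows "(killed_step \<mu> c ^^ n) F x t \<le> (killed_step \<mu> c ^^ n) G x t"
  using assms(2,3)
proof (induction n arbitrary: x t)
  case (Suc n)
  show ?case unfolding funpow.simps o_def
    by (rule killed_step_mono) (use Suc in auto)
qed (use FG in auto)

lemma funpow_killed_step_increasing:
  assumes F: "\<And>t x y. t \<ge> 0 \<Longrightarrow> in_domain c x t \<Longrightarrow> x \<le> y \<Longrightarrow> F x t \<le> F y t"
    and "t \<ge> 0" "in_domain c x t" "x \<le> y"
  shows "(killed_step \<mu> c ^^ n) F x t \<le> (killed_step \<mu> c ^^ n) F y t"
  using assms(2-4)
proof (induction n arbitrary: x y t)
  case (Suc n)
  have "(killed_step \<mu> c ^^ n) F (x + \<xi>) (t + 1) * indicator {c * sqrt (t + 1)<..} (x + \<xi>)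
      \<le> (killed_step \<mu> c ^^ n) F (y + \<xi>) (t + 1) * indicator {c * sqrt (t + 1)<..} (y + \<xi>)" for \<xi>
    using Suc.IH[of "t + 1" "x + \<xi>" "y + \<xi>"] Suc.prems by (auto simp: indicator_def)
  then show ?case
    by (simp add: killed_step_def[of \<mu> c "(killed_step \<mu> c ^^ n) F"] nn_integral_mono)
qed (use F in auto)

context centred_step
begin

lemma killed_step_measurable:
  assumes "\<And>t. (\<lambda>x. F x t) \<in> borel_measurable borel"
  shows "(\<lambda>x. killed_step \<mu> c F x t) \<in> borel_measurable borel"
proof -
  have [measurable]: "(\<lambda>x. F x (t + 1)) \<in> borel_measurable borel" by (rule assms)
  show ?thesis unfolding killed_step_def by measurable
qed

lemma funpow_killed_step_measurable:
  assumes "\<And>t. (\<lambda>x. F x t) \<in> borel_measurable borel"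
  shows "(\<lambda>x. (killed_step \<mu> c ^^ n) F x t) \<in> borel_measurable borel"
proof (induction n arbitrary: t)
  case (Suc n)
  show ?case unfolding funpow.simps o_def by (rule killed_step_measurable[OF Suc])
qed (use assms in simp)

lemma killed_step_add:
  assumes "\<And>t. (\<lambda>x. F x t) \<in> borel_measurable borel" "\<And>t. (\<lambda>x. G x t) \<in> borel_measurable borel"
  shows "killed_step \<mu> c (\<lambda>x t. F x t + G x t) = (\<lambda>x t. killed_step \<mu> c F x t + killed_step \<mu> c G x t)"
proof (intro ext)
  fix x t
  have [measurable]: "(\<lambda>x. F x (t + 1)) \<in> borel_measurable borel" "(\<lambda>x. G x (t + 1)) \<in> borel_measurable borel"
    by (rule assms)+
  show "killed_step \<mu> c (\<lambda>x t. F x t + G x t) x t = killed_step \<mu> c F x t + killed_step \<mu> c G x t"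
    unfolding killed_step_def distrib_right by (rule nn_integral_add) measurable
qed

lemma funpow_killed_step_add:
  assumes "\<And>t. (\<lambda>x. F x t) \<in> borel_measurable borel" "\<And>t. (\<lambda>x. G x t) \<in> borel_measurable borel"
  shows "(killed_step \<mu> c ^^ n) (\<lambda>x t. F x t + G x t)
       = (\<lambda>x t. (killed_step \<mu> c ^^ n) F x t + (killed_step \<mu> c ^^ n) G x t)"
proof (induction n)
  case (Suc n)
  show ?case unfolding funpow.simps o_def Suc
    by (rule killed_step_add) (rule funpow_killed_step_measurable[OF assms(1)] funpow_killed_step_measurable[OF assms(2)])+
qed simp

text \<open>
  This class is invariant under the transition operator, and its members are finite above the boundary. It provides the
  integrable majorants for early times.
\<close>

definition power_bounded :: "real \<Rightarrow> real \<Rightarrow> (real \<Rightarrow> real \<Rightarrow> ennreal) \<Rightarrow> bool" where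
  "power_bounded c p F \<longleftrightarrow> (\<forall>t\<ge>0. \<exists>K\<ge>0. \<forall>x. in_domain c x t \<longrightarrow> F x t \<le> ennreal (K * (1 + \<bar>x\<bar> powr p)))"

lemma power_bounded_killed_step:
  assumes F: "power_bounded c p F" and p: "p > 0" and moment: "integrable \<mu> (\<lambda>\<xi>. \<bar>\<xi>\<bar> powr p)"
  shows "power_bounded c p (killed_step \<mu> c F)"
  unfolding power_bounded_def
proof (intro allI impI)
  fix t :: real assume t: "t \<ge> 0"
  then obtain K where K: "K \<ge> 0" "\<And>y. in_domain c y (t + 1) \<Longrightarrow> F y (t + 1) \<le> ennreal (K * (1 + \<bar>y\<bar> powr p))"
    using F unfolding power_bounded_def by (metis add_nonneg_nonneg zero_le_one)
  define m where "m = (LINT \<xi>|\<mu>. \<bar>\<xi>\<bar> powr p)"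
  have m: "m \<ge> 0" unfolding m_def by (rule integral_nonneg_AE) simp
  define K' where "K' = K * (1 + 2 powr p * (m + 1))"
  have K': "K' \<ge> 0" using K m by (simp add: K'_def)
  show "\<exists>K\<ge>0. \<forall>x. in_domain c x t \<longrightarrow> killed_step \<mu> c F x t \<le> ennreal (K * (1 + \<bar>x\<bar> powr p))"
  proof (intro exI[of _ K'] conjI K' allI impI)
    fix x
    have tri: "\<bar>x + \<xi>\<bar> powr p \<le> 2 powr p * (\<bar>x\<bar> powr p + \<bar>\<xi>\<bar> powr p)" for \<xi>
    proof -
      have "\<bar>x + \<xi>\<bar> powr p \<le> (2 * max \<bar>x\<bar> \<bar>\<xi>\<bar>) powr p" using p by (intro powr_mono2) auto
      also have "\<dots> = 2 powr p * max \<bar>x\<bar> \<bar>\<xi>\<bar> powr p" by (simp add: powr_mult)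
      also have "max \<bar>x\<bar> \<bar>\<xi>\<bar> powr p \<le> \<bar>x\<bar> powr p + \<bar>\<xi>\<bar> powr p" by (simp add: max_def)
      finally show ?thesis by simp
    qed
    have "killed_step \<mu> c F x t \<le> (\<integral>\<^sup>+\<xi>. ennreal (K * (1 + 2 powr p * (\<bar>x\<bar> powr p + \<bar>\<xi>\<bar> powr p))) \<partial>\<mu>)"
      unfolding killed_step_def
    proof (intro nn_integral_mono)
      fix \<xi>
      show "F (x + \<xi>) (t + 1) * indicator {c * sqrt (t + 1)<..} (x + \<xi>)
          \<le> ennreal (K * (1 + 2 powr p * (\<bar>x\<bar> powr p + \<bar>\<xi>\<bar> powr p)))"
      proof (cases "in_domain c (x + \<xi>) (t + 1)")
        case True
        have "F (x + \<xi>) (t + 1) \<le> ennreal (K * (1 + \<bar>x + \<xi>\<bar> powr p))" by (rule K(2)[OF True])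
        also have "\<dots> \<le> ennreal (K * (1 + 2 powr p * (\<bar>x\<bar> powr p + \<bar>\<xi>\<bar> powr p)))"
          using tri[of \<xi>] K(1) by (intro ennreal_leI mult_left_mono) auto
        finally show ?thesis using True by simp
      qed simp
    qed
    also have "\<dots> = ennreal (LINT \<xi>|\<mu>. K * (1 + 2 powr p * (\<bar>x\<bar> powr p + \<bar>\<xi>\<bar> powr p)))"
      using moment K(1) by (intro nn_integral_eq_integral) auto
    also have "(LINT \<xi>|\<mu>. K * (1 + 2 powr p * (\<bar>x\<bar> powr p + \<bar>\<xi>\<bar> powr p)))
        = K * (1 + 2 powr p * (\<bar>x\<bar> powr p + m))"
      using moment by (simp add: m_def prob_space)
    also have "\<dots> \<le> K' * (1 + \<bar>x\<bar> powr p)"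
    proof -
      have key: "1 + w * (z + m) \<le> (1 + w * (m + 1)) * (1 + z)" if "0 \<le> z" "0 \<le> w" for z w :: real
      proof -
        have "(1 + w * (m + 1)) * (1 + z) - (1 + w * (z + m)) = z + w + w * m * z" by (simp add: algebra_simps)
        moreover have "0 \<le> z + w + w * m * z" using that m by simp
        ultimately show ?thesis by linarith
      qed
      have "1 + 2 powr p * (\<bar>x\<bar> powr p + m) \<le> (1 + 2 powr p * (m + 1)) * (1 + \<bar>x\<bar> powr p)"
        by (rule key) auto
      from mult_left_mono[OF this K(1)] show ?thesis by (simp add: K'_def mult.assoc)
    qed
    finally show "killed_step \<mu> c F x t \<le> ennreal (K' * (1 + \<bar>x\<bar> powr p))"
      by (simp add: ennreal_leI)
  qed
qed

lemma power_bounded_funpow: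
  assumes "power_bounded c p F" "p > 0" "integrable \<mu> (\<lambda>\<xi>. \<bar>\<xi>\<bar> powr p)"
  shows "power_bounded c p ((killed_step \<mu> c ^^ n) F)"
  using assms by (induction n) (auto intro: power_bounded_killed_step)

lemma power_bounded_finite:
  assumes "power_bounded c p F" "t \<ge> 0" "in_domain c x t" shows "F x t < \<infinity>"
proof -
  obtain K where "F x t \<le> ennreal (K * (1 + \<bar>x\<bar> powr p))"
    using assms unfolding power_bounded_def by blast
  also have "\<dots> < \<infinity>" by simp
  finally show ?thesis .
qed

end

text \<open>
  The inequalities \<open>P (F\<^sub>0 + h) \<le> F\<^sub>0 + h\<close> and \<open>P (F\<^sub>0 - h) \<ge> F\<^sub>0 - h\<close> for times from \<open>t\<^sub>0\<close> on, without
  subtraction.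
\<close>

locale almost_harmonic_pair = centred_step +
  fixes c p t\<^sub>0 :: real and F\<^sub>0 h :: "real \<Rightarrow> real \<Rightarrow> ennreal"
  assumes p_pos: "p > 0" and moment: "integrable \<mu> (\<lambda>\<xi>. \<bar>\<xi>\<bar> powr p)"
    and measurable_F\<^sub>0: "\<And>t. (\<lambda>x. F\<^sub>0 x t) \<in> borel_measurable borel"
    and measurable_h: "\<And>t. (\<lambda>x. h x t) \<in> borel_measurable borel"
    and bounded_F\<^sub>0: "power_bounded c p F\<^sub>0" and bounded_h: "power_bounded c p h"
    and t\<^sub>0_nonneg: "t\<^sub>0 \<ge> 0"
    and super: "\<And>x t. t \<ge> t\<^sub>0 \<Longrightarrow> in_domain c x t \<Longrightarrow>
      killed_step \<mu> c F\<^sub>0 x t + killed_step \<mu> c h x t \<le> F\<^sub>0 x t + h x t"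
    and sub: "\<And>x t. t \<ge> t\<^sub>0 \<Longrightarrow> in_domain c x t \<Longrightarrow>
      F\<^sub>0 x t + killed_step \<mu> c h x t \<le> killed_step \<mu> c F\<^sub>0 x t + h x t"
    and super_h: "\<And>x t. t \<ge> t\<^sub>0 \<Longrightarrow> in_domain c x t \<Longrightarrow> killed_step \<mu> c h x t \<le> h x t"
begin

abbreviation "P \<equiv> killed_step \<mu> c"

definition limit_fn :: "real \<Rightarrow> real \<Rightarrow> ennreal" where
  "limit_fn x t = liminf (\<lambda>n. (P ^^ n) F\<^sub>0 x t)"

abbreviation (input) "majorant \<equiv> (\<lambda>x t. F\<^sub>0 x t + h x t)"

lemma majorant_bounded: "power_bounded c p majorant"
  unfolding power_bounded_def
proof (intro allI impI)
  fix t :: real assume t: "t \<ge> 0"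
  from t bounded_F\<^sub>0 obtain K1 where K1: "K1 \<ge> 0" "\<And>x. in_domain c x t \<Longrightarrow> F\<^sub>0 x t \<le> ennreal (K1 * (1 + \<bar>x\<bar> powr p))"
    unfolding power_bounded_def by blast
  from t bounded_h obtain K2 where K2: "K2 \<ge> 0" "\<And>x. in_domain c x t \<Longrightarrow> h x t \<le> ennreal (K2 * (1 + \<bar>x\<bar> powr p))"
    unfolding power_bounded_def by blast
  note K = K1 K2
  have "F\<^sub>0 x t + h x t \<le> ennreal ((K1 + K2) * (1 + \<bar>x\<bar> powr p))" if "in_domain c x t" for x
    using add_mono[OF K(2)[OF that] K(4)[OF that]] K(1,3)
    by (simp add: distrib_right flip: ennreal_plus)
  then show "\<exists>K\<ge>0. \<forall>x. in_domain c x t \<longrightarrow> F\<^sub>0 x t + h x t \<le> ennreal (K * (1 + \<bar>x\<bar> powr p))"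
    using K(1,3) by (intro exI[of _ "K1 + K2"]) auto
qed

lemma funpow_majorant_finite: "t \<ge> 0 \<Longrightarrow> in_domain c x t \<Longrightarrow> (P ^^ n) majorant x t < \<infinity>"
  by (rule power_bounded_finite[OF power_bounded_funpow[OF majorant_bounded p_pos moment]])

lemma funpow_majorant_le:
  assumes "t \<ge> t\<^sub>0" "in_domain c x t" shows "(P ^^ n) majorant x t \<le> majorant x t"
  using assms
proof (induction n arbitrary: x t)
  case (Suc n)
  have "(P ^^ Suc n) majorant x t \<le> P majorant x t"
    unfolding funpow.simps o_def by (rule killed_step_mono) (use Suc in auto)
  also have "\<dots> = P F\<^sub>0 x t + P h x t"
    by (simp add: killed_step_add[OF measurable_F\<^sub>0 measurable_h])
  also have "\<dots> \<le> majorant x t" using Suc.prems by (rule super)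
  finally show ?case .
qed simp

lemma funpow_F\<^sub>0_le:
  assumes "t + real k \<ge> t\<^sub>0" "in_domain c x t" "n \<ge> k"
  shows "(P ^^ n) F\<^sub>0 x t \<le> (P ^^ k) majorant x t"
proof -
  have "(P ^^ n) F\<^sub>0 x t = (P ^^ k) ((P ^^ (n - k)) F\<^sub>0) x t"
    using assms(3) by (simp flip: funpow_add comp_apply[of "P ^^ k"])
  also have "\<dots> \<le> (P ^^ k) majorant x t"
  proof (rule funpow_killed_step_mono[OF _ assms(1,2)])
    fix y s assume s: "s \<ge> t\<^sub>0" "in_domain c y s"
    have "(P ^^ (n - k)) F\<^sub>0 y s \<le> (P ^^ (n - k)) majorant y s"
      using s by (intro funpow_killed_step_mono[of t\<^sub>0]) auto
    also have "\<dots> \<le> majorant y s" using s by (rule funpow_majorant_le)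
    finally show "(P ^^ (n - k)) F\<^sub>0 y s \<le> majorant y s" .
  qed
  finally show ?thesis .
qed

text \<open>
  Applying \<open>P ^^ n\<close> to the inequalities, \<open>u n - v n\<close> increases, \<open>v n\<close> decreases and \<open>u n + v n\<close> stays below the
  majorant, where \<open>u n = (P ^^ n) F\<^sub>0 x t\<close> and \<open>v n = (P ^^ n) h x t\<close>. The bounds for the limit are those of the
  two monotone sequences.
\<close>

lemma limit_late:
  assumes t: "t \<ge> t\<^sub>0" and x: "in_domain c x t"
  shows "(\<lambda>n. (P ^^ n) F\<^sub>0 x t) \<longlonglongrightarrow> limit_fn x t"
    and "F\<^sub>0 x t \<le> limit_fn x t + h x t" and "limit_fn x t \<le> F\<^sub>0 x t + h x t"
proof -
  define u where "u n = (P ^^ n) F\<^sub>0 x t" for n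
  define v where "v n = (P ^^ n) h x t" for n
  have uv: "u n + v n \<le> F\<^sub>0 x t + h x t" for n
    using funpow_majorant_le[OF t x, of n]
    by (simp add: u_def v_def funpow_killed_step_add[OF measurable_F\<^sub>0 measurable_h])
  have fin0: "F\<^sub>0 x t + h x t < \<infinity>" using funpow_majorant_finite[of t x 0] t x t\<^sub>0_nonneg by simp
  have fin: "u n < \<infinity>" "v n < \<infinity>" for n using order_le_less_trans[OF uv fin0] by auto
  have mono: "(P ^^ n) G1 x t \<le> (P ^^ n) G2 x t"
    if "\<And>y s. s \<ge> t\<^sub>0 \<Longrightarrow> in_domain c y s \<Longrightarrow> G1 y s \<le> G2 y s" for n G1 G2
    using that t x by (intro funpow_killed_step_mono[of t\<^sub>0]) auto
  have v_step: "v (Suc n) \<le> v n" for n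
    using mono[of "P h" h n] super_h by (simp add: v_def funpow_swap1)
  have u_step: "u n + v (Suc n) \<le> u (Suc n) + v n" for n
  proof -
    have mP: "(\<lambda>x. P F\<^sub>0 x t) \<in> borel_measurable borel" "(\<lambda>x. P h x t) \<in> borel_measurable borel" for t
      by (intro killed_step_measurable measurable_F\<^sub>0 measurable_h)+
    have "(P ^^ n) (\<lambda>y s. F\<^sub>0 y s + P h y s) x t \<le> (P ^^ n) (\<lambda>y s. P F\<^sub>0 y s + h y s) x t"
      using sub by (intro mono) auto
    then show ?thesis
      unfolding funpow_killed_step_add[OF measurable_F\<^sub>0 mP(2)] funpow_killed_step_add[OF mP(1) measurable_h]
      by (simp add: u_def v_def funpow_swap1)
  qed
  define ur where "ur n = enn2real (u n)" for n
  define vr where "vr n = enn2real (v n)" for n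
  have eq: "u n = ennreal (ur n)" "v n = ennreal (vr n)" for n
    using fin[of n] by (auto simp: ur_def vr_def less_top)
  have nn: "ur n \<ge> 0" "vr n \<ge> 0" for n by (auto simp: ur_def vr_def)
  define B where "B = enn2real (F\<^sub>0 x t + h x t)"
  have B: "F\<^sub>0 x t + h x t = ennreal B" "B \<ge> 0" using fin0 by (auto simp: B_def less_top)
  have uvr: "ur n + vr n \<le> B" for n using uv[of n] nn[of n] B(2) unfolding B(1) eq by (simp flip: ennreal_plus)
  have vr_step: "vr (Suc n) \<le> vr n" for n using v_step[of n] nn unfolding eq by simp
  have ur_step: "ur n + vr (Suc n) \<le> ur (Suc n) + vr n" for n
    using u_step[of n] nn unfolding eq by (simp flip: ennreal_plus)
  have "decseq vr" using vr_step by (intro decseq_SucI)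
  then obtain lv where lv: "vr \<longlonglongrightarrow> lv" using nn(2) decseq_convergent by metis
  have inc: "incseq (\<lambda>n. ur n - vr n)"
    by (intro incseq_SucI) (use ur_step in \<open>simp add: algebra_simps\<close>)
  have "ur n - vr n \<le> B" for n using uvr[of n] nn[of n] by linarith
  then obtain lu where lu: "(\<lambda>n. ur n - vr n) \<longlonglongrightarrow> lu" using incseq_convergent[OF inc] by metis
  from tendsto_add[OF lu lv] have lim_ur: "ur \<longlonglongrightarrow> lu + lv" by simp
  then have lim_u: "u \<longlonglongrightarrow> ennreal (lu + lv)" unfolding eq by (rule tendsto_ennrealI)
  then have lf: "limit_fn x t = ennreal (lu + lv)"
    unfolding limit_fn_def u_def by (intro lim_imp_Liminf) auto
  show "(\<lambda>n. (P ^^ n) F\<^sub>0 x t) \<longlonglongrightarrow> limit_fn x t" using lim_u unfolding lf u_def .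
  have lv0: "lv \<ge> 0" using lv nn(2) by (intro LIMSEQ_le_const) auto
  have l0: "lu + lv \<ge> 0" using lim_ur nn(1) by (intro LIMSEQ_le_const) auto
  have "ur 0 - vr 0 \<le> lu" using incseq_le[OF inc lu] .
  then have "ur 0 \<le> (lu + lv) + vr 0" using lv0 by linarith
  then have "u 0 \<le> limit_fn x t + v 0" unfolding lf eq using nn l0 by (simp flip: ennreal_plus)
  then show "F\<^sub>0 x t \<le> limit_fn x t + h x t" by (simp add: u_def v_def)
  have "ur n \<le> B" for n using uvr[of n] nn[of n] by linarith
  then have "lu + lv \<le> B" by (intro LIMSEQ_le_const2[OF lim_ur]) auto
  then show "limit_fn x t \<le> F\<^sub>0 x t + h x t" unfolding lf B(1) using B by simp
qed

lemma limit_fn_measurable: "(\<lambda>x. limit_fn x t) \<in> borel_measurable borel"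
  unfolding limit_fn_def
  by (intro borel_measurable_liminf funpow_killed_step_measurable measurable_F\<^sub>0)

text \<open>
  Dominated convergence: after \<open>k\<close> further steps with \<open>real k \<ge> t\<^sub>0\<close> the time is late enough for
  the majorant to be superharmonic, so that its \<open>k\<close>-th iterate dominates all later iterates of \<open>F\<^sub>0\<close>.
\<close>

lemma limit_one_step:
  assumes t: "t \<ge> 0" and lim: "\<And>y. in_domain c y (t + 1) \<Longrightarrow> (\<lambda>n. (P ^^ n) F\<^sub>0 y (t + 1)) \<longlonglongrightarrow> limit_fn y (t + 1)"
    and x: "in_domain c x t"
  shows "(\<lambda>n. (P ^^ n) F\<^sub>0 x t) \<longlonglongrightarrow> P limit_fn x t"
proof -
  obtain k :: nat where k: "real k \<ge> t\<^sub>0" using real_arch_simple by blast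
  have "(\<lambda>n. P ((P ^^ (n + k)) F\<^sub>0) x t) \<longlonglongrightarrow> P limit_fn x t"
    unfolding killed_step_def[of \<mu> c _ x t]
  proof (rule nn_integral_dominated_convergence[where
        w = "\<lambda>\<xi>. (P ^^ k) majorant (x + \<xi>) (t + 1) * indicator {c * sqrt (t + 1)<..} (x + \<xi>)"])
    have [measurable]: "(\<lambda>x. (P ^^ n) F\<^sub>0 x (t + 1)) \<in> borel_measurable borel" for n
      by (intro funpow_killed_step_measurable measurable_F\<^sub>0)
    have [measurable]: "(\<lambda>x. (P ^^ n) majorant x (t + 1)) \<in> borel_measurable borel" for n
      by (intro funpow_killed_step_measurable borel_measurable_add measurable_F\<^sub>0 measurable_h)
    have [measurable]: "(\<lambda>x. limit_fn x (t + 1)) \<in> borel_measurable borel" by (rule limit_fn_measurable)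
    show "(\<lambda>\<xi>. (P ^^ (n + k)) F\<^sub>0 (x + \<xi>) (t + 1) * indicator {c * sqrt (t + 1)<..} (x + \<xi>)) \<in> borel_measurable \<mu>" for n
      by measurable
    show "(\<lambda>\<xi>. limit_fn (x + \<xi>) (t + 1) * indicator {c * sqrt (t + 1)<..} (x + \<xi>)) \<in> borel_measurable \<mu>"
      by measurable
    show "(\<lambda>\<xi>. (P ^^ k) majorant (x + \<xi>) (t + 1) * indicator {c * sqrt (t + 1)<..} (x + \<xi>)) \<in> borel_measurable \<mu>"
      by measurable
    show "AE \<xi> in \<mu>. (P ^^ (n + k)) F\<^sub>0 (x + \<xi>) (t + 1) * indicator {c * sqrt (t + 1)<..} (x + \<xi>)
        \<le> (P ^^ k) majorant (x + \<xi>) (t + 1) * indicator {c * sqrt (t + 1)<..} (x + \<xi>)" for n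
      using funpow_F\<^sub>0_le[of "t + 1" k _ "n + k"] t k by (intro AE_I2) (auto simp: indicator_def)
    show "(\<integral>\<^sup>+\<xi>. (P ^^ k) majorant (x + \<xi>) (t + 1) * indicator {c * sqrt (t + 1)<..} (x + \<xi>) \<partial>\<mu>) < \<infinity>"
      using funpow_majorant_finite[OF t x, of "Suc k"] by (simp add: killed_step_def[of \<mu> c _ x t])
    have "(\<lambda>n. (P ^^ (n + k)) F\<^sub>0 (x + \<xi>) (t + 1) * indicator {c * sqrt (t + 1)<..} (x + \<xi>))
        \<longlonglongrightarrow> limit_fn (x + \<xi>) (t + 1) * indicator {c * sqrt (t + 1)<..} (x + \<xi>)" for \<xi>
      using LIMSEQ_ignore_initial_segment[OF lim, of "x + \<xi>" k]
      by (cases "in_domain c (x + \<xi>) (t + 1)") auto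
    then show "AE \<xi> in \<mu>. (\<lambda>n. (P ^^ (n + k)) F\<^sub>0 (x + \<xi>) (t + 1) * indicator {c * sqrt (t + 1)<..} (x + \<xi>))
        \<longlonglongrightarrow> limit_fn (x + \<xi>) (t + 1) * indicator {c * sqrt (t + 1)<..} (x + \<xi>)" by simp
  qed
  then have "(\<lambda>n. (P ^^ (n + Suc k)) F\<^sub>0 x t) \<longlonglongrightarrow> P limit_fn x t" by simp
  then show ?thesis by (rule LIMSEQ_offset)
qed

theorem limit_exists:
  assumes "t \<ge> 0" "in_domain c x t"
  shows "(\<lambda>n. (P ^^ n) F\<^sub>0 x t) \<longlonglongrightarrow> limit_fn x t"
proof -
  obtain k :: nat where k: "real k \<ge> t\<^sub>0" using real_arch_simple by blast
  have "t + real k \<ge> t\<^sub>0" using k assms(1) by simp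
  then show ?thesis using assms
  proof (induction k arbitrary: x t)
    case 0
    then show ?case by (intro limit_late) auto
  next
    case (Suc k)
    have "(\<lambda>n. (P ^^ n) F\<^sub>0 x t) \<longlonglongrightarrow> P limit_fn x t"
      by (rule limit_one_step) (use Suc in auto)
    moreover from this have "limit_fn x t = P limit_fn x t"
      unfolding limit_fn_def[of x t] by (intro lim_imp_Liminf) auto
    ultimately show ?case by simp
  qed
qed

theorem limit_harmonic:
  assumes "t \<ge> 0" "in_domain c x t"
  shows "P limit_fn x t = limit_fn x t"
proof (rule LIMSEQ_unique)
  show "(\<lambda>n. (P ^^ n) F\<^sub>0 x t) \<longlonglongrightarrow> P limit_fn x t"
    by (rule limit_one_step) (use assms limit_exists in auto)
qed (rule limit_exists[OF assms])

lemma limit_funpow_harmonic: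
  assumes "t \<ge> 0" "in_domain c x t"
  shows "(P ^^ n) limit_fn x t = limit_fn x t"
  using assms
proof (induction n arbitrary: x t)
  case (Suc n)
  have "(P ^^ Suc n) limit_fn x t = P limit_fn x t"
    unfolding funpow.simps o_def by (rule killed_step_cong) (use Suc in auto)
  then show ?case using limit_harmonic Suc.prems by simp
qed simp

lemma limit_finite:
  assumes "t \<ge> 0" "in_domain c x t" shows "limit_fn x t < \<infinity>"
proof -
  obtain k :: nat where k: "real k \<ge> t\<^sub>0" using real_arch_simple by blast
  have "limit_fn x t \<le> (P ^^ k) majorant x t"
    by (rule LIMSEQ_le_const2[OF limit_exists[OF assms]]) (use funpow_F\<^sub>0_le[of t k x] k assms in auto)
  then show ?thesis using funpow_majorant_finite[OF assms] order_le_less_trans by blast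
qed

end

section \<open>The random walk and the transition operator\<close>

lemma in_survival_iff:
  "\<omega> \<in> survival M X c a b n \<longleftrightarrow>
     \<omega> \<in> space M \<and> (\<forall>k\<in>{1..n}. c * sqrt (real k + b) < a + walk X k \<omega>)"
proof -
  define S where "S = {enat n |n. n \<ge> 1 \<and> a + walk X n \<omega> \<le> c * sqrt (real n + b)}"
  have "enat n < Inf S \<longleftrightarrow> (\<forall>k. enat k \<in> S \<longrightarrow> n < k)"
  proof
    assume l: "enat n < Inf S"
    show "\<forall>k. enat k \<in> S \<longrightarrow> n < k"
    proof (intro allI impI)
      fix k assume "enat k \<in> S"
      then have "Inf S \<le> enat k" by (rule Inf_lower)
      with l have "enat n < enat k" by (rule order_less_le_trans)
      then show "n < k" by simp
    qed
  next
    assume r: "\<forall>k. enat k \<in> S \<longrightarrow> n < k"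
    have "enat (Suc n) \<le> Inf S"
    proof (rule Inf_greatest)
      fix z assume z: "z \<in> S"
      then obtain k where "z = enat k" by (auto simp: S_def)
      with z r show "enat (Suc n) \<le> z" by auto
    qed
    moreover have "enat n < enat (Suc n)" by simp
    ultimately show "enat n < Inf S" by (rule order_less_le_trans[rotated])
  qed
  also have "\<dots> \<longleftrightarrow> (\<forall>k\<in>{1..n}. c * sqrt (real k + b) < a + walk X k \<omega>)"
  proof -
    have "enat k \<in> S \<longleftrightarrow> k \<ge> 1 \<and> \<not> c * sqrt (real k + b) < a + walk X k \<omega>" for k
      by (auto simp: S_def)
    then show ?thesis by (simp only: atLeastAtMost_iff Ball_def) (meson not_le)
  qed
  finally show ?thesis by (simp add: survival_def exit_time_def S_def)
qed

lemma (in prob_space) nn_integral_indep_var: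
  assumes ind: "indep_var N1 Y N2 Z" and g [measurable]: "g \<in> borel_measurable (N1 \<Otimes>\<^sub>M N2)"
  shows "(\<integral>\<^sup>+\<omega>. g (Y \<omega>, Z \<omega>) \<partial>M) = (\<integral>\<^sup>+\<omega>. (\<integral>\<^sup>+z. g (Y \<omega>, z) \<partial>distr M N2 Z) \<partial>M)"
proof -
  have [measurable]: "Y \<in> measurable M N1" "Z \<in> measurable M N2"
    using ind by (auto dest: indep_var_rv1 indep_var_rv2)
  interpret Z: prob_space "distr M N2 Z" by (rule prob_space_distr) measurable
  have "(\<integral>\<^sup>+\<omega>. g (Y \<omega>, Z \<omega>) \<partial>M) = (\<integral>\<^sup>+z. g z \<partial>distr M (N1 \<Otimes>\<^sub>M N2) (\<lambda>\<omega>. (Y \<omega>, Z \<omega>)))"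
    by (subst nn_integral_distr) auto
  also have "\<dots> = (\<integral>\<^sup>+z. g z \<partial>(distr M N1 Y \<Otimes>\<^sub>M distr M N2 Z))"
    using ind by (simp add: indep_var_distribution_eq)
  also have "\<dots> = (\<integral>\<^sup>+y. (\<integral>\<^sup>+z. g (y, z) \<partial>distr M N2 Z) \<partial>distr M N1 Y)"
    by (subst Z.nn_integral_fst[symmetric]) (auto cong: measurable_cong_sets)
  also have "\<dots> = (\<integral>\<^sup>+\<omega>. (\<integral>\<^sup>+z. g (Y \<omega>, z) \<partial>distr M N2 Z) \<partial>M)"
    by (subst nn_integral_distr) auto
  finally show ?thesis .
qed

lemma walk_Suc: "walk X (Suc n) \<omega> = walk X n \<omega> + X (Suc n) \<omega>"
  by (simp add: walk_def)

lemma (in prob_space) survival_measurable: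
  assumes X: "\<And>i. i \<ge> 1 \<Longrightarrow> X i \<in> borel_measurable M"
  shows "walk X n \<in> borel_measurable M" "survival M X c a b n \<in> sets M"
proof -
  have w [measurable]: "walk X k \<in> borel_measurable M" for k
    unfolding walk_def[abs_def] using X by (intro borel_measurable_sum) auto
  then show "walk X n \<in> borel_measurable M" by simp
  have "survival M X c a b n = {\<omega> \<in> space M. \<forall>k\<in>{1..n}. c * sqrt (real k + b) < a + walk X k \<omega>}"
    by (auto simp: in_survival_iff)
  also have "\<dots> \<in> sets M" by measurable
  finally show "survival M X c a b n \<in> sets M" .
qed

text \<open>
  The Markov property, peeling off the last step: given the first \<open>n\<close> steps, the expectation over the step \<open>Suc n\<close>
  turns \<open>F\<close> into \<open>killed_step \<mu> c F\<close>.
\<close>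

lemma (in prob_space) killed_walk_nn_integral:
  assumes ind: "indep_vars (\<lambda>_. borel) X {1..}"
    and dist: "\<And>i. i \<ge> 1 \<Longrightarrow> distr M borel (X i) = \<mu>" and \<mu>: "centred_step \<mu>"
    and F: "\<And>t. (\<lambda>x. F x t) \<in> borel_measurable borel"
  shows "(\<integral>\<^sup>+\<omega>. F (a + walk X n \<omega>) (b + real n) * indicator (survival M X c a b n) \<omega> \<partial>M)
       = (killed_step \<mu> c ^^ n) F a b"
  using F
proof (induction n arbitrary: F)
  case 0
  have "(\<integral>\<^sup>+\<omega>. F (a + walk X 0 \<omega>) (b + real 0) * indicator (survival M X c a b 0) \<omega> \<partial>M) = (\<integral>\<^sup>+\<omega>. F a b \<partial>M)"
    by (intro nn_integral_cong) (auto simp: walk_def in_survival_iff indicator_def)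
  then show ?case by (simp add: emeasure_space_1)
next
  case (Suc n)
  have X: "X i \<in> borel_measurable M" if "i \<ge> 1" for i
    using ind that by (auto simp: indep_vars_def)
  define Y where "Y = (\<lambda>\<omega>. restrict (\<lambda>i. X i \<omega>) {1..n})"
  define Z where "Z = (\<lambda>\<omega>. restrict (\<lambda>i. X i \<omega>) {Suc n})"
  define s where "s = b + real n"
  have "indep_var (Pi\<^sub>M {1..n} (\<lambda>_. borel)) Y (Pi\<^sub>M {Suc n} (\<lambda>_. borel)) (\<lambda>\<omega>. restrict (\<lambda>i. X i \<omega>) {Suc n})"
    unfolding Y_def by (rule indep_var_restrict[OF ind]) auto
  then have indYZ: "indep_var (Pi\<^sub>M {1..n} (\<lambda>_. borel)) Y (Pi\<^sub>M {Suc n} (\<lambda>_. borel)) Z"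
    by (simp add: Z_def)
  have X_meas [measurable]: "X (Suc n) \<in> borel_measurable M" by (rule X) simp
  have Z_meas [measurable]: "Z \<in> measurable M (Pi\<^sub>M {Suc n} (\<lambda>_. borel))" using indYZ by (rule indep_var_rv2)
  \<comment> \<open>the walk and its survival as functions of the vector of the first \<open>n\<close> steps\<close>
  define wk where "wk k y = (\<Sum>i=1..k. y i :: real)" for k and y :: "nat \<Rightarrow> real"
  have wkY: "wk k (Y \<omega>) = walk X k \<omega>" if "k \<le> n" for k \<omega>
    using that by (simp add: wk_def walk_def Y_def)
  define alive where "alive = {y \<in> space (Pi\<^sub>M {1..n} (\<lambda>_. borel)). \<forall>k\<in>{1..n}. c * sqrt (real k + b) < a + wk k y}"
  have wk_meas: "wk k \<in> borel_measurable (Pi\<^sub>M {1..n} (\<lambda>_. borel))" if "k \<le> n" for k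
    unfolding wk_def[abs_def] using that by (intro borel_measurable_sum measurable_component_singleton) auto
  have alive [measurable]: "alive \<in> sets (Pi\<^sub>M {1..n} (\<lambda>_. borel))"
  proof -
    have "{y \<in> space (Pi\<^sub>M {1..n} (\<lambda>_. borel)). c * sqrt (real k + b) < a + wk k y} \<in> sets (Pi\<^sub>M {1..n} (\<lambda>_. borel))"
      if "k \<in> {1..n}" for k
    proof -
      have [measurable]: "wk k \<in> borel_measurable (Pi\<^sub>M {1..n} (\<lambda>_. borel))" using that by (intro wk_meas) simp
      show ?thesis by measurable
    qed
    then show ?thesis unfolding alive_def by (intro sets.sets_Collect_finite_All) auto
  qed
  have Yspace: "Y \<omega> \<in> space (Pi\<^sub>M {1..n} (\<lambda>_. borel))" for \<omega>
    by (simp add: Y_def space_PiM)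
  have surv: "\<omega> \<in> survival M X c a b n \<longleftrightarrow> Y \<omega> \<in> alive" if "\<omega> \<in> space M" for \<omega>
    using that Yspace by (auto simp: in_survival_iff alive_def wkY)
  define g where "g z = F (a + wk n (fst z) + snd z) (s + 1)
      * indicator {c * sqrt (s + 1)<..} (a + wk n (fst z) + snd z) * indicator alive (fst z)" for z
  have g: "g \<in> borel_measurable (Pi\<^sub>M {1..n} (\<lambda>_. borel) \<Otimes>\<^sub>M borel)"
  proof -
    have [measurable]: "wk n \<in> borel_measurable (Pi\<^sub>M {1..n} (\<lambda>_. borel))" by (rule wk_meas) simp
    have [measurable]: "(\<lambda>x. F x (s + 1)) \<in> borel_measurable borel" by (rule Suc.prems)
    show ?thesis unfolding g_def[abs_def] by measurable
  qed
  have "(\<integral>\<^sup>+\<omega>. F (a + walk X (Suc n) \<omega>) (b + real (Suc n)) * indicator (survival M X c a b (Suc n)) \<omega> \<partial>M)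
      = (\<integral>\<^sup>+\<omega>. g (Y \<omega>, X (Suc n) \<omega>) \<partial>M)"
  proof (rule nn_integral_cong)
    fix \<omega> assume \<omega>: "\<omega> \<in> space M"
    have "\<omega> \<in> survival M X c a b (Suc n) \<longleftrightarrow>
        Y \<omega> \<in> alive \<and> c * sqrt (s + 1) < a + walk X n \<omega> + X (Suc n) \<omega>"
      using surv[OF \<omega>] \<omega> by (auto simp: in_survival_iff s_def walk_Suc atLeastAtMostSuc_conv add_ac)
    moreover have bs: "b + real (Suc n) = s + 1" by (simp add: s_def)
    ultimately show "F (a + walk X (Suc n) \<omega>) (b + real (Suc n)) * indicator (survival M X c a b (Suc n)) \<omega>
        = g (Y \<omega>, X (Suc n) \<omega>)"
      unfolding bs by (simp add: g_def wkY walk_Suc indicator_def add.assoc)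
  qed
  also have "\<dots> = (\<integral>\<^sup>+\<omega>. (\<integral>\<^sup>+z. g (Y \<omega>, z) \<partial>\<mu>) \<partial>M)"
  proof -
    have comp: "(\<lambda>z. z (Suc n)) \<in> borel_measurable (Pi\<^sub>M {Suc n} (\<lambda>_. borel))"
      by (rule measurable_component_singleton) simp
    have g': "(\<lambda>w. g (fst w, snd w (Suc n))) \<in> borel_measurable (Pi\<^sub>M {1..n} (\<lambda>_. borel) \<Otimes>\<^sub>M Pi\<^sub>M {Suc n} (\<lambda>_. borel))"
      using measurable_compose[OF measurable_snd comp]
      by (intro measurable_compose[OF _ g] measurable_Pair measurable_fst)
    have "(\<integral>\<^sup>+\<omega>. g (Y \<omega>, X (Suc n) \<omega>) \<partial>M) = (\<integral>\<^sup>+\<omega>. g (Y \<omega>, Z \<omega> (Suc n)) \<partial>M)"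
      by (simp add: Z_def)
    also have "\<dots> = (\<integral>\<^sup>+\<omega>. (\<integral>\<^sup>+z. g (Y \<omega>, z (Suc n)) \<partial>distr M (Pi\<^sub>M {Suc n} (\<lambda>_. borel)) Z) \<partial>M)"
      using nn_integral_indep_var[OF indYZ g'] by simp
    also have "\<dots> = (\<integral>\<^sup>+\<omega>. (\<integral>\<^sup>+z. g (Y \<omega>, z) \<partial>\<mu>) \<partial>M)"
    proof (rule nn_integral_cong)
      fix \<omega>
      have gy: "(\<lambda>x. g (Y \<omega>, x)) \<in> borel_measurable borel"
        by (rule measurable_compose[OF measurable_Pair1'[OF Yspace] g])
      have "(\<integral>\<^sup>+z. g (Y \<omega>, z (Suc n)) \<partial>distr M (Pi\<^sub>M {Suc n} (\<lambda>_. borel)) Z) = (\<integral>\<^sup>+w. g (Y \<omega>, X (Suc n) w) \<partial>M)"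
        by (subst nn_integral_distr[OF Z_meas]) (auto intro: measurable_compose[OF comp gy] simp: Z_def)
      also have "\<dots> = (\<integral>\<^sup>+z. g (Y \<omega>, z) \<partial>distr M borel (X (Suc n)))"
        by (subst nn_integral_distr[OF X_meas]) (simp_all add: gy)
      finally show "(\<integral>\<^sup>+z. g (Y \<omega>, z (Suc n)) \<partial>distr M (Pi\<^sub>M {Suc n} (\<lambda>_. borel)) Z) = (\<integral>\<^sup>+z. g (Y \<omega>, z) \<partial>\<mu>)"
        using dist[of "Suc n"] by simp
    qed
    finally show ?thesis .
  qed
  also have "\<dots> = (\<integral>\<^sup>+\<omega>. killed_step \<mu> c F (a + walk X n \<omega>) (b + real n) * indicator (survival M X c a b n) \<omega> \<partial>M)"
  proof (rule nn_integral_cong)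
    fix \<omega> assume \<omega>: "\<omega> \<in> space M"
    show "(\<integral>\<^sup>+z. g (Y \<omega>, z) \<partial>\<mu>) = killed_step \<mu> c F (a + walk X n \<omega>) (b + real n) * indicator (survival M X c a b n) \<omega>"
      using surv[OF \<omega>] by (cases "Y \<omega> \<in> alive") (simp_all add: g_def wkY killed_step_def s_def)
  qed
  also have "\<dots> = (killed_step \<mu> c ^^ n) (killed_step \<mu> c F) a b"
    by (rule Suc.IH) (rule centred_step.killed_step_measurable[OF \<mu> Suc.prems])
  also have "\<dots> = (killed_step \<mu> c ^^ Suc n) F a b" by (simp add: funpow_swap1)
  finally show ?case .
qed

text \<open>
  The real function \<open>f\<close> is tied to the Borel function \<open>F\<close> above the boundary only, so that the lemma covers
  \<open>W\<close>, which is identified there as the limit of the iterates.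
\<close>

lemma (in prob_space) killed_walk_expectation:
  assumes ind: "indep_vars (\<lambda>_. borel) X {1..}"
    and dist: "\<And>i. i \<ge> 1 \<Longrightarrow> distr M borel (X i) = \<mu>" and \<mu>: "centred_step \<mu>"
    and F: "\<And>t. (\<lambda>x. F x t) \<in> borel_measurable borel"
    and n: "n \<ge> 1" and fF: "\<And>x. in_domain c x (b + real n) \<Longrightarrow> ennreal (f x) = F x (b + real n) \<and> 0 \<le> f x"
    and fin: "(killed_step \<mu> c ^^ n) F a b < \<infinity>"
  shows "set_integrable M (survival M X c a b n) (\<lambda>\<omega>. f (a + walk X n \<omega>))"
    and "(LINT \<omega>:survival M X c a b n|M. f (a + walk X n \<omega>)) = enn2real ((killed_step \<mu> c ^^ n) F a b)"
proof -
  have X: "X i \<in> borel_measurable M" if "i \<ge> 1" for i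
    using ind that by (auto simp: indep_vars_def)
  note [measurable] = survival_measurable[OF X]
  have [measurable]: "(\<lambda>x. F x (b + real n)) \<in> borel_measurable borel" by (rule F)
  define k where "k \<omega> = indicator (survival M X c a b n) \<omega> *\<^sub>R enn2real (F (a + walk X n \<omega>) (b + real n))" for \<omega>
  have dom: "in_domain c (a + walk X n \<omega>) (b + real n)" if "\<omega> \<in> survival M X c a b n" for \<omega>
    using that n by (auto simp: in_survival_iff add.commute)
  have keq: "indicator (survival M X c a b n) \<omega> *\<^sub>R f (a + walk X n \<omega>) = k \<omega>" for \<omega>
  proof (cases "\<omega> \<in> survival M X c a b n")
    case True
    then have "f (a + walk X n \<omega>) = enn2real (F (a + walk X n \<omega>) (b + real n))"
      using fF[OF dom[OF True]] by (metis enn2real_ennreal)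
    then show ?thesis by (simp add: k_def)
  qed (simp add: k_def)
  have kn: "k \<omega> \<ge> 0" for \<omega> by (simp add: k_def)
  have km: "k \<in> borel_measurable M" unfolding k_def[abs_def] by measurable
  have "ennreal (k \<omega>) = F (a + walk X n \<omega>) (b + real n) * indicator (survival M X c a b n) \<omega>" for \<omega>
    using fF[OF dom, of \<omega>] by (auto simp: indicator_def simp flip: keq)
  then have int: "(\<integral>\<^sup>+\<omega>. ennreal (k \<omega>) \<partial>M) = (killed_step \<mu> c ^^ n) F a b"
    using killed_walk_nn_integral[OF ind dist \<mu> F] by simp
  show "set_integrable M (survival M X c a b n) (\<lambda>\<omega>. f (a + walk X n \<omega>))"
    unfolding set_integrable_def keq using int fin kn km by (intro integrableI_nonneg) auto
  show "(LINT \<omega>:survival M X c a b n|M. f (a + walk X n \<omega>)) = enn2real ((killed_step \<mu> c ^^ n) F a b)"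
    unfolding set_lebesgue_integral_def keq using int kn km by (subst integral_eq_nn_integral) auto
qed

section \<open>The harmonic function\<close>

lemma (in centred_step) heat_hermite_power_bounded:
  assumes r: "0 < r" "r \<le> p" and k: "\<And>t. k t \<ge> 0"
  shows "power_bounded c p (\<lambda>x t. ennreal (k t * heat_hermite r x t))"
  unfolding power_bounded_def
proof (intro allI impI)
  fix t :: real assume t: "t \<ge> 0"
  obtain C where C: "C > 0" "\<And>v. v \<ge> c \<Longrightarrow> \<bar>He r v\<bar> \<le> C * (1 + \<bar>v\<bar>) powr r"
    using He_upper_bound by blast
  show "\<exists>K\<ge>0. \<forall>x. in_domain c x t \<longrightarrow> ennreal (k t * heat_hermite r x t) \<le> ennreal (K * (1 + \<bar>x\<bar> powr p))"
  proof (cases "t = 0")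
    case True
    then show ?thesis by (intro exI[of _ 0]) (simp add: heat_hermite_def)
  next
    case False
    then have t0: "t > 0" using t by simp
    define K where "K = k t * (t powr (r / 2) * (C * (2 powr p * (1 + sqrt t powr - p))))"
    have K: "K \<ge> 0" using k C by (simp add: K_def)
    have "k t * heat_hermite r x t \<le> K * (1 + \<bar>x\<bar> powr p)" if "in_domain c x t" for x
    proof -
      define v where "v = \<bar>x\<bar> / sqrt t"
      have v0: "v \<ge> 0" by (simp add: v_def t)
      have "x / sqrt t \<ge> c" using that t0 by (simp add: le_divide_eq)
      then have "He r (x / sqrt t) \<le> C * (1 + v) powr r"
        using C(2)[of "x / sqrt t"] t by (simp add: v_def abs_divide)
      also have "\<dots> \<le> C * (2 powr p * ((1 + sqrt t powr - p) * (1 + \<bar>x\<bar> powr p)))"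
      proof (rule mult_left_mono)
        have "(1 + v) powr r \<le> (1 + v) powr p" using v0 r by (intro powr_mono) auto
        also have "\<dots> \<le> (2 * max 1 v) powr p" using v0 r by (intro powr_mono2) auto
        also have "\<dots> = 2 powr p * max 1 v powr p" by (simp add: powr_mult)
        also have "\<dots> \<le> 2 powr p * (1 + v powr p)" by (intro mult_left_mono) (auto simp: max_def)
        also have "v powr p = sqrt t powr - p * \<bar>x\<bar> powr p"
          using t0 by (simp add: v_def powr_divide powr_minus_divide)
        also have "2 powr p * (1 + sqrt t powr - p * \<bar>x\<bar> powr p) \<le> 2 powr p * ((1 + sqrt t powr - p) * (1 + \<bar>x\<bar> powr p))"
          by (intro mult_left_mono) (auto simp: algebra_simps)
        finally show "(1 + v) powr r \<le> 2 powr p * ((1 + sqrt t powr - p) * (1 + \<bar>x\<bar> powr p))" .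
      qed (use C in simp)
      finally have "He r (x / sqrt t) \<le> C * (2 powr p * ((1 + sqrt t powr - p) * (1 + \<bar>x\<bar> powr p)))" .
      then have "k t * (t powr (r / 2) * He r (x / sqrt t))
          \<le> k t * (t powr (r / 2) * (C * (2 powr p * ((1 + sqrt t powr - p) * (1 + \<bar>x\<bar> powr p)))))"
        using k by (intro mult_left_mono) auto
      then show ?thesis by (simp add: heat_hermite_def K_def mult.assoc)
    qed
    then show ?thesis using K by (intro exI[of _ K]) (auto intro: ennreal_leI)
  qed
qed

lemma heat_hermite_nonneg:
  assumes "\<And>v. v \<ge> c \<Longrightarrow> 0 \<le> He r v" "t \<ge> 0" "in_domain c x t"
  shows "0 \<le> heat_hermite r x t"
proof (cases "t = 0")
  case False
  then have "x / sqrt t \<ge> c" using assms by (simp add: le_divide_eq)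
  then show ?thesis using assms by (simp add: heat_hermite_def)
qed (simp add: heat_hermite_def)

text \<open>
  The two functions of \<open>almost_harmonic\<close> are \<open>F\<^sub>0 + h\<close> and \<open>F\<^sub>0 - h\<close>; their half sum and half difference
  separate the images of \<open>F\<^sub>0\<close> and \<open>h\<close> under one killed step.
\<close>

lemma (in centred_step) heat_hermite_almost_harmonic_pair:
  fixes c \<delta> p :: real
  assumes \<delta>: "0 < \<delta>" "\<delta> \<le> 1" and p: "p > 0"
    and root: "He p c = 0" and pos: "\<And>r v. r < p \<Longrightarrow> v \<ge> c \<Longrightarrow> He r v > 0"
    and nonneg: "\<And>v. v \<ge> c \<Longrightarrow> 0 \<le> He p v"
    and moment: "integrable \<mu> (moment_fn \<delta> p)" "integrable \<mu> (\<lambda>\<xi>. \<bar>\<xi>\<bar> powr p)"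
  obtains q \<gamma> t\<^sub>0 where "0 < \<gamma>" "q = p - 2 * \<gamma>" "t\<^sub>0 \<ge> 1"
    "almost_harmonic_pair \<mu> c p t\<^sub>0 (\<lambda>x t. ennreal (heat_hermite p x t))
       (\<lambda>x t. ennreal (t powr - \<gamma> * heat_hermite q x t))"
proof -
  \<comment> \<open>the first bound keeps \<open>q\<close> positive, the second makes the error exponent \<open>\<gamma> * (3 * p + 11) - \<delta> / 2\<close> negative\<close>
  define \<gamma> where "\<gamma> = min (p / 4) (\<delta> / (4 * (3 * p + 11)))"
  define q where "q = p - 2 * \<gamma>"
  have \<gamma>0: "\<gamma> > 0" using p \<delta> by (simp add: \<gamma>_def)
  have "\<gamma> \<le> \<delta> / (4 * (3 * p + 11))" by (simp add: \<gamma>_def)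
  then have "\<gamma> * (4 * (3 * p + 11)) \<le> \<delta>" using p by (simp add: le_divide_eq)
  then have \<gamma>1: "3 * \<gamma> * (p + 3) + 2 * \<gamma> \<le> \<delta> / 4" by (simp add: algebra_simps)
  moreover have "0 \<le> \<gamma> * p" using \<gamma>0 p by simp
  ultimately have \<gamma>2: "2 * \<gamma> < 1" using \<delta> \<gamma>0 by (simp add: algebra_simps)
  have q: "q > 0" "q < p" using \<gamma>0 p by (auto simp: q_def \<gamma>_def)
  have \<gamma>3: "3 * \<gamma> * (p + 3) + 2 * \<gamma> < \<delta> / 2" using \<gamma>1 \<delta> by linarith
  obtain t\<^sub>0 where t0: "t\<^sub>0 \<ge> 1"
    "\<And>t x. t \<ge> t\<^sub>0 \<Longrightarrow> x > c * sqrt t \<Longrightarrow> integrable \<mu> (\<lambda>\<xi>. killed_sum 1 \<gamma> c p q (x + \<xi>) (t + 1)) \<and>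
       integrable \<mu> (\<lambda>\<xi>. killed_sum (-1) \<gamma> c p q (x + \<xi>) (t + 1)) \<and>
       (LINT \<xi>|\<mu>. killed_sum 1 \<gamma> c p q (x + \<xi>) (t + 1)) \<le> killed_sum 1 \<gamma> c p q x t \<and>
       killed_sum (-1) \<gamma> c p q x t \<le> (LINT \<xi>|\<mu>. killed_sum (-1) \<gamma> c p q (x + \<xi>) (t + 1))"
    using almost_harmonic[OF \<delta> p \<gamma>0 q_def q(1) \<gamma>2 \<gamma>3 root pos nonneg moment(1)] by blast
  define F where "F = (\<lambda>x t. ennreal (heat_hermite p x t))"
  define h where "h = (\<lambda>x t. ennreal (t powr - \<gamma> * heat_hermite q x t))"
  have nnp: "0 \<le> heat_hermite p x t" and nnq: "0 \<le> heat_hermite q x t"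
    if "t \<ge> 0" "in_domain c x t" for x t
    using heat_hermite_nonneg[of c p, OF nonneg] heat_hermite_nonneg[of c q, OF less_imp_le[OF pos[OF q(2)]]] that
    by auto
  have step: "killed_step \<mu> c F x t + killed_step \<mu> c h x t \<le> F x t + h x t \<and>
      F x t + killed_step \<mu> c h x t \<le> killed_step \<mu> c F x t + h x t \<and>
      killed_step \<mu> c h x t \<le> h x t"
    if t: "t \<ge> t\<^sub>0" and x: "in_domain c x t" for x t
  proof -
    define kp where "kp \<xi> = killed_sum 1 \<gamma> c p q (x + \<xi>) (t + 1)" for \<xi>
    define km where "km \<xi> = killed_sum (-1) \<gamma> c p q (x + \<xi>) (t + 1)" for \<xi>
    define I where "I = (LINT \<xi>|\<mu>. kp \<xi>)"
    define J where "J = (LINT \<xi>|\<mu>. km \<xi>)"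
    define Vx where "Vx = heat_hermite p x t"
    define hx where "hx = t powr - \<gamma> * heat_hermite q x t"
    have tt: "t \<ge> 1" using t t0(1) by simp
    have int: "integrable \<mu> kp" "integrable \<mu> km" and IJ: "I \<le> Vx + hx" "Vx - hx \<le> J"
      using t0(2)[OF t x] x by (auto simp: kp_def[abs_def] km_def[abs_def] I_def J_def killed_sum_def Vx_def hx_def)
    have kp0: "0 \<le> (kp \<xi> + km \<xi>) / 2" for \<xi>
      unfolding kp_def km_def using nnp[of "t + 1" "x + \<xi>"] tt by (auto simp: killed_sum_def)
    have "killed_step \<mu> c F x t = (\<integral>\<^sup>+\<xi>. ennreal ((kp \<xi> + km \<xi>) / 2) \<partial>\<mu>)"
      unfolding killed_step_def F_def kp_def km_def
      by (intro nn_integral_cong) (auto simp: killed_sum_def indicator_def)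
    also have "\<dots> = ennreal (LINT \<xi>|\<mu>. (kp \<xi> + km \<xi>) / 2)"
    proof (rule nn_integral_eq_integral)
      show "AE \<xi> in \<mu>. 0 \<le> (kp \<xi> + km \<xi>) / 2" by (intro AE_I2 kp0)
    qed (use int in simp)
    also have "(LINT \<xi>|\<mu>. (kp \<xi> + km \<xi>) / 2) = (I + J) / 2" using int by (simp add: I_def J_def)
    finally have PF: "killed_step \<mu> c F x t = ennreal ((I + J) / 2)" .
    have kq: "(kp \<xi> - km \<xi>) / 2 = (if in_domain c (x + \<xi>) (t + 1)
        then (t + 1) powr - \<gamma> * heat_hermite q (x + \<xi>) (t + 1) else 0)" for \<xi>
      by (simp add: kp_def km_def killed_sum_def)
    have Jle: "J \<le> I" unfolding I_def J_def
    proof (intro integral_mono int)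
      show "km \<xi> \<le> kp \<xi>" for \<xi>
        unfolding kp_def km_def using nnq[of "t + 1" "x + \<xi>"] tt by (auto simp: killed_sum_def)
    qed
    have Ige: "0 \<le> (I + J) / 2"
    proof -
      have "0 \<le> (LINT \<xi>|\<mu>. (kp \<xi> + km \<xi>) / 2)"
        by (intro integral_nonneg_AE AE_I2 kp0)
      then show ?thesis using int by (simp add: I_def J_def)
    qed
    have "killed_step \<mu> c h x t = (\<integral>\<^sup>+\<xi>. ennreal ((kp \<xi> - km \<xi>) / 2) \<partial>\<mu>)"
      unfolding killed_step_def h_def kq
      by (intro nn_integral_cong) (auto simp: indicator_def)
    also have "\<dots> = ennreal (LINT \<xi>|\<mu>. (kp \<xi> - km \<xi>) / 2)"
    proof (rule nn_integral_eq_integral)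
      have "0 \<le> (kp \<xi> - km \<xi>) / 2" for \<xi>
        unfolding kq using nnq[of "t + 1" "x + \<xi>"] tt by auto
      then show "AE \<xi> in \<mu>. 0 \<le> (kp \<xi> - km \<xi>) / 2" by simp
    qed (use int in simp)
    also have "(LINT \<xi>|\<mu>. (kp \<xi> - km \<xi>) / 2) = (I - J) / 2" using int by (simp add: I_def J_def)
    finally have Ph: "killed_step \<mu> c h x t = ennreal ((I - J) / 2)" .
    have Fx: "F x t = ennreal Vx" "h x t = ennreal hx" by (auto simp: F_def h_def Vx_def hx_def)
    have n: "0 \<le> Vx" "0 \<le> hx" using nnp[of t x] nnq[of t x] tt x by (auto simp: Vx_def hx_def)
    show ?thesis unfolding PF Ph Fx
      using n Jle Ige IJ by (simp flip: ennreal_plus) (simp add: field_simps)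
  qed
  have "almost_harmonic_pair \<mu> c p t\<^sub>0 F h"
  proof unfold_locales
    show "(\<lambda>x. F x t) \<in> borel_measurable borel" "(\<lambda>x. h x t) \<in> borel_measurable borel" for t
      using heat_hermite_measurable[of p t] heat_hermite_measurable[of q t] by (simp_all add: F_def h_def)
    show "power_bounded c p F" "power_bounded c p h"
      using heat_hermite_power_bounded[of p p "\<lambda>_. 1" c] heat_hermite_power_bounded[of q p "\<lambda>t. t powr - \<gamma>" c] p q
      by (simp_all add: F_def h_def)
  qed (use p moment(2) t0(1) step in auto)
  then show ?thesis using \<gamma>0 q_def t0(1) that unfolding F_def h_def by blast
qed

theorem theorem1:
  fixes M :: "'a measure" and \<xi> :: "'a \<Rightarrow> real" and X :: "nat \<Rightarrow> 'a \<Rightarrow> real"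
    and c \<delta> :: real
  assumes "prob_space M"
    and "\<xi> \<in> borel_measurable M"
    and "prob_space.indep_vars M (\<lambda>_. borel) X {1..}"
    and "\<And>i. i \<ge> 1 \<Longrightarrow> distr M borel (X i) = distr M borel \<xi>"
    and "prob_space.expectation M \<xi> = 0"
    and "prob_space.expectation M (\<lambda>\<omega>. (\<xi> \<omega>)\<^sup>2) = 1"
    and "\<delta> > 0" and "integrable M (\<lambda>\<omega>. \<bar>\<xi> \<omega>\<bar> powr (2 + \<delta>))"
    and "integrable M (\<lambda>\<omega>. \<bar>\<xi> \<omega>\<bar> powr min_root c)"
  shows
    "(\<forall>b\<ge>0. \<forall>a>c * sqrt b.
        (\<forall>n. set_integrable M (survival M X c a b n)
               (\<lambda>\<omega>. V (min_root c) (a + walk X n \<omega>) (b + real n))) \<and>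
        convergent (\<lambda>n. LINT \<omega>:survival M X c a b n|M.
               V (min_root c) (a + walk X n \<omega>) (b + real n)) \<and>
        (\<forall>n\<ge>1.
           set_integrable M (survival M X c a b n)
             (\<lambda>\<omega>. W M X c (a + walk X n \<omega>) (b + real n)) \<and>
           W M X c a b =
             (LINT \<omega>:survival M X c a b n|M. W M X c (a + walk X n \<omega>) (b + real n)))) \<and>
     (\<forall>b\<ge>0. mono_on {c * sqrt b<..} (\<lambda>a. W M X c a b)) \<and>
     (\<forall>\<epsilon>>0.
        ((\<lambda>(x, t). W M X c x t / V (min_root c) x t) \<longlongrightarrow> 1)
          (inf (at_top \<times>\<^sub>F at_top) (principal {(x, t). x / sqrt t \<ge> c + \<epsilon>})))"
proof -
  interpret prob_space M by fact
  note [measurable] = assms(2)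
  define p where "p = min_root c"
  define \<mu> where "\<mu> = distr M borel \<xi>"
  \<comment> \<open>the third-order Taylor remainder can only be converted into moments of order at most \<open>3\<close>\<close>
  define \<delta>' where "\<delta>' = min \<delta> 1"
  have p: "p > 0" and root: "He p c = 0"
    and pos: "\<And>r v. r < p \<Longrightarrow> v \<ge> c \<Longrightarrow> He r v > 0"
    using min_root_pos[of c] psi_min_root[of c] psi_pos_below_min_root[where c = c]
    by (auto simp: p_def psi_eq_He)
  have incr: "\<And>x y. c \<le> x \<Longrightarrow> x < y \<Longrightarrow> He p x < He p y"
    using psi_min_root_increasing by (auto simp: p_def psi_eq_He)
  have nonneg: "\<And>v. v \<ge> c \<Longrightarrow> 0 \<le> He p v"
    using incr[of c] root by (metis less_eq_real_def)
  have \<delta>': "0 < \<delta>'" "\<delta>' \<le> 1" using assms(7) by (auto simp: \<delta>'_def)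
  have low_moment: "integrable M (\<lambda>\<omega>. \<bar>\<xi> \<omega>\<bar> powr e)" if "0 \<le> e" "e \<le> 2 + \<delta>" for e
  proof (rule Bochner_Integration.integrable_bound)
    show "integrable M (\<lambda>\<omega>. 1 + \<bar>\<xi> \<omega>\<bar> powr (2 + \<delta>))" using assms(8) by simp
    have "\<bar>z\<bar> powr e \<le> 1 + \<bar>z\<bar> powr (2 + \<delta>)" for z :: real
    proof (cases "\<bar>z\<bar> \<le> 1")
      case True
      then have "\<bar>z\<bar> powr e \<le> 1" using that by (simp add: powr_le1)
      then show ?thesis by (simp add: add_increasing2)
    next
      case False
      then have "\<bar>z\<bar> powr e \<le> \<bar>z\<bar> powr (2 + \<delta>)" using that by (intro powr_mono) auto
      then show ?thesis by simp
    qed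
    then show "AE \<omega> in M. norm (\<bar>\<xi> \<omega>\<bar> powr e) \<le> norm (1 + \<bar>\<xi> \<omega>\<bar> powr (2 + \<delta>))"
      by (auto simp: abs_of_nonneg)
  qed simp
  have step: "centred_step \<mu>"
  proof (intro centred_step.intro centred_step_axioms.intro)
    show "prob_space \<mu>" unfolding \<mu>_def by (rule prob_space_distr) simp
    show "sets \<mu> = sets borel" by (simp add: \<mu>_def)
    have "integrable M \<xi>"
      by (rule Bochner_Integration.integrable_bound[OF low_moment[of 1]]) (use assms(7) in auto)
    then show "integrable \<mu> (\<lambda>x. x)" by (simp add: \<mu>_def integrable_distr_eq)
    show "(LINT x|\<mu>. x) = 0" using assms(5) by (simp add: \<mu>_def integral_distr)
    have "integrable M (\<lambda>\<omega>. (\<xi> \<omega>)\<^sup>2)" using low_moment[of 2] assms(7) by simp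
    then show "integrable \<mu> (\<lambda>x. x\<^sup>2)" by (simp add: \<mu>_def integrable_distr_eq)
    show "(LINT x|\<mu>. x\<^sup>2) = 1" using assms(6) by (simp add: \<mu>_def integral_distr)
  qed
  interpret S: centred_step \<mu> by (rule step)
  have mom_p: "integrable \<mu> (\<lambda>x. \<bar>x\<bar> powr p)"
    using assms(9) by (simp add: \<mu>_def integrable_distr_eq p_def)
  have "integrable M (\<lambda>\<omega>. \<bar>\<xi> \<omega>\<bar> powr max p (2 + \<delta>'))"
    using assms(9) low_moment[of "2 + \<delta>'"] \<delta>' by (cases "p \<le> 2 + \<delta>'") (auto simp: p_def \<delta>'_def max_def)
  then have mom: "integrable \<mu> (moment_fn \<delta>' p)"
    unfolding moment_fn_def \<mu>_def using low_moment[of "2 + \<delta>'"] \<delta>'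
    by (intro Bochner_Integration.integrable_add) (auto simp: integrable_distr_eq \<delta>'_def)
  obtain q \<gamma> t\<^sub>0 where \<gamma>: "0 < \<gamma>" "q = p - 2 * \<gamma>" "t\<^sub>0 \<ge> 1" and
    pair: "almost_harmonic_pair \<mu> c p t\<^sub>0 (\<lambda>x t. ennreal (heat_hermite p x t))
       (\<lambda>x t. ennreal (t powr - \<gamma> * heat_hermite q x t))"
    using S.heat_hermite_almost_harmonic_pair[OF \<delta>' p root pos nonneg mom mom_p] by blast
  define F where "F = (\<lambda>x t. ennreal (heat_hermite p x t))"
  define h where "h = (\<lambda>x t. ennreal (t powr - \<gamma> * heat_hermite q x t))"
  interpret H: almost_harmonic_pair \<mu> c p t\<^sub>0 F h using pair unfolding F_def h_def .
  define L where "L = H.limit_fn"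
  have dist: "\<And>i. i \<ge> 1 \<Longrightarrow> distr M borel (X i) = \<mu>" using assms(4) by (simp add: \<mu>_def)
  have V_eq: "V p x t = heat_hermite p x t" if "t \<noteq> 0" for x t
    using that by (simp add: V_def heat_hermite_def psi_eq_He)
  have hnn: "0 \<le> heat_hermite p x t" if "t \<ge> 0" "in_domain c x t" for x t
    using heat_hermite_nonneg[OF nonneg that] .
  have fin: "(killed_step \<mu> c ^^ n) F a b < \<infinity>" if "b \<ge> 0" "in_domain c a b" for a b n
    using S.power_bounded_finite[OF S.power_bounded_funpow[OF H.bounded_F\<^sub>0 p mom_p] that] .
  have expect: "set_integrable M (survival M X c a b n) (\<lambda>\<omega>. V p (a + walk X n \<omega>) (b + real n))"
      "(LINT \<omega>:survival M X c a b n|M. V p (a + walk X n \<omega>) (b + real n))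
        = enn2real ((killed_step \<mu> c ^^ n) F a b)"
    if "b \<ge> 0" "in_domain c a b" "n \<ge> 1" for a b n
  proof -
    have "ennreal (V p x (b + real n)) = F x (b + real n) \<and> 0 \<le> V p x (b + real n)"
      if "in_domain c x (b + real n)" for x
      using \<open>b \<ge> 0\<close> \<open>n \<ge> 1\<close> hnn[of "b + real n" x] that by (simp add: V_eq F_def)
    note this = killed_walk_expectation[OF assms(3) dist step H.measurable_F\<^sub>0 that(3)
        this fin[OF that(1,2)]]
    then show "set_integrable M (survival M X c a b n) (\<lambda>\<omega>. V p (a + walk X n \<omega>) (b + real n))"
      "(LINT \<omega>:survival M X c a b n|M. V p (a + walk X n \<omega>) (b + real n))
        = enn2real ((killed_step \<mu> c ^^ n) F a b)" by simp_all
  qed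
  have Lfin: "L a b = ennreal (enn2real (L a b))" if "b \<ge> 0" "in_domain c a b" for a b
    using H.limit_finite[OF that] by (simp add: L_def less_top)
  have lim: "(\<lambda>n. LINT \<omega>:survival M X c a b n|M. V p (a + walk X n \<omega>) (b + real n))
      \<longlonglongrightarrow> enn2real (L a b)" if "b \<ge> 0" "in_domain c a b" for a b
  proof -
    have "(\<lambda>n. (killed_step \<mu> c ^^ n) F a b) \<longlonglongrightarrow> ennreal (enn2real (L a b))"
      using H.limit_exists[OF that] Lfin[OF that] by (simp add: L_def)
    then have "(\<lambda>n. enn2real ((killed_step \<mu> c ^^ n) F a b)) \<longlonglongrightarrow> enn2real (L a b)"
      by (rule tendsto_enn2real) simp
    moreover have "\<forall>\<^sub>F n in sequentially. enn2real ((killed_step \<mu> c ^^ n) F a b)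
        = (LINT \<omega>:survival M X c a b n|M. V p (a + walk X n \<omega>) (b + real n))"
      using eventually_ge_at_top[of 1] by eventually_elim (use expect(2)[OF that] in simp)
    ultimately show ?thesis by (rule Lim_transform_eventually)
  qed
  have W_eq: "W M X c a b = enn2real (L a b)" if "b \<ge> 0" "in_domain c a b" for a b
    unfolding W_def p_def[symmetric] using lim[OF that] by (rule limI)
  have X_meas: "X i \<in> borel_measurable M" if "i \<ge> 1" for i
    using assms(3) that by (auto simp: indep_vars_def)
  have part1: "(\<forall>n. set_integrable M (survival M X c a b n) (\<lambda>\<omega>. V p (a + walk X n \<omega>) (b + real n))) \<and>
      convergent (\<lambda>n. LINT \<omega>:survival M X c a b n|M. V p (a + walk X n \<omega>) (b + real n)) \<and>
      (\<forall>n\<ge>1. set_integrable M (survival M X c a b n) (\<lambda>\<omega>. W M X c (a + walk X n \<omega>) (b + real n)) \<and>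
         W M X c a b = (LINT \<omega>:survival M X c a b n|M. W M X c (a + walk X n \<omega>) (b + real n)))"
    if ab: "b \<ge> 0" "in_domain c a b" for a b
  proof (intro conjI allI impI)
    fix n
    show "set_integrable M (survival M X c a b n) (\<lambda>\<omega>. V p (a + walk X n \<omega>) (b + real n))"
    proof (cases "n \<ge> 1")
      case False
      then have "n = 0" by simp
      moreover have "survival M X c a b 0 \<in> sets M" by (rule survival_measurable[OF X_meas])
      then have "integrable M (indicat_real (survival M X c a b 0))"
        by (intro integrable_real_indicator) (auto simp: less_top[symmetric])
      ultimately show ?thesis
        unfolding set_integrable_def by (simp add: walk_def)
    qed (rule expect[OF ab])
  next
    show "convergent (\<lambda>n. LINT \<omega>:survival M X c a b n|M. V p (a + walk X n \<omega>) (b + real n))"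
      using lim[OF ab] by (rule convergentI)
  next
    fix n :: nat assume n: "n \<ge> 1"
    have LW: "ennreal (W M X c x (b + real n)) = L x (b + real n) \<and> 0 \<le> W M X c x (b + real n)"
      if "in_domain c x (b + real n)" for x
      using W_eq[of "b + real n" x] Lfin[of "b + real n" x] that ab by simp
    have PL: "(killed_step \<mu> c ^^ n) L a b = L a b" unfolding L_def by (rule H.limit_funpow_harmonic[OF ab])
    have Lm: "\<And>t. (\<lambda>x. L x t) \<in> borel_measurable borel" unfolding L_def by (rule H.limit_fn_measurable)
    have "(killed_step \<mu> c ^^ n) L a b < \<infinity>" unfolding PL unfolding L_def by (rule H.limit_finite[OF ab])
    note E = killed_walk_expectation[OF assms(3) dist step Lm n LW this]
    show "set_integrable M (survival M X c a b n) (\<lambda>\<omega>. W M X c (a + walk X n \<omega>) (b + real n))"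
      using E(1) by simp
    show "W M X c a b = (LINT \<omega>:survival M X c a b n|M. W M X c (a + walk X n \<omega>) (b + real n))"
      using E(2) PL W_eq[OF ab] by simp
  qed
  have part2: "mono_on {c * sqrt b<..} (\<lambda>a. W M X c a b)" if b: "b \<ge> 0" for b
  proof (rule mono_onI)
    fix a a' assume a: "a \<in> {c * sqrt b<..}" "a' \<in> {c * sqrt b<..}" "a \<le> a'"
    have F_incr: "F x t \<le> F y t" if "t \<ge> 0" "in_domain c x t" "x \<le> y" for x y t
    proof (cases "t = 0")
      case False
      have "He p (x / sqrt t) \<le> He p (y / sqrt t)"
      proof (cases "x = y")
        case False
        then have "x / sqrt t < y / sqrt t" using that \<open>t \<noteq> 0\<close> by (simp add: divide_strict_right_mono)
        moreover have "c \<le> x / sqrt t" using that \<open>t \<noteq> 0\<close> by (simp add: le_divide_eq)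
        ultimately show ?thesis using incr by (simp add: less_imp_le)
      qed simp
      then show ?thesis unfolding F_def heat_hermite_def by (intro ennreal_leI mult_left_mono) auto
    qed (simp add: F_def heat_hermite_def)
    have "L a b \<le> L a' b" unfolding L_def
    proof (rule LIMSEQ_le[OF H.limit_exists H.limit_exists])
      show "\<exists>N. \<forall>n\<ge>N. (killed_step \<mu> c ^^ n) F a b \<le> (killed_step \<mu> c ^^ n) F a' b"
        using funpow_killed_step_increasing[OF F_incr b] a by auto
    qed (use a b in auto)
    then have "enn2real (L a b) \<le> enn2real (L a' b)"
      using H.limit_finite[OF b, of a'] a by (intro enn2real_mono) (auto simp: L_def)
    then show "W M X c a b \<le> W M X c a' b" using W_eq[OF b] a by simp
  qed
  have part3: "((\<lambda>(x, t). W M X c x t / V p x t) \<longlongrightarrow> 1)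
      (inf (at_top \<times>\<^sub>F at_top) (principal {(x, t). x / sqrt t \<ge> c + \<epsilon>}))" if \<epsilon>: "\<epsilon> > 0" for \<epsilon> :: real
  proof -
    define FF where "FF = inf (at_top \<times>\<^sub>F at_top) (principal {(x::real, t::real). x / sqrt t \<ge> c + \<epsilon>})"
    have qp: "q < p" using \<gamma> by simp
    have "He p v > 0" if "v \<ge> c + \<epsilon>" for v using incr[of c v] root that \<epsilon> by simp
    then obtain lp where lp: "lp > 0" "\<And>v. v \<ge> c + \<epsilon> \<Longrightarrow> He p v \<ge> lp * (1 + \<bar>v\<bar>) powr p"
      using He_lower_bound by blast
    obtain Bq where Bq: "Bq > 0" "\<And>v. v \<ge> c + \<epsilon> \<Longrightarrow> \<bar>He q v\<bar> \<le> Bq * (1 + \<bar>v\<bar>) powr q"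
      using He_upper_bound by blast
    have bound: "\<bar>W M X c x t / V p x t - 1\<bar> \<le> Bq / lp * t powr (- (2 * \<gamma>))"
      if t: "t \<ge> t\<^sub>0" and x: "x / sqrt t \<ge> c + \<epsilon>" for x t
    proof -
      define v where "v = x / sqrt t"
      have t1: "t > 0" "t \<ge> 0" using t \<gamma>(3) by auto
      have dom: "in_domain c x t"
      proof -
        have "c < x / sqrt t" using x \<epsilon> by linarith
        then show ?thesis using t1 by (simp add: less_divide_eq)
      qed
      define hx where "hx = t powr - \<gamma> * heat_hermite q x t"
      have vx: "v \<ge> c + \<epsilon>" using x by (simp add: v_def)
      note lpv = lp(2)[OF vx]
      have "lp * (1 + \<bar>v\<bar>) powr p > 0" using lp(1) by simp
      then have Hp: "He p v > 0" using lpv by linarith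
      have Vpos: "V p x t > 0" using t1 Hp by (simp add: V_eq heat_hermite_def v_def)
      have hx0: "hx \<ge> 0" unfolding hx_def
        using heat_hermite_nonneg[of c q, OF less_imp_le[OF pos[OF qp]] t1(2) dom] by simp
      have W0: "W M X c x t \<ge> 0" using W_eq[OF t1(2) dom] by simp
      have LW: "L x t = ennreal (W M X c x t)" using W_eq[OF t1(2) dom] Lfin[OF t1(2) dom] by simp
      have FV: "F x t = ennreal (V p x t)" "h x t = ennreal hx" using t1 by (auto simp: F_def h_def hx_def V_eq)
      have "V p x t \<le> W M X c x t + hx" "W M X c x t \<le> V p x t + hx"
        using H.limit_late(2,3)[OF t dom] Vpos hx0 W0 unfolding FV L_def[symmetric] LW
        by (simp_all flip: ennreal_plus)
      then have "\<bar>W M X c x t - V p x t\<bar> \<le> hx" by linarith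
      then have "\<bar>W M X c x t - V p x t\<bar> / V p x t \<le> hx / V p x t" using Vpos by (simp add: divide_right_mono)
      moreover have "\<bar>W M X c x t / V p x t - 1\<bar> = \<bar>W M X c x t - V p x t\<bar> / V p x t"
      proof -
        have "W M X c x t / V p x t - 1 = (W M X c x t - V p x t) / V p x t" using Vpos by (simp add: diff_divide_distrib)
        then show ?thesis using Vpos by (simp add: abs_divide)
      qed
      moreover have "hx / V p x t \<le> Bq / lp * t powr (- (2 * \<gamma>))"
      proof -
        have "t powr - \<gamma> * t powr (q / 2) = t powr (- (2 * \<gamma>)) * t powr (p / 2)"
          unfolding powr_add[symmetric] \<gamma>(2) by (simp add: field_simps)
        then have "hx = t powr (- (2 * \<gamma>)) * (t powr (p / 2) * He q v)"
          unfolding hx_def heat_hermite_def v_def by (simp add: mult.assoc[symmetric])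
        then have e: "hx / V p x t = t powr (- (2 * \<gamma>)) * (He q v / He p v)"
          using t1 by (simp add: V_eq heat_hermite_def v_def)
        have "He q v / He p v \<le> (Bq * (1 + \<bar>v\<bar>) powr p) / (lp * (1 + \<bar>v\<bar>) powr p)"
        proof (rule frac_le)
          have "He q v \<le> Bq * (1 + \<bar>v\<bar>) powr q" using Bq(2)[OF vx] by simp
          also have "\<dots> \<le> Bq * (1 + \<bar>v\<bar>) powr p" using Bq(1) qp by (intro mult_left_mono powr_mono) auto
          finally show "He q v \<le> Bq * (1 + \<bar>v\<bar>) powr p" .
        qed (use lp(1) lpv Bq(1) in auto)
        also have "\<dots> = Bq / lp" by simp
        finally have "t powr (- (2 * \<gamma>)) * (He q v / He p v) \<le> t powr (- (2 * \<gamma>)) * (Bq / lp)"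
          by (rule mult_left_mono) simp
        then show ?thesis unfolding e by (simp only: mult.commute)
      qed
      ultimately show ?thesis by linarith
    qed
    have snd: "filterlim snd at_top FF"
      unfolding FF_def by (rule filterlim_mono[OF filterlim_snd order_refl inf_le1])
    have ev: "\<forall>\<^sub>F z in FF. snd z \<ge> t\<^sub>0 \<and> fst z / sqrt (snd z) \<ge> c + \<epsilon>"
    proof (rule eventually_conj)
      show "\<forall>\<^sub>F z in FF. snd z \<ge> t\<^sub>0" using snd by (simp add: filterlim_at_top)
      show "\<forall>\<^sub>F z in FF. fst z / sqrt (snd z) \<ge> c + \<epsilon>"
        unfolding FF_def eventually_inf_principal by (auto intro!: always_eventually)
    qed
    have "((\<lambda>z. (case z of (x, t) \<Rightarrow> W M X c x t / V p x t) - 1) \<longlongrightarrow> 0) FF"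
    proof (rule Lim_null_comparison)
      show "\<forall>\<^sub>F z in FF. norm ((case z of (x, t) \<Rightarrow> W M X c x t / V p x t) - 1) \<le> Bq / lp * snd z powr (- (2 * \<gamma>))"
        using ev
      proof eventually_elim
        case (elim z)
        then show ?case using bound[of "snd z" "fst z"] by (cases z) simp
      qed
      show "((\<lambda>z. Bq / lp * snd z powr (- (2 * \<gamma>))) \<longlongrightarrow> 0) FF"
        by (rule tendsto_mult_right_zero[OF tendsto_neg_powr[OF _ snd]]) (use \<gamma> in simp)
    qed
    then show ?thesis unfolding FF_def by (rule LIM_zero_cancel)
  qed
  show ?thesis using part1 part2 part3 unfolding p_def by blast
qed

end
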